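(* Let $0<\lambda<1$. There is a constant $C_\lambda$ that depends on $\lambda$ but not on $r$ such that, for every $r\ge 2$, if $\mathcal{S}^{\mathrm{Fek}}$ denotes the Fekete segments with uniform arc-radius $\rho=\lambda\frac{\pi}{r}$ and arc-midpoints $\mathcal{T}^{\mathrm{Fek}}=\{\cos\tau_1,\dots,\cos\tau_r\}\subset I_\rho=[-\cos\rho,\cos\rho]$, then the norm of the interpolation operator $\Pi_r(\mathcal{S}^{\mathrm{Fek}})$ on $C(I)$, $I=[-1,1]$, satisfies $$\frac12\left(\frac{4}{\pi^2}\ln(r-1)-1\right)\le\|\Pi_r(\mathcal{S}^{\mathrm{Fek}})\|_{\mathrm{op}}\le C_\lambda\ln(r).$$
   Context: Let $I=[-1,1]$, let $C(I)$ carry the sup-norm $\|\cdot\|$, and let $\mathbb{P}_{r-1}$ be the space of polynomials of degree at most $r-1$. Segments with uniform arc-radius $\rho$ ($0<\rho<\pi/2$): sets $\mathcal{S}=\{s_1,\dots,s_r\}$ with $s_i=[\cos(\tau_i+\rho),\cos(\tau_i-\rho)]$, where $\rho\le\tau_1<\dots<\tau_r\le\pi-\rho$. The values $\cos\tau_i$ are the arc-midpoints. Fekete segments with uniform arc-radius $\rho<\pi/r$: the set $\mathcal{S}^{\mathrm{Fek}}$ in this class (with $r$ and $\rho$ fixed) that maximizes $|\det V(\mathcal{S})|$, where $V_{i,j}(\mathcal{S})=\frac{1}{|s_i|}\int_{s_i}B_j(x)\,dx$ for any fixed basis $\{B_1,\dots,B_r\}$ of $\mathbb{P}_{r-1}$.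 Explicitly, its arc-midpoints are the points $\xi_i^{(LL)}\cos\rho$, $i=1,\dots,r$, where $\xi_i^{(LL)}$ are the Legendre-Gauss-Lobatto nodes of order $r$, i.e. the $r$ roots of $(1-x^2)P_{r-1}'(x)$ with $P_{r-1}$ the Legendre polynomial of degree $r-1$. For $f\in C(I)$, $\Pi_r(\mathcal{S}^{\mathrm{Fek}})f$ is the unique polynomial $p\in\mathbb{P}_{r-1}$ with $\frac{1}{|s_i|}\int_{s_i}p(x)\,dx=\frac{1}{|s_i|}\int_{s_i}f(x)\,dx$ for all $s_i\in\mathcal{S}^{\mathrm{Fek}}$, and $\|\Pi_r(\mathcal{S}^{\mathrm{Fek}})\|_{\mathrm{op}}=\sup_{\|f\|\le1}\sup_{x\in I}|\Pi_r(\mathcal{S}^{\mathrm{Fek}})f(x)|$. *)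

theory Defs
  imports "HOL-Analysis.Analysis" "Jordan_Normal_Form.Determinant"
begin

definition arc_segment :: "real \<Rightarrow> real \<Rightarrow> real set" where
  "arc_segment \<rho> t = {cos (t + \<rho>)..cos (t - \<rho>)}"

text \<open>
  A family of \<open>r\<close> segments with uniform arc-radius \<open>\<rho>\<close> is given by the increasing tuple
  of its angles \<open>\<tau> 0 < \<dots> < \<tau> (r - 1)\<close>; values of \<open>\<tau>\<close> outside \<open>{..<r}\<close> are irrelevant.
  Overlapping segments are allowed.
\<close>

definition arc_angles :: "nat \<Rightarrow> real \<Rightarrow> (nat \<Rightarrow> real) \<Rightarrow> bool" where
  "arc_angles r \<rho> \<tau> \<longleftrightarrow> strict_mono_on {..<r} \<tau> \<and> (\<forall>i<r. \<rho> \<le> \<tau> i \<and> \<tau> i \<le> pi - \<rho>)"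

definition arc_segments :: "nat \<Rightarrow> real \<Rightarrow> (nat \<Rightarrow> real) \<Rightarrow> real set set" where
  "arc_segments r \<rho> \<tau> = (\<lambda>i. arc_segment \<rho> (\<tau> i)) ` {..<r}"

definition average :: "real set \<Rightarrow> (real \<Rightarrow> real) \<Rightarrow> real" where
  "average s f = 1 / measure lborel s * integral s f"

definition poly_basis :: "nat \<Rightarrow> (nat \<Rightarrow> real poly) \<Rightarrow> bool" where
  "poly_basis r B \<longleftrightarrow> inj_on B {..<r} \<and> \<not> Modules.module.dependent Polynomial.smult (B ` {..<r}) \<and>
     Modules.module.span Polynomial.smult (B ` {..<r}) = {p. degree p \<le> r - 1}"

text \<open>
  The determinant is the one of Jordan-Normal-Form matrices, whose dimension is a term, so
  rows and columns are indexed by \<open>0, \<dots>, r - 1\<close>.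
\<close>

definition segment_vandermonde ::
    "(nat \<Rightarrow> real poly) \<Rightarrow> nat \<Rightarrow> real \<Rightarrow> (nat \<Rightarrow> real) \<Rightarrow> real mat" where
  "segment_vandermonde B r \<rho> \<tau> =
     mat r r (\<lambda>(i, j). average (arc_segment \<rho> (\<tau> i)) (poly (B j)))"

definition fekete_angles ::
    "(nat \<Rightarrow> real poly) \<Rightarrow> nat \<Rightarrow> real \<Rightarrow> (nat \<Rightarrow> real) \<Rightarrow> bool" where
  "fekete_angles B r \<rho> \<tau> \<longleftrightarrow> arc_angles r \<rho> \<tau> \<and>
     (\<forall>\<sigma>. arc_angles r \<rho> \<sigma> \<longrightarrow>
        \<bar>Determinant.det (segment_vandermonde B r \<rho> \<sigma>)\<bar>
          \<le> \<bar>Determinant.det (segment_vandermonde B r \<rho> \<tau>)\<bar>)"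

definition segment_interpolant :: "nat \<Rightarrow> real set set \<Rightarrow> (real \<Rightarrow> real) \<Rightarrow> real poly" where
  "segment_interpolant r S f =
     (THE p. degree p \<le> r - 1 \<and> (\<forall>s\<in>S. average s (poly p) = average s f))"

definition sup_norm :: "(real \<Rightarrow> real) \<Rightarrow> real" where
  "sup_norm f = (SUP x\<in>{-1..1}. \<bar>f x\<bar>)"

text \<open>
  The supremum over the unit ball is taken in the extended reals, where it is meaningful
  without a boundedness assumption; an upper bound by a real number then asserts boundedness.
\<close>

definition interpolation_op_norm :: "nat \<Rightarrow> real set set \<Rightarrow> ereal" where
  "interpolation_op_norm r S =
     (SUP f\<in>{f. continuous_on {-1..1} f \<and> sup_norm f \<le> 1}.
        ereal (sup_norm (poly (segment_interpolant r S f))))"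

end

theory Submission
  imports Defs "HOL-Complex_Analysis.Cauchy_Integral_Formula"
begin

text \<open>
  In the basis of Chebyshev polynomials of the second kind, averaging over a segment of
  arc-radius \<open>\<rho>\<close> is evaluation at the arc-midpoint after the diagonal operator \<open>M\<close> with
  \<open>M U\<^sub>k\<^sub>-\<^sub>1 = sin (k \<rho>) / (k sin \<rho>) U\<^sub>k\<^sub>-\<^sub>1\<close>. Hence the Fekete midpoints are the Fekete
  points of \<open>[-cos \<rho>, cos \<rho>]\<close>; the first-order conditions say that their node polynomial solves
  the Lobatto differential equation.

  For the upper bound, the interpolant is \<open>M\<^sup>-\<^sup>1 q\<close> with \<open>q\<close> the Lagrange interpolant of the averages.
  Sonin-type energies control the amplitude of the node polynomial, and Fejer's argument with
  Bernstein's inequality separates the nodes, so \<open>q\<close> is \<open>O(ln r)\<close> on \<open>[-cos \<rho>, cos \<rho>]\<close>.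
  It grows by a bounded factor up to \<open>[-1, 1]\<close>. Finally \<open>M\<^sup>-\<^sup>1\<close> is uniformly bounded: its multiplier is
  a multiple of \<open>t / sin t\<close> at \<open>t = k \<rho>\<close>, a power series in \<open>t\<^sup>2\<close> with radius of convergence \<open>\<pi>\<close>,
  while \<open>t\<close> stays below \<open>\<lambda> \<pi>\<close>; powers of \<open>k\<close> are derivatives, which Bernstein's inequality bounds with
  its sharp constant.

  The lower bound holds for every projection onto polynomials of degree at most \<open>r - 1\<close>, by
  Berman's averaging over translations and the Dirichlet kernel.
\<close>

text \<open>The tuple of angles must stay increasing, so maximality of the determinant can only be
  tested against moves of one segment that pass no other. This fixes the outermost segments and
  gives local conditions inside, but no bound by 1 for the Lagrange basis on the whole interval;
  that bound is recovered from the differential equation.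

  The multiplier is diagonal for \<open>chebU\<close>, whereas suprema are visible on cosine sums,
  that is, for \<open>chebT\<close>. Passing between the two means dividing by sin t, which done
  crudely loses a factor of order r near the end points. So sin t stays attached to the polynomial:
  the m-th derivative of the product is a multiple of sin t plus a remainder that is smaller by a
  factor of order r / m and can be absorbed because its sum vanishes at 0 and pi.

  The largest argument of t / sin t is (n + 1) * \<rho> = \<lambda> * pi, for every r. Each use of
  Bernstein's inequality multiplies the argument of the series by the constant in it, so a constant
  above 1 would push it out of the disc of convergence for \<lambda> close to 1.\<close>

hide_const (open) Module.smult

subsection \<open>Bernstein's inequality\<close>

lemma arith_progression_of_second_diff:
  fixes f :: "nat \<Rightarrow> real"
  assumes "\<And>k. 0 < k \<Longrightarrow> k < n \<Longrightarrow> f (Suc k) - 2 * f k + f (k - 1) = 0"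
    and "k \<le> n"
  shows "f k = f 0 + real k * (f 1 - f 0)"
  using \<open>k \<le> n\<close>
proof (induction k rule: less_induct)
  case (less k)
  consider "k = 0" | "k = 1" | j where "k = Suc (Suc j)"
    by (metis One_nat_def nat.exhaust)
  then show ?case
  proof cases
    case 3
    have "f k = 2 * f (Suc j) - f j"
      using assms(1)[of "Suc j"] less.prems 3 by simp
    moreover have "f (Suc j) = f 0 + real (Suc j) * (f 1 - f 0)" "f j = f 0 + real j * (f 1 - f 0)"
      using less.IH[of "Suc j"] less.IH[of j] less.prems 3 by simp_all
    ultimately show ?thesis
      using 3 by (simp add: algebra_simps)
  qed auto
qed

text \<open>These are the 2 n zeros of cos (n t) in one period. With \<open>riesz_weight\<close>
  they make up M. Riesz's formula, which writes the derivative of a trigonometric polynomial of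
  degree n as a combination of 2 n translates.\<close>

definition riesz_node :: "nat \<Rightarrow> nat \<Rightarrow> real" where
  "riesz_node n j = (2 * real j + 1) * pi / (2 * real n)"

definition riesz_weight :: "nat \<Rightarrow> nat \<Rightarrow> real" where
  "riesz_weight n j = 1 / (4 * real n * (sin (riesz_node n j / 2))\<^sup>2)"

lemma sin_half_riesz_node_pos:
  assumes "j < 2 * n" shows "sin (riesz_node n j / 2) > 0"
proof (rule sin_gt_zero)
  have "real (2 * j + 1) < real (4 * n)" using assms by linarith
  then have "2 * real j + 1 < 4 * real n" by simp
  then show "riesz_node n j / 2 < pi" "0 < riesz_node n j / 2"
    using assms by (simp_all add: riesz_node_def divide_less_eq add_nonneg_pos)
qed

lemma riesz_weight_pos: "j < 2 * n \<Longrightarrow> riesz_weight n j > 0"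
  using sin_half_riesz_node_pos[of j n] by (auto simp: riesz_weight_def)

lemma riesz_weight_sin:
  "j < 2 * n \<Longrightarrow> 4 * (sin (riesz_node n j / 2))\<^sup>2 * riesz_weight n j = 1 / real n"
  using sin_half_riesz_node_pos[of j n] by (auto simp: riesz_weight_def field_simps)

text \<open>Consecutive terms differ in phase by m * pi / n. Multiplying by twice the sine of half
  that step makes the sum telescope, and the range of m keeps this sine positive.\<close>

lemma sum_cos_riesz_node:
  assumes "0 < m" "m < 2 * n"
  shows "(\<Sum>j<2*n. cos (real m * riesz_node n j)) = 0"
proof -
  define a where "a = real m * pi / (2 * real n)"
  have n: "n > 0" using assms by auto
  have "0 < a" "a < pi"
    using assms n by (auto simp: a_def field_simps)
  then have sa: "sin a > 0" by (rule sin_gt_zero)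
  have "2 * sin a * cos (real m * riesz_node n j) = sin (2 * real (Suc j) * a) - sin (2 * real j * a)" for j
  proof -
    have e: "real m * riesz_node n j = (2 * real j + 1) * a"
      by (simp add: a_def riesz_node_def)
    have "2 * real (Suc j) * a = (2 * real j + 1) * a + a" "2 * real j * a = (2 * real j + 1) * a - a"
      by (simp_all add: algebra_simps)
    then show ?thesis
      unfolding e by (simp only: sin_add sin_diff) simp
  qed
  then have "2 * sin a * (\<Sum>j<2*n. cos (real m * riesz_node n j))
      = (\<Sum>j<2*n. sin (2 * real (Suc j) * a) - sin (2 * real j * a))"
    by (simp only: sum_distrib_left)
  also have "\<dots> = sin (2 * real (2 * n) * a)"
    by (subst sum_lessThan_telescope) simp
  also have "2 * real (2 * n) * a = 2 * real m * pi"
    using n by (simp add: a_def)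
  finally show ?thesis using sa by (simp add: sin_2npi)
qed

lemma cos_second_diff:
  "cos (real (Suc k) * t) - 2 * cos (real k * t) + cos (real k * t - t) = - 4 * (sin (t / 2))\<^sup>2 * cos (real k * t)"
proof -
  have "cos t = 1 - 2 * (sin (t/2))\<^sup>2" using cos_double_sin[of "t/2"] by simp
  moreover have "real (Suc k) * t = real k * t + t" by (simp add: algebra_simps)
  ultimately show ?thesis by (simp only: cos_add cos_diff) (simp add: algebra_simps)
qed

lemma sin_second_diff:
  "sin (real (Suc k) * t) - 2 * sin (real k * t) + sin (real k * t - t) = - 4 * (sin (t / 2))\<^sup>2 * sin (real k * t)"
proof -
  have "cos t = 1 - 2 * (sin (t/2))\<^sup>2" using cos_double_sin[of "t/2"] by simp
  moreover have "real (Suc k) * t = real k * t + t" by (simp add: algebra_simps)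
  ultimately show ?thesis by (simp only: sin_add sin_diff) (simp add: algebra_simps)
qed

lemma cos_n_riesz_node: "n > 0 \<Longrightarrow> cos (real n * riesz_node n j) = 0"
  unfolding cos_zero_iff
  by (intro disjI1 exI[of _ "2*j+1"]) (auto simp: riesz_node_def)

lemma sin_n_riesz_node:
  assumes "n > 0" shows "sin (real n * riesz_node n j) = (-1) ^ j"
proof -
  have "real n * riesz_node n j = pi / 2 + real j * pi"
    using assms by (simp add: riesz_node_def field_simps)
  then show ?thesis by (simp add: sin_add)
qed

text \<open>Taking second differences in k of the cosine moments \<open>d k\<close> cancels the
  squared sine in the weights and leaves a vanishing node sum. So \<open>d\<close> is affine in k,
  and the value 0 at n together with slope -1 gives \<open>d 0\<close> = n.\<close>

lemma sum_riesz_weight: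
  assumes "n > 0" shows "(\<Sum>j<2*n. riesz_weight n j) = real n"
proof -
  define d where "d k = (\<Sum>j<2*n. riesz_weight n j * cos (real k * riesz_node n j))" for k
  have "d (Suc k) - 2 * d k + d (k - 1) = 0" if "0 < k" "k < 2 * n" for k
  proof -
    have "d (Suc k) - 2 * d k + d (k - 1) = (\<Sum>j<2*n. riesz_weight n j *
        (cos (real (Suc k) * riesz_node n j) - 2 * cos (real k * riesz_node n j)
          + cos (real k * riesz_node n j - riesz_node n j)))"
      using that by (simp add: d_def sum_distrib_left sum_subtractf sum.distrib algebra_simps)
    also have "\<dots> = (\<Sum>j<2*n. (- 1 / real n) * cos (real k * riesz_node n j))"
    proof (rule sum.cong[OF refl])
      fix j assume "j \<in> {..<2*n}"
      then have w: "4 * (sin (riesz_node n j / 2))\<^sup>2 * riesz_weight n j = 1 / real n"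
        by (simp add: riesz_weight_sin)
      have "riesz_weight n j * (- 4 * (sin (riesz_node n j / 2))\<^sup>2 * cos (real k * riesz_node n j))
        = - (4 * (sin (riesz_node n j / 2))\<^sup>2 * riesz_weight n j) * cos (real k * riesz_node n j)"
        by (simp add: algebra_simps)
      then show "riesz_weight n j *
        (cos (real (Suc k) * riesz_node n j) - 2 * cos (real k * riesz_node n j)
          + cos (real k * riesz_node n j - riesz_node n j)) = (- 1 / real n) * cos (real k * riesz_node n j)"
        unfolding cos_second_diff w by simp
    qed
    also have "\<dots> = 0" unfolding sum_distrib_left[symmetric] by (simp add: sum_cos_riesz_node that)
    finally show ?thesis .
  qed
  then have "d n = d 0 + real n * (d 1 - d 0)"
    by (rule arith_progression_of_second_diff[of "2*n"]) auto
  moreover have "d n = 0" using assms by (simp add: d_def cos_n_riesz_node)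
  moreover have "d 1 - d 0 = -1"
  proof -
    have "d 1 - d 0 = (\<Sum>j<2*n. riesz_weight n j * (cos (riesz_node n j) - 1))"
      by (simp add: d_def sum_subtractf algebra_simps)
    also have "\<dots> = (\<Sum>j<2*n. - 1 / (2 * real n))"
    proof (rule sum.cong[OF refl])
      fix j assume "j \<in> {..<2*n}"
      then have w: "4 * (sin (riesz_node n j / 2))\<^sup>2 * riesz_weight n j = 1 / real n"
        by (simp add: riesz_weight_sin)
      have "cos (riesz_node n j) = 1 - 2 * (sin (riesz_node n j / 2))\<^sup>2"
        using cos_double_sin[of "riesz_node n j/2"] by simp
      then have "riesz_weight n j * (cos (riesz_node n j) - 1)
          = - (4 * (sin (riesz_node n j / 2))\<^sup>2 * riesz_weight n j) / 2"
        by simp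
      then show "riesz_weight n j * (cos (riesz_node n j) - 1) = - 1 / (2 * real n)"
        unfolding w by simp
    qed
    finally show ?thesis using assms by simp
  qed
  moreover have "d 0 = (\<Sum>j<2*n. riesz_weight n j)" by (simp add: d_def)
  ultimately show ?thesis by simp
qed

text \<open>Second differences again. Here (-1)^j is the value of sin (n t) at the node, so the
  product of sines becomes cosines of the frequencies n - k and n + k, both strictly between 0 and 2
  n. The values at 0 and n then force slope 1.\<close>

lemma riesz_sum_sin:
  assumes "n > 0" "k \<le> n"
  shows "(\<Sum>j<2*n. (-1) ^ j * riesz_weight n j * sin (real k * riesz_node n j)) = real k"
proof -
  define d where "d k = (\<Sum>j<2*n. (-1) ^ j * riesz_weight n j * sin (real k * riesz_node n j))" for k
  have sd: "d (Suc k) - 2 * d k + d (k - 1) = 0" if "0 < k" "k < n" for k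
  proof -
    have "d (Suc k) - 2 * d k + d (k - 1) = (\<Sum>j<2*n. (-1) ^ j * riesz_weight n j *
        (sin (real (Suc k) * riesz_node n j) - 2 * sin (real k * riesz_node n j)
          + sin (real k * riesz_node n j - riesz_node n j)))"
      using that by (simp add: d_def sum_distrib_left sum_subtractf sum.distrib algebra_simps)
    also have "\<dots> = (\<Sum>j<2*n. (- 1 / (2 * real n)) * (cos (real (n - k) * riesz_node n j) - cos (real (n + k) * riesz_node n j)))"
    proof (rule sum.cong[OF refl])
      fix j assume "j \<in> {..<2*n}"
      then have w: "4 * (sin (riesz_node n j / 2))\<^sup>2 * riesz_weight n j = 1 / real n"
        by (simp add: riesz_weight_sin)
      have "cos (real (n - k) * riesz_node n j) - cos (real (n + k) * riesz_node n j)
        = 2 * (sin (real n * riesz_node n j) * sin (real k * riesz_node n j))"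
        using that by (simp add: of_nat_diff algebra_simps cos_add cos_diff)
      also have "\<dots> = 2 * ((-1)^j * sin (real k * riesz_node n j))"
        using assms by (simp add: sin_n_riesz_node)
      finally have c: "cos (real (n - k) * riesz_node n j) - cos (real (n + k) * riesz_node n j)
         = 2 * ((-1)^j * sin (real k * riesz_node n j))" .
      have "(-1) ^ j * riesz_weight n j * (- 4 * (sin (riesz_node n j / 2))\<^sup>2 * sin (real k * riesz_node n j))
        = - (4 * (sin (riesz_node n j / 2))\<^sup>2 * riesz_weight n j) * ((-1)^j * sin (real k * riesz_node n j))"
        by (simp add: algebra_simps)
      then show "(-1) ^ j * riesz_weight n j *
        (sin (real (Suc k) * riesz_node n j) - 2 * sin (real k * riesz_node n j)
          + sin (real k * riesz_node n j - riesz_node n j))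
        = (- 1 / (2 * real n)) * (cos (real (n - k) * riesz_node n j) - cos (real (n + k) * riesz_node n j))"
        unfolding sin_second_diff c w by simp
    qed
    also have "\<dots> = 0" unfolding sum_distrib_left[symmetric] sum_subtractf
      using that by (subst (1 2) sum_cos_riesz_node) auto
    finally show ?thesis .
  qed
  have lin: "d k = d 0 + real k * (d 1 - d 0)" if "k \<le> n" for k
    using sd that by (rule arith_progression_of_second_diff)
  have d0: "d 0 = 0" by (simp add: d_def)
  have "d n = (\<Sum>j<2*n. riesz_weight n j)"
    using assms by (simp add: d_def sin_n_riesz_node mult_ac flip: power_add mult_2)
  also have "\<dots> = real n" using assms by (simp add: sum_riesz_weight)
  finally have "d 1 = 1" using lin[of n] d0 assms by simp
  then show ?thesis using lin[of k] d0 assms by (simp add: d_def)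
qed

text \<open>The reflection of t to 2 pi - t permutes the nodes and preserves weights and cosines,
  but j and 2 n - 1 - j have opposite parity, so the alternating sign flips.\<close>

lemma riesz_sum_cos:
  assumes "n > 0"
  shows "(\<Sum>j<2*n. (-1) ^ j * riesz_weight n j * cos (real k * riesz_node n j)) = 0"
proof -
  let ?f = "\<lambda>j. (-1) ^ j * riesz_weight n j * cos (real k * riesz_node n j)"
  have f: "?f (2 * n - Suc j) = - ?f j" if "j < 2 * n" for j
  proof -
    have e: "riesz_node n (2 * n - Suc j) = 2 * pi - riesz_node n j"
      using assms that by (simp add: riesz_node_def field_simps of_nat_diff)
    have "sin (riesz_node n (2 * n - Suc j) / 2) = sin (pi - riesz_node n j / 2)"
      unfolding e by (simp add: diff_divide_distrib)
    then have w: "riesz_weight n (2 * n - Suc j) = riesz_weight n j"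
      by (simp add: riesz_weight_def)
    have "cos (real k * riesz_node n (2 * n - Suc j)) = cos (real k * riesz_node n j)"
    proof -
      have "real k * riesz_node n (2 * n - Suc j) = 2 * real k * pi - real k * riesz_node n j"
        unfolding e by (simp add: algebra_simps)
      then show ?thesis
        by (simp only: cos_diff cos_2npi sin_2npi)
    qed
    moreover have "(-1::real) ^ (2 * n - Suc j) = - ((-1) ^ j)"
      using that by (auto simp: minus_one_power_iff)
    ultimately show ?thesis using w by simp
  qed
  have "sum ?f {..<2*n} = (\<Sum>j<2*n. ?f (2 * n - Suc j))"
    by (rule sum.nat_diff_reindex[symmetric])
  also have "\<dots> = - sum ?f {..<2*n}"
    using f by (simp add: sum_negf)
  finally show ?thesis by simp
qed

text \<open>M. Riesz's formula for one harmonic of arbitrary phase. The derivative is written as a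
  phase advance by pi / 2, so that it is again a cosine.\<close>

lemma riesz_interpolation:
  assumes "n > 0" "k \<le> n"
  shows "(\<Sum>j<2*n. (-1) ^ j * riesz_weight n j * cos (real k * (t + riesz_node n j) + a))
     = real k * cos (real k * t + a + pi / 2)"
proof -
  have "(\<Sum>j<2*n. (-1) ^ j * riesz_weight n j * cos (real k * (t + riesz_node n j) + a))
    = (\<Sum>j<2*n. cos (real k * t + a) * ((-1) ^ j * riesz_weight n j * cos (real k * riesz_node n j))
         - sin (real k * t + a) * ((-1) ^ j * riesz_weight n j * sin (real k * riesz_node n j)))"
  proof (rule sum.cong[OF refl])
    fix j
    have "real k * (t + riesz_node n j) + a = (real k * t + a) + real k * riesz_node n j"
      by (simp add: algebra_simps)
    then show "(-1) ^ j * riesz_weight n j * cos (real k * (t + riesz_node n j) + a) =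
        cos (real k * t + a) * ((-1) ^ j * riesz_weight n j * cos (real k * riesz_node n j))
         - sin (real k * t + a) * ((-1) ^ j * riesz_weight n j * sin (real k * riesz_node n j))"
      by (simp only: cos_add) (simp add: algebra_simps)
  qed
  also have "\<dots> = - sin (real k * t + a) * real k"
    unfolding sum_subtractf sum_distrib_left[symmetric]
    by (simp only: riesz_sum_cos[OF assms(1)] riesz_sum_sin[OF assms] mult_zero_right diff_0 minus_mult_left)
  also have "\<dots> = real k * cos (real k * t + a + pi / 2)"
    by (simp add: cos_add)
  finally show ?thesis .
qed

text \<open>The weights are positive with sum n, which gives the sharp constant. Every frequency
  carries its own phase, so the conclusion has the shape of the hypothesis and the inequality can be
  iterated.\<close>

theorem bernstein_inequality:
  fixes A \<alpha> :: "nat \<Rightarrow> real"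
  assumes B: "\<And>t. \<bar>\<Sum>k\<le>n. A k * cos (real k * t + \<alpha> k)\<bar> \<le> B"
  shows "\<bar>\<Sum>k\<le>n. A k * real k * cos (real k * t + \<alpha> k + pi / 2)\<bar> \<le> real n * B"
proof (cases "n = 0")
  case False
  then have n: "n > 0" by simp
  have "(\<Sum>k\<le>n. A k * real k * cos (real k * t + \<alpha> k + pi / 2))
    = (\<Sum>k\<le>n. A k * (\<Sum>j<2*n. (-1) ^ j * riesz_weight n j * cos (real k * (t + riesz_node n j) + \<alpha> k)))"
    by (rule sum.cong) (auto simp: riesz_interpolation[OF n])
  also have "\<dots> = (\<Sum>j<2*n. (-1) ^ j * riesz_weight n j * (\<Sum>k\<le>n. A k * cos (real k * (t + riesz_node n j) + \<alpha> k)))"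
    unfolding sum_distrib_left by (subst sum.swap) (simp add: mult_ac)
  also have "\<bar>\<dots>\<bar> \<le> (\<Sum>j<2*n. riesz_weight n j * B)"
  proof (rule order.trans[OF sum_abs sum_mono])
    fix j assume "j \<in> {..<2*n}"
    then have "riesz_weight n j > 0" by (simp add: riesz_weight_pos)
    then show "\<bar>(-1) ^ j * riesz_weight n j * (\<Sum>k\<le>n. A k * cos (real k * (t + riesz_node n j) + \<alpha> k))\<bar>
        \<le> riesz_weight n j * B"
      using B[of "t + riesz_node n j"] by (simp add: abs_mult)
  qed
  also have "\<dots> = real n * B"
    using n by (simp add: sum_riesz_weight flip: sum_distrib_right)
  finally show ?thesis .
qed auto

subsection \<open>Chebyshev polynomials\<close>

fun chebT :: "nat \<Rightarrow> real poly" where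
  "chebT 0 = 1"
| "chebT (Suc 0) = [:0, 1:]"
| "chebT (Suc (Suc k)) = [:0, 2:] * chebT (Suc k) - chebT k"

text \<open>Obtaining the second kind as a derivative of the first supplies the antiderivative
  needed for averages.\<close>

definition chebU :: "nat \<Rightarrow> real poly" where
  "chebU k = smult (1 / real (Suc k)) (pderiv (chebT (Suc k)))"

lemma chebT_cos: "poly (chebT k) (cos t) = cos (real k * t)"
proof (induction k rule: chebT.induct)
  case (3 k)
  have "cos (real (Suc (Suc k)) * t) + cos (real k * t) = 2 * cos t * cos (real (Suc k) * t)"
  proof -
    have "real (Suc (Suc k)) * t = real (Suc k) * t + t" "real k * t = real (Suc k) * t - t"
      by (simp_all add: algebra_simps)
    then show ?thesis by (simp only: cos_add cos_diff) simp
  qed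
  then show ?case using 3 by (simp add: algebra_simps)
qed auto

lemma chebT_cosh: "poly (chebT k) (cosh t) = cosh (real k * t)"
proof (induction k rule: chebT.induct)
  case (3 k)
  have "cosh (real (Suc (Suc k)) * t) + cosh (real k * t) = 2 * cosh t * cosh (real (Suc k) * t)"
  proof -
    have "real (Suc (Suc k)) * t = real (Suc k) * t + t" "real k * t = real (Suc k) * t - t"
      by (simp_all add: algebra_simps)
    then show ?thesis by (simp only: cosh_add cosh_diff) simp
  qed
  then show ?case using 3 by (simp add: algebra_simps)
qed auto

lemma degree_chebT: "degree (chebT k) = k"
proof (induction k rule: chebT.induct)
  case (3 k)
  have "[:0, 2:] * chebT (Suc k) \<noteq> 0" using 3 by auto
  then have "degree ([:0, 2:] * chebT (Suc k)) = Suc (Suc k)"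
    using 3 by (subst degree_mult_eq) auto
  then show ?case using 3(2)
    by (simp only: chebT.simps diff_conv_add_uminus, subst degree_add_eq_left) auto
qed auto

lemma degree_chebU: "degree (chebU k) = k"
  by (simp add: chebU_def degree_pderiv degree_chebT)

lemma chebU_cos: "sin t * poly (chebU k) (cos t) = sin (real (Suc k) * t)"
proof -
  have "((\<lambda>t. poly (chebT (Suc k)) (cos t)) has_real_derivative
      poly (pderiv (chebT (Suc k))) (cos t) * (- sin t)) (at t)"
    by (rule DERIV_chain2[OF poly_DERIV DERIV_cos])
  moreover have "((\<lambda>t. cos (real (Suc k) * t)) has_real_derivative - sin (real (Suc k) * t) * real (Suc k)) (at t)"
    by (auto intro!: derivative_eq_intros)
  ultimately have "poly (pderiv (chebT (Suc k))) (cos t) * (- sin t) = - sin (real (Suc k) * t) * real (Suc k)"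
    unfolding chebT_cos by (rule DERIV_unique)
  then show ?thesis by (simp add: chebU_def field_simps del: chebT.simps)
qed

text \<open>The zero polynomial also has degree 0, so \<open>b 0\<close> is required to be nonzero;
  for k > 0 the degree already ensures it.\<close>

lemma poly_expansion:
  fixes b :: "nat \<Rightarrow> 'a::field poly"
  assumes "\<And>k. degree (b k) = k" "b 0 \<noteq> 0" "degree p \<le> n"
  obtains a where "p = (\<Sum>k\<le>n. smult (a k) (b k))"
proof -
  have "\<exists>a. p = (\<Sum>k\<le>n. smult (a k) (b k))"
    using assms(3)
  proof (induction n arbitrary: p)
    case 0
    then obtain c where c: "p = [:c:]" using degree_eq_zeroE by auto
    obtain d where d: "b 0 = [:d:]" using assms(1)[of 0] degree_eq_zeroE by blast
    then have "d \<noteq> 0" using assms(2) by auto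
    then show ?case using c d by (intro exI[of _ "\<lambda>_. c / d"]) simp
  next
    case (Suc n)
    have lc: "coeff (b (Suc n)) (Suc n) \<noteq> 0"
      using assms(1)[of "Suc n"] leading_coeff_neq_0[of "b (Suc n)"] by (metis degree_0 nat.distinct(1))
    define c where "c = coeff p (Suc n) / coeff (b (Suc n)) (Suc n)"
    have "degree (p - smult c (b (Suc n))) \<le> n"
    proof (rule degree_le, intro allI impI)
      fix i assume "n < i"
      then consider "i = Suc n" | "Suc n < i" by linarith
      then show "coeff (p - smult c (b (Suc n))) i = 0"
      proof cases
        case 2
        then have "coeff p i = 0" "coeff (b (Suc n)) i = 0"
          using Suc.prems assms(1)[of "Suc n"] by (auto intro!: coeff_eq_0)
        then show ?thesis by simp
      qed (use lc in \<open>simp add: c_def\<close>)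
    qed
    then obtain a where a: "p - smult c (b (Suc n)) = (\<Sum>k\<le>n. smult (a k) (b k))"
      using Suc.IH by blast
    have "(\<Sum>k\<le>Suc n. smult ((a(Suc n := c)) k) (b k)) = (\<Sum>k\<le>n. smult (a k) (b k)) + smult c (b (Suc n))"
      by simp
    then have "p = (\<Sum>k\<le>Suc n. smult ((a(Suc n := c)) k) (b k))"
      by (simp flip: a)
    then show ?case by blast
  qed
  then show ?thesis using that by blast
qed

lemma poly_expansion_zero:
  fixes b :: "nat \<Rightarrow> 'a::field poly"
  assumes "\<And>k. degree (b k) = k" "b 0 \<noteq> 0" "(\<Sum>k\<le>n. smult (a k) (b k)) = 0" "k \<le> n"
  shows "a k = 0"
  using assms(3,4)
proof (induction n)
  case (Suc n)
  have nz: "b (Suc n) \<noteq> 0" using assms(1)[of "Suc n"] by auto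
  have "degree (\<Sum>k\<le>n. smult (a k) (b k)) \<le> n"
    by (rule degree_sum_le) (use assms(1) order.trans[OF degree_smult_le] in auto)
  then have "coeff (\<Sum>k\<le>n. smult (a k) (b k)) (Suc n) = 0" by (intro coeff_eq_0) simp
  then have "a (Suc n) * coeff (b (Suc n)) (Suc n) = 0"
    using arg_cong[OF Suc.prems(1), of "\<lambda>p. coeff p (Suc n)"] by simp
  then have a: "a (Suc n) = 0"
    using assms(1)[of "Suc n"] nz leading_coeff_neq_0[of "b (Suc n)"] by auto
  show ?case
  proof (cases "k = Suc n")
    case False
    then show ?thesis using Suc a by auto
  qed (use a in simp)
qed (use assms(2) in simp)

lemma cheb_expansion:
  assumes "degree p \<le> n"
  obtains a where "p = (\<Sum>k\<le>n. smult (a k) (chebT k))"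
  by (rule poly_expansion[OF degree_chebT _ assms]) auto

lemma trig_lipschitz:
  fixes n :: nat and A \<alpha> :: "nat \<Rightarrow> real"
  defines "f \<equiv> \<lambda>t. \<Sum>k\<le>n. A k * cos (real k * t + \<alpha> k)"
  assumes B: "\<And>t. \<bar>f t\<bar> \<le> B"
  shows "\<bar>f s - f t\<bar> \<le> real n * B * \<bar>s - t\<bar>"
proof -
  have der: "(f has_real_derivative (\<Sum>k\<le>n. A k * real k * cos (real k * t + \<alpha> k + pi / 2))) (at t)" for t
    unfolding f_def by (auto intro!: derivative_eq_intros sum.cong simp: cos_add sin_add algebra_simps)
  have bd: "\<bar>\<Sum>k\<le>n. A k * real k * cos (real k * t + \<alpha> k + pi / 2)\<bar> \<le> real n * B" for t
    by (rule bernstein_inequality) (use B in \<open>simp add: f_def\<close>)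
  have "norm (f s - f t) \<le> real n * B * norm (s - t)"
  proof (rule field_differentiable_bound[of UNIV])
    show "(f has_real_derivative (\<Sum>k\<le>n. A k * real k * cos (real k * z + \<alpha> k + pi / 2))) (at z within UNIV)" for z
      using der by simp
  qed (use bd in auto)
  then show ?thesis by simp
qed

lemma cheb_lipschitz:
  assumes "degree p \<le> n" "\<And>x. \<bar>x\<bar> \<le> 1 \<Longrightarrow> \<bar>poly p x\<bar> \<le> B"
  shows "\<bar>poly p (cos s) - poly p (cos t)\<bar> \<le> real n * B * \<bar>s - t\<bar>"
proof -
  obtain a where a: "p = (\<Sum>k\<le>n. smult (a k) (chebT k))"
    using cheb_expansion[OF assms(1)] .
  have "poly p (cos t) = (\<Sum>k\<le>n. a k * cos (real k * t + 0))" for t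
    by (simp add: a poly_sum chebT_cos)
  then show ?thesis
    using trig_lipschitz[where A = a and \<alpha> = "\<lambda>_. 0" and n = n and B = B and s = s and t = t] assms(2) by (metis abs_cos_le_one)
qed

text \<open>At the half angle the cosine and, by the mean value theorem, the ratio of sine to angle
  are both at least sqrt 2 / 2. The double angle formula multiplies the two.\<close>

lemma half_le_sin:
  assumes "0 \<le> t" "t \<le> pi / 2" shows "t / 2 \<le> sin t"
proof (cases "t = 0")
  case False
  define c where "c = sqrt 2 / 2"
  have c: "c * c = 1 / 2" "c \<ge> 0" by (auto simp: c_def)
  have le: "c \<le> cos z" if "0 \<le> z" "z \<le> t / 2" for z
    unfolding c_def cos_45[symmetric] using assms that by (intro cos_monotone_0_pi_le) auto
  from False assms have "0 < t / 2" by simp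
  from MVT2[OF this, of sin cos] obtain z where z: "0 < z" "z < t / 2" "sin (t/2) - sin 0 = (t/2 - 0) * cos z"
    using DERIV_sin by blast
  have "t / 2 * c \<le> sin (t/2)"
    using z le[of z] assms by (simp add: mult_left_mono)
  then have "(t / 2 * c) * c \<le> sin (t/2) * cos (t/2)"
    using le[of "t/2"] assms c by (intro mult_mono) (auto intro: sin_ge_zero)
  then have "t / 4 \<le> sin (t/2) * cos (t/2)" by (simp add: mult.assoc c)
  then show ?thesis using sin_double[of "t/2"] by simp
qed simp

subsection \<open>Amplitude of solutions of the Lobatto equation\<close>

text \<open>Here y, a, b stand for a solution and its first two derivatives at x, and the left side
  is the derivative of the bracket in the energy \<open>G\<close>. All but the last term recombine
  to x / s times that bracket, which the derivative of the factor sqrt (1 - x^2) cancels.\<close>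

lemma sonin_algebra:
  fixes x s a y N :: real
  assumes "s = 1 - x\<^sup>2" "s \<noteq> 0"
  defines "b \<equiv> - N * y / s"
  shows "2 * a * b + (y * a + x * (a * a + y * b)) / s + x * y * a * (2 * x) / s\<^sup>2
      + (N * (2 * x) / s\<^sup>2 - 2 * x / s ^ 3) * y\<^sup>2 + (N / s - 1 / (2 * s\<^sup>2)) * (2 * y * a)
    = x * (a\<^sup>2 + x * y * a / s + (N / s - 1 / (2 * s\<^sup>2)) * y\<^sup>2) / s - 3 / 2 * x * y\<^sup>2 / s ^ 3"
proof -
  define w where "w = 1 / s"
  have w: "w * (1 - x\<^sup>2) = 1" using assms by (simp add: w_def)
  have e: "z / s = z * w" "z / s\<^sup>2 = z * w\<^sup>2" "z / s ^ 3 = z * w ^ 3" "z / (2 * s\<^sup>2) = z * w\<^sup>2 / 2" for z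
    by (simp_all add: w_def power_divide)
  have "2 * (2 * a * (- N * y * w) + (y * a + x * (a * a + y * (- N * y * w))) * w + x * y * a * (2 * x) * w\<^sup>2
      + (N * (2 * x) * w\<^sup>2 - 2 * x * w ^ 3) * y\<^sup>2 + (N * w - w\<^sup>2 / 2) * (2 * y * a))
    = 2 * (x * (a\<^sup>2 + x * y * a * w + (N * w - w\<^sup>2 / 2) * y\<^sup>2) * w - 3 / 2 * x * y\<^sup>2 * w ^ 3)"
    using w by Groebner_Basis.algebra
  then have "2 * a * (- N * y * w) + (y * a + x * (a * a + y * (- N * y * w))) * w + x * y * a * (2 * x) * w\<^sup>2
      + (N * (2 * x) * w\<^sup>2 - 2 * x * w ^ 3) * y\<^sup>2 + (N * w - 1 * w\<^sup>2 / 2) * (2 * y * a)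
    = x * (a\<^sup>2 + x * y * a * w + (N * w - 1 * w\<^sup>2 / 2) * y\<^sup>2) * w - 3 / 2 * x * y\<^sup>2 * w ^ 3"
    by (simp only: mult_cancel_left mult_1) (simp add: algebra_simps)
  then show ?thesis unfolding b_def e .
qed

text \<open>For N = n (n + 1) this is the equation of (1 - x^2) times the derivative of the n-th
  Legendre polynomial, whose roots are the n + 1 Gauss-Lobatto points.\<close>

locale lobatto_ode =
  fixes y :: "real poly" and N :: real
  assumes ode: "[:1, 0, -1:] * pderiv (pderiv y) = smult (- N) y"
    and N: "N \<ge> 2" and nonzero: "y \<noteq> 0"
begin

definition "y' = pderiv y"
definition "y'' = pderiv y'"

lemma ode_poly: "(1 - x\<^sup>2) * poly y'' x = - N * poly y x"
  using arg_cong[OF ode, of "\<lambda>p. poly p x"]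
  by (simp add: y''_def y'_def algebra_simps power2_eq_square)

lemma ode_solved: "x\<^sup>2 \<noteq> 1 \<Longrightarrow> poly y'' x = - N * poly y x / (1 - x\<^sup>2)"
  using ode_poly[of x] by (simp add: field_simps)

lemma deriv_y: "(poly y has_real_derivative poly y' x) (at x)"
  by (simp add: y'_def poly_DERIV)

lemma deriv_y': "(poly y' has_real_derivative poly y'' x) (at x)"
  by (simp add: y''_def poly_DERIV)

text \<open>The energy \<open>G\<close> at 0. It is the common scale for the size of the solution
  and for its slopes at the roots.\<close>

definition "K = (poly y' 0)\<^sup>2 + (N - 1/2) * (poly y 0)\<^sup>2"

text \<open>
  In the variable \<open>\<theta>\<close> with \<open>x = cos \<theta>\<close>, the function \<open>u = y / sqrt (sin \<theta>)\<close> satisfies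
  \<open>u'' + Q u = 0\<close>; the next two definitions are \<open>Q\<close> and the energy \<open>u'\<^sup>2 + Q u\<^sup>2\<close>.
\<close>

definition "Q x = N + 1/4 - 3 / (4 * (1 - x\<^sup>2))"

definition "G x = sqrt (1 - x\<^sup>2) * ((poly y' x)\<^sup>2 + x * poly y x * poly y' x / (1 - x\<^sup>2)
    + (N / (1 - x\<^sup>2) - 1 / (2 * (1 - x\<^sup>2)\<^sup>2)) * (poly y x)\<^sup>2)"

lemma G_0: "G 0 = K"
  by (simp add: G_def K_def)

text \<open>The summands are the square of the derivative of u and Q u^2. \<open>G\<close> itself is
  defined in expanded form, which is easier to differentiate; this form shows its sign.\<close>

lemma G_eq:
  assumes "\<bar>x\<bar> < 1"
  shows "G x = sqrt (1 - x\<^sup>2) * (poly y' x + x * poly y x / (2 * (1 - x\<^sup>2)))\<^sup>2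
            + Q x * (poly y x)\<^sup>2 * sqrt (1 - x\<^sup>2) / (1 - x\<^sup>2)"
proof -
  have s0: "1 - x\<^sup>2 > 0" using assms by (simp add: abs_square_less_1)
  define s where "s = 1 - x\<^sup>2"
  define w where "w = 1 / s"
  have w: "w * (1 - x\<^sup>2) = 1" using s0 by (simp add: w_def s_def)
  have e: "z / s = z * w" "z / s\<^sup>2 = z * w\<^sup>2" "z / (2 * s\<^sup>2) = z * w\<^sup>2 / 2"
     "z / (2 * s) = z * w / 2"  "z / (4 * s) = z * w / 4" for z
    by (simp_all add: w_def power_divide)
  define a where "a = poly y' x"
  define b where "b = poly y x"
  have x2: "x * (x * w) = w - 1" using w by (simp add: algebra_simps power2_eq_square)
  have "x\<^sup>2 * w\<^sup>2 = w * (x * (x * w))" by (simp add: power2_eq_square)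
  also have "\<dots> = w\<^sup>2 - w" unfolding x2 by (simp add: power2_eq_square algebra_simps)
  finally have "b\<^sup>2 * (x\<^sup>2 * w\<^sup>2) = b\<^sup>2 * (w\<^sup>2 - w)" by simp
  then have E: "a\<^sup>2 + x * b * a * w + (N * w - 1 * w\<^sup>2 / 2) * b\<^sup>2
    = (a + x * b * w / 2)\<^sup>2 + (N + 1/4 - 3 * w / 4) * b\<^sup>2 * w"
    by (simp add: power2_eq_square algebra_simps)
  show ?thesis
    unfolding G_def Q_def s_def[symmetric] e a_def[symmetric] b_def[symmetric] E distrib_left
    by (simp add: mult_ac)
qed

lemma sq_less_1: "\<bar>x\<bar> < 1 \<Longrightarrow> (x::real)\<^sup>2 < 1"
  by (simp add: abs_square_less_1)

text \<open>Because u'' = - Q u, only the variation of Q contributes: the derivative is Q' u^2,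
  which is nonpositive for x >= 0.\<close>

lemma deriv_G:
  assumes "\<bar>x\<bar> < 1"
  shows "(G has_real_derivative - 3 / 2 * x * (poly y x)\<^sup>2 * sqrt (1 - x\<^sup>2) / (1 - x\<^sup>2) ^ 3) (at x)"
proof -
  define s where "s = 1 - x\<^sup>2"
  have s: "s > 0" using assms by (simp add: s_def abs_square_less_1)
  define g where "g x = (poly y' x)\<^sup>2 + x * poly y x * poly y' x / (1 - x\<^sup>2)
    + (N / (1 - x\<^sup>2) - 1 / (2 * (1 - x\<^sup>2)\<^sup>2)) * (poly y x)\<^sup>2" for x
  have G: "G = (\<lambda>x. sqrt (1 - x\<^sup>2) * g x)" by (simp add: G_def g_def fun_eq_iff)
  have b: "poly y'' x = - N * poly y x / s"
    using ode_solved[of x] s by (simp add: s_def)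
  have inv: "((\<lambda>x. c / (1 - x\<^sup>2)) has_real_derivative c * (2 * x) / s\<^sup>2) (at x)" for c :: real
    using s by (auto intro!: derivative_eq_intros simp: s_def power2_eq_square)
  have inv2: "((\<lambda>x. 1 / (2 * (1 - x\<^sup>2)\<^sup>2)) has_real_derivative 2 * x / s ^ 3) (at x)"
  proof -
    have "((\<lambda>x. inverse (2 * (1 - x\<^sup>2)\<^sup>2)) has_real_derivative
       - (inverse (2 * s\<^sup>2) * (2 * (2 * s * (- 2 * x))) * inverse (2 * s\<^sup>2))) (at x)"
      using s by (auto intro!: derivative_eq_intros simp: s_def)
    also have "- (inverse (2 * s\<^sup>2) * (2 * (2 * s * (- 2 * x))) * inverse (2 * s\<^sup>2)) = 2 * x / s ^ 3"
      using s by (simp add: field_simps power2_eq_square power3_eq_cube)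
    finally show ?thesis by (simp add: inverse_eq_divide)
  qed
  have "(g has_real_derivative
     2 * poly y' x * poly y'' x + (poly y x * poly y' x + x * (poly y' x * poly y' x + poly y x * poly y'' x)) / s
      + x * poly y x * poly y' x * (2 * x) / s\<^sup>2
      + (N * (2 * x) / s\<^sup>2 - 2 * x / s ^ 3) * (poly y x)\<^sup>2 + (N / s - 1 / (2 * s\<^sup>2)) * (2 * poly y x * poly y' x)) (at x)"
  proof -
    have 1: "((\<lambda>x. (poly y' x)\<^sup>2) has_real_derivative 2 * poly y' x * poly y'' x) (at x)"
      using DERIV_power[OF deriv_y', of 2] by (simp add: mult_ac)
    have "((\<lambda>x. x * poly y x * poly y' x) has_real_derivative
         (poly y x * poly y' x + x * (poly y' x * poly y' x + poly y x * poly y'' x))) (at x)"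
      using DERIV_mult[OF DERIV_mult[OF DERIV_ident deriv_y] deriv_y'] by (simp add: algebra_simps)
    from DERIV_mult[OF this inv[of 1]]
    have 2: "((\<lambda>x. x * poly y x * poly y' x / (1 - x\<^sup>2)) has_real_derivative
         (poly y x * poly y' x + x * (poly y' x * poly y' x + poly y x * poly y'' x)) / s
          + x * poly y x * poly y' x * (2 * x) / s\<^sup>2) (at x)"
      by (simp add: s_def mult_ac)
    have 3: "((\<lambda>x. (poly y x)\<^sup>2) has_real_derivative 2 * poly y x * poly y' x) (at x)"
      using DERIV_power[OF deriv_y, of 2] by (simp add: mult_ac)
    have 4: "((\<lambda>x. (N / (1 - x\<^sup>2) - 1 / (2 * (1 - x\<^sup>2)\<^sup>2)) * (poly y x)\<^sup>2) has_real_derivative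
       (N * (2 * x) / s\<^sup>2 - 2 * x / s ^ 3) * (poly y x)\<^sup>2 + (N / s - 1 / (2 * s\<^sup>2)) * (2 * poly y x * poly y' x)) (at x)"
      using DERIV_mult[OF DERIV_diff[OF inv[of N] inv2] 3] by (simp add: s_def algebra_simps)
    show ?thesis
      unfolding g_def[abs_def] using DERIV_add[OF DERIV_add[OF 1 2] 4] by (simp add: algebra_simps)
  qed
  also have "2 * poly y' x * poly y'' x + (poly y x * poly y' x + x * (poly y' x * poly y' x + poly y x * poly y'' x)) / s
      + x * poly y x * poly y' x * (2 * x) / s\<^sup>2
      + (N * (2 * x) / s\<^sup>2 - 2 * x / s ^ 3) * (poly y x)\<^sup>2 + (N / s - 1 / (2 * s\<^sup>2)) * (2 * poly y x * poly y' x)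
     = x * g x / s - 3 / 2 * x * (poly y x)\<^sup>2 / s ^ 3"
    unfolding b g_def s_def[symmetric]
    by (rule sonin_algebra) (use s in \<open>auto simp: s_def\<close>)
  finally have g': "(g has_real_derivative x * g x / s - 3 / 2 * x * (poly y x)\<^sup>2 / s ^ 3) (at x)" .
  have r: "((\<lambda>x. sqrt (1 - x\<^sup>2)) has_real_derivative - x / sqrt s) (at x)"
    using s by (auto intro!: derivative_eq_intros simp: s_def field_simps)
  have rs: "x / sqrt s = x * sqrt s / s"
    using s by (simp add: real_div_sqrt field_simps)
  show ?thesis
    unfolding G by (rule DERIV_cong[OF DERIV_mult[OF r g']])
      (use s rs in \<open>simp add: algebra_simps s_def[symmetric]\<close>)
qed

lemma deriv_Q: "\<bar>x\<bar> < 1 \<Longrightarrow> (Q has_real_derivative - 3 / 2 * x / (1 - x\<^sup>2)\<^sup>2) (at x)"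
proof -
  assume "\<bar>x\<bar> < 1"
  define s where "s = 1 - x\<^sup>2"
  have s: "s > 0" using sq_less_1[OF \<open>\<bar>x\<bar> < 1\<close>] by (simp add: s_def)
  have "((\<lambda>x. N + 1/4 - 3 / 4 * inverse (1 - x\<^sup>2)) has_real_derivative
      - (3 / 4 * (- (inverse s * (- 2 * x) * inverse s)))) (at x)"
    using s by (auto intro!: derivative_eq_intros simp: s_def)
  also have "- (3 / 4 * (- (inverse s * (- 2 * x) * inverse s))) = - 3 / 2 * x / s\<^sup>2"
    using s by (simp add: field_simps power2_eq_square)
  finally show ?thesis
    unfolding Q_def[abs_def] s_def by (simp add: inverse_eq_divide)
qed

text \<open>The condition on x keeps away from the turning region, 1 - x^2 < 3 / (4 N + 1), where
  \<open>Q\<close> is negative.\<close>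

lemma Q_ge:
  assumes "\<bar>x\<bar> < 1" "1 - x\<^sup>2 \<ge> 1 / N"
  shows "Q x \<ge> N / 4 + 1 / 4"
proof -
  have "1 / (1 - x\<^sup>2) \<le> N"
    using assms N by (simp add: field_simps sq_less_1)
  then have *: "3 / 4 * (1 / (1 - x\<^sup>2)) \<le> 3 / 4 * N" by (rule mult_left_mono) simp
  have "3 / (4 * s) = 3 / 4 * (1 / s)" for s :: real by simp
  then have "Q x = N + 1/4 - 3 / 4 * (1 / (1 - x\<^sup>2))" by (simp only: Q_def)
  then show ?thesis using * by simp
qed

lemma G_le:
  assumes "0 \<le> x" "x < 1" shows "G x \<le> K"
proof -
  have "G x \<le> G 0"
  proof (rule DERIV_nonpos_imp_nonincreasing[OF \<open>0 \<le> x\<close>])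
    fix t assume t: "0 \<le> t" "t \<le> x"
    then have a: "\<bar>t\<bar> < 1" using assms by auto
    have "t\<^sup>2 < 1" using a by (rule sq_less_1)
    then have "- 3 / 2 * t * (poly y t)\<^sup>2 * sqrt (1 - t\<^sup>2) / (1 - t\<^sup>2) ^ 3 \<le> 0"
      using t by (intro divide_nonpos_pos mult_nonpos_nonneg) auto
    then show "\<exists>D. (G has_real_derivative D) (at t) \<and> D \<le> 0"
      using deriv_G[OF a] by blast
  qed
  then show ?thesis by (simp add: G_0)
qed

text \<open>Sonin's companion energy: G / Q is u^2 plus the square of u' over Q, so its derivative
  is a positive multiple of - Q' and it increases for x >= 0 as long as Q > 0. Between 0 and x the
  factor Q drops at most from N to N / 4.\<close>

lemma G_ge:
  assumes "0 \<le> x" "x < 1" "1 - x\<^sup>2 \<ge> 1 / N" shows "G x \<ge> K / 4"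
proof -
  have "G 0 / Q 0 \<le> G x / Q x"
  proof (rule DERIV_nonneg_imp_nondecreasing[OF \<open>0 \<le> x\<close>])
    fix t assume t: "0 \<le> t" "t \<le> x"
    then have a: "\<bar>t\<bar> < 1" using assms by auto
    have t1: "t\<^sup>2 < 1" using a by (rule sq_less_1)
    have "t\<^sup>2 \<le> x\<^sup>2" using t by (intro power_mono) auto
    then have Qt: "Q t > 0" using Q_ge[OF a] assms N by linarith
    define s where "s = 1 - t\<^sup>2"
    have s: "s > 0" using t1 by (simp add: s_def)
    define A where "A = sqrt s * (poly y' t + t * poly y t / (2 * s))\<^sup>2"
    have Gt: "G t = A + Q t * (poly y t)\<^sup>2 * sqrt s / s"
      unfolding A_def s_def by (rule G_eq[OF a])
    have "((\<lambda>x. G x / Q x) has_real_derivative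
        ((- 3 / 2 * t * (poly y t)\<^sup>2 * sqrt s / s ^ 3) * Q t - G t * (- 3 / 2 * t / s\<^sup>2)) / (Q t * Q t)) (at t)"
      using DERIV_divide[OF deriv_G[OF a] deriv_Q[OF a]] Qt by (simp add: s_def)
    also have "(- 3 / 2 * t * (poly y t)\<^sup>2 * sqrt s / s ^ 3) * Q t - G t * (- 3 / 2 * t / s\<^sup>2)
        = 3 / 2 * t / s\<^sup>2 * A"
      unfolding Gt using s by (simp add: field_simps power2_eq_square power3_eq_cube)
    finally have d: "((\<lambda>x. G x / Q x) has_real_derivative 3 / 2 * t / s\<^sup>2 * A / (Q t * Q t)) (at t)" .
    have "A \<ge> 0" using s by (simp add: A_def)
    then have "3 / 2 * t / s\<^sup>2 * A / (Q t * Q t) \<ge> 0"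
      using s t Qt by (intro divide_nonneg_pos mult_nonneg_nonneg) auto
    then show "\<exists>D. ((\<lambda>x. G x / Q x) has_real_derivative D) (at t) \<and> D \<ge> 0"
      using d by blast
  qed
  moreover have Q0: "Q 0 > 0" "Q 0 \<le> N" using N by (auto simp: Q_def)
  moreover have Qx: "Q x \<ge> N / 4" using Q_ge[of x] assms by simp
  moreover have "K \<ge> 0" using N by (simp add: K_def)
  ultimately have "K / Q 0 * Q x \<le> G x"
    using N by (simp add: G_0 field_simps)
  moreover have "K / Q 0 * Q x \<ge> K / N * (N / 4)"
    using \<open>K \<ge> 0\<close> Q0 Qx N by (intro mult_mono divide_left_mono) auto
  moreover have "K / N * (N / 4) = K / 4" using N by simp
  ultimately show ?thesis by linarith
qed

section \<open>A second energy for the neighbourhood of the end point\<close>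

lemma y_1: "poly y 1 = 0"
  using ode_poly[of 1] N by simp

definition "k = (SOME k. y = [:-1, 1:] * k)"

lemma y_eq_k: "y = [:-1, 1:] * k"
proof -
  have "[:-1, 1:] dvd y" using y_1 poly_eq_0_iff_dvd[of y 1] by simp
  then have "\<exists>k. y = [:-1, 1:] * k" unfolding dvd_def .
  then show ?thesis unfolding k_def by (rule someI_ex)
qed

lemma poly_y_eq_k: "poly y x = (x - 1) * poly k x"
  using arg_cong[OF y_eq_k, of "\<lambda>p. poly p x"] by (simp add: algebra_simps)

lemma poly_y'_eq_k: "poly y' x = poly k x + (x - 1) * poly (pderiv k) x"
proof -
  have "y' = [:-1, 1:] * pderiv k + k * [:1:]"
    unfolding y'_def by (subst y_eq_k, subst pderiv_mult) (simp add: pderiv_pCons)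
  then have "poly y' x = poly ([:-1, 1:] * pderiv k + k * [:1:]) x" by (rule arg_cong)
  then show ?thesis by (simp add: algebra_simps)
qed

lemma ode_k: "(1 + x) * poly y'' x = N * poly k x"
proof -
  have "[:1, -1:] * ([:1, 1:] * y'') = [:1, 0, -1:] * y''"
    by (simp flip: mult.assoc)
  also have "\<dots> = smult (- N) ([:-1, 1:] * k)"
    using ode unfolding y''_def y'_def y_eq_k[symmetric] .
  also have "\<dots> = [:1, -1:] * smult N k"
    by (simp add: poly_eq_poly_eq_iff[symmetric] fun_eq_iff algebra_simps)
  finally have "[:1, 1:] * y'' = smult N k"
    by (simp only: mult_cancel_left) auto
  from arg_cong[OF this, of "\<lambda>p. poly p x"] show ?thesis by (simp add: algebra_simps)
qed

text \<open>
  This is \<open>y'\<^sup>2 + N y\<^sup>2 / (1 - x\<^sup>2)\<close>, which controls the solution near the end point,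
  with the removable singularity at \<open>1\<close> cancelled.
\<close>

definition "H x = (poly y' x)\<^sup>2 + N * ((1 - x) / (1 + x)) * (poly k x)\<^sup>2"

lemma H_1: "H 1 = (poly y' 1)\<^sup>2"
  by (simp add: H_def)

text \<open>Away from 1 this is y^2 times the derivative of N / (1 - x^2), the remaining terms
  cancelling by the equation. Expressed through \<open>k\<close> it holds at 1 as well.\<close>

lemma deriv_H:
  assumes "x > -1"
  shows "(H has_real_derivative 2 * N * (poly k x)\<^sup>2 * x / (1 + x)\<^sup>2) (at x)"
proof -
  define w where "w = 1 / (1 + x)"
  have w: "w * (1 + x) = 1" using assms by (simp add: w_def)
  have y'': "poly y'' x = N * poly k x * w"
    using ode_k[of x] assms by (simp add: w_def field_simps)
  have 1: "((\<lambda>x. (1 - x) / (1 + x)) has_real_derivative - 2 * w\<^sup>2) (at x)"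
    using assms by (auto intro!: derivative_eq_intros simp: w_def power2_eq_square field_simps)
  have "(H has_real_derivative 2 * poly y' x * poly y'' x + (N * (- 2 * w\<^sup>2) * (poly k x)\<^sup>2
      + N * ((1 - x) / (1 + x)) * (2 * poly k x * poly (pderiv k) x))) (at x)"
    unfolding H_def[abs_def]
    by (rule derivative_eq_intros deriv_y' 1 poly_DERIV refl | simp add: algebra_simps)+
  also have "2 * poly y' x * poly y'' x + (N * (- 2 * w\<^sup>2) * (poly k x)\<^sup>2
      + N * ((1 - x) / (1 + x)) * (2 * poly k x * poly (pderiv k) x))
     = 2 * (poly k x + (x - 1) * poly (pderiv k) x) * (N * poly k x * w) + (N * (- 2 * w\<^sup>2) * (poly k x)\<^sup>2
      + N * ((1 - x) * w) * (2 * poly k x * poly (pderiv k) x))"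
    unfolding y'' poly_y'_eq_k by (simp add: w_def)
  also have "\<dots> = 2 * N * (poly k x)\<^sup>2 * x * w\<^sup>2"
    using w by Groebner_Basis.algebra
  also have "\<dots> = 2 * N * (poly k x)\<^sup>2 * x / (1 + x)\<^sup>2"
    by (simp add: w_def power_divide)
  finally show ?thesis .
qed

lemma H_mono:
  assumes "0 \<le> x" "x \<le> 1" shows "H x \<le> H 1"
proof (rule DERIV_nonneg_imp_nondecreasing[OF assms(2)])
  fix t assume "x \<le> t" "t \<le> 1"
  then have "2 * N * (poly k t)\<^sup>2 * t / (1 + t)\<^sup>2 \<ge> 0"
    using N assms by (intro divide_nonneg_nonneg mult_nonneg_nonneg) auto
  then show "\<exists>D. (H has_real_derivative D) (at t) \<and> D \<ge> 0"
    using deriv_H[of t] assms(1) \<open>x \<le> t\<close> by force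
qed

lemma y'_le:
  assumes "0 \<le> x" "x \<le> 1" shows "(poly y' x)\<^sup>2 \<le> (poly y' 1)\<^sup>2"
proof -
  have "(poly y' x)\<^sup>2 \<le> H x" using assms N by (simp add: H_def)
  then show ?thesis using H_mono[OF assms] by (simp add: H_1)
qed

lemma k_le:
  assumes "0 \<le> x" "x \<le> 1" shows "(poly k x)\<^sup>2 \<le> (poly y' 1)\<^sup>2"
proof (cases "x = 1")
  case True
  then show ?thesis by (simp add: poly_y'_eq_k)
next
  case False
  then have "x < 1" using assms by simp
  from MVT2[OF this, of "poly y" "poly y'"] obtain z where
    z: "x < z" "z < 1" "poly y 1 - poly y x = (1 - x) * poly y' z"
    using deriv_y by blast
  then have "(1 - x) * poly k x = (1 - x) * poly y' z"
    using y_1 poly_y_eq_k[of x] by (simp add: algebra_simps)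
  then have "poly k x = poly y' z" using \<open>x < 1\<close> by simp
  then show ?thesis using y'_le[of z] z assms by simp
qed

text \<open>By 4 t <= (1 + t)^2 and the bound of \<open>k\<close> by the end slope, the derivative
  of \<open>H\<close> is at most N / 2 * H 1. So \<open>H\<close> keeps half of its end value within
  distance 1 / N of the end point.\<close>

lemma H_ge:
  assumes "0 \<le> x" "x \<le> 1" shows "H 1 * (1 - N / 2 * (1 - x)) \<le> H x"
proof -
  have "H 1 - N / 2 * H 1 * 1 \<le> H x - N / 2 * H 1 * x"
  proof (rule DERIV_nonpos_imp_nonincreasing[OF assms(2)])
    fix t assume t: "x \<le> t" "t \<le> 1"
    then have t0: "t \<ge> 0" using assms by simp
    have "4 * t \<le> (1 + t)\<^sup>2"
      using zero_le_power2[of "1 - t"] by (simp add: power2_eq_square algebra_simps)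
    then have 1: "t / (1 + t)\<^sup>2 \<le> 1 / 4" using t0 by (simp add: field_simps)
    have "2 * N * (poly k t)\<^sup>2 * t / (1 + t)\<^sup>2 = 2 * N * (poly k t)\<^sup>2 * (t / (1 + t)\<^sup>2)" by simp
    also have "\<dots> \<le> 2 * N * H 1 * (1 / 4)"
      using 1 k_le[OF t0 t(2)] t0 N by (intro mult_mono) (auto simp: H_1)
    finally have "2 * N * (poly k t)\<^sup>2 * t / (1 + t)\<^sup>2 - N / 2 * H 1 \<le> 0" by simp
    moreover have "((\<lambda>x. H x - N / 2 * H 1 * x) has_real_derivative
        2 * N * (poly k t)\<^sup>2 * t / (1 + t)\<^sup>2 - N / 2 * H 1) (at t)"
      using t0 by (auto intro!: derivative_eq_intros deriv_H)
    ultimately show "\<exists>D. ((\<lambda>x. H x - N / 2 * H 1 * x) has_real_derivative D) (at t) \<and> D \<le> 0"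
      by blast
  qed
  moreover have "H 1 * (1 - N / 2 * (1 - x)) = H 1 - N / 2 * H 1 * 1 + N / 2 * H 1 * x"
    by (simp add: algebra_simps add_divide_distrib diff_divide_distrib)
  ultimately show ?thesis by linarith
qed

lemma H_eq: "0 \<le> x \<Longrightarrow> x < 1 \<Longrightarrow> H x = (poly y' x)\<^sup>2 + N * (poly y x)\<^sup>2 / (1 - x\<^sup>2)"
proof -
  assume x: "0 \<le> x" "x < 1"
  have "1 - x\<^sup>2 = (1 - x) * (1 + x)" by (simp add: algebra_simps power2_eq_square)
  then have "N * (poly y x)\<^sup>2 / (1 - x\<^sup>2) = N * ((1 - x)\<^sup>2 * (poly k x)\<^sup>2) / ((1 - x) * (1 + x))"
    by (simp add: poly_y_eq_k power_mult_distrib power2_commute)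
  also have "\<dots> = N * ((1 - x) / (1 + x)) * (poly k x)\<^sup>2"
    using x by (simp add: power2_eq_square)
  finally show ?thesis by (simp add: H_def)
qed

lemma y_sq_le_end:
  assumes "0 \<le> x" "x \<le> 1" shows "(poly y x)\<^sup>2 \<le> (1 - x\<^sup>2) * (poly y' 1)\<^sup>2 / N"
proof (cases "x = 1")
  case False
  then have x: "x < 1" using assms by simp
  then have s: "1 - x\<^sup>2 > 0" using assms sq_less_1[of x] by simp
  have "N * (poly y x)\<^sup>2 / (1 - x\<^sup>2) \<le> H x" using H_eq[of x] x assms by simp
  also have "\<dots> \<le> (poly y' 1)\<^sup>2" using H_mono[OF assms] by (simp add: H_1)
  finally show ?thesis using s N by (simp add: field_simps)
qed (simp add: y_1)

text \<open>At \<open>1 - x\<^sup>2 = 1 / N\<close> the two energies are comparable.\<close>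

lemma end_slope:
  "sqrt N * K / 6 \<le> (poly y' 1)\<^sup>2" "(poly y' 1)\<^sup>2 \<le> 12 * sqrt N * K"
proof -
  define x where "x = sqrt (1 - 1 / N)"
  have x2: "x\<^sup>2 = 1 - 1 / N" and x0: "x \<ge> 0" using N by (auto simp: x_def)
  have s: "1 - x\<^sup>2 = 1 / N" by (simp add: x2)
  have x1: "x < 1" using x2 x0 N by (smt (verit) divide_pos_pos one_le_power)
  have "1 - x \<le> 1 / N"
  proof -
    have "x\<^sup>2 \<le> x" using x0 x1 by (simp add: power2_eq_square mult_left_le)
    then show ?thesis using s by simp
  qed
  then have "N * (1 - x) \<le> 1" using N by (simp add: field_simps)
  then have "H 1 * (1 / 2) \<le> H 1 * (1 - N / 2 * (1 - x))"
    by (intro mult_left_mono) (auto simp: H_1)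
  then have H: "H 1 / 2 \<le> H x" "H x \<le> H 1" using H_ge[of x] H_mono[of x] x0 x1 by auto
  define a where "a = poly y' x"
  define b where "b = N * poly y x"
  have Hx: "H x = a\<^sup>2 + b\<^sup>2"
    using H_eq[OF x0 x1] N unfolding s a_def b_def by (simp add: power2_eq_square)
  have Gx: "G x = (a\<^sup>2 + x * a * b + b\<^sup>2 / 2) / sqrt N"
    unfolding G_def s a_def b_def using N
    by (simp add: real_sqrt_divide power2_eq_square field_simps)
  have xab: "\<bar>x * a * b\<bar> \<le> \<bar>a\<bar> * \<bar>b\<bar>"
    using x0 x1 by (simp add: abs_mult mult_left_le_one_le mult.assoc)
  \<comment> \<open>The coefficients are tuned to |a b| <= 5/6 a^2 + 1/3 b^2, which leaves exactly
    1/6 of a^2 + b^2 in the lower estimate of the mixed form.\<close>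
  have "0 \<le> (5 * \<bar>a\<bar> - 3 * \<bar>b\<bar>)\<^sup>2 + \<bar>b\<bar>\<^sup>2" "0 \<le> (\<bar>a\<bar> - \<bar>b\<bar>)\<^sup>2" by simp_all
  then have "30 * (\<bar>a\<bar> * \<bar>b\<bar>) \<le> 25 * a\<^sup>2 + 10 * b\<^sup>2" "2 * (\<bar>a\<bar> * \<bar>b\<bar>) \<le> a\<^sup>2 + b\<^sup>2"
    by (simp_all add: power2_diff power_mult_distrib algebra_simps)
  note ab = this
  have pm: "x * a * b \<le> \<bar>a\<bar> * \<bar>b\<bar>" "- (x * a * b) \<le> \<bar>a\<bar> * \<bar>b\<bar>" "0 \<le> a\<^sup>2" "0 \<le> b\<^sup>2"
    using xab by auto
  have "(a\<^sup>2 + b\<^sup>2) / 6 \<le> a\<^sup>2 + x * a * b + b\<^sup>2 / 2" using ab pm by argo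
  moreover have "a\<^sup>2 + x * a * b + b\<^sup>2 / 2 \<le> 3 / 2 * (a\<^sup>2 + b\<^sup>2)" using ab pm by argo
  ultimately
  have G: "H x / 6 \<le> sqrt N * G x" "sqrt N * G x \<le> 3 / 2 * H x"
    using N by (simp_all add: Hx Gx)
  have K: "K / 4 \<le> G x" "G x \<le> K"
    using G_ge[of x] G_le[of x] x0 x1 s by auto
  have "sqrt N * (K / 4) \<le> sqrt N * G x" "sqrt N * G x \<le> sqrt N * K"
    using K N by (auto intro!: mult_left_mono)
  then show "sqrt N * K / 6 \<le> (poly y' 1)\<^sup>2" "(poly y' 1)\<^sup>2 \<le> 12 * sqrt N * K"
    using G H unfolding H_1[symmetric] by auto
qed

lemma K_nonneg: "K \<ge> 0" using N by (simp add: K_def)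

text \<open>Where 1 - x^2 >= 1 / N, use Q u^2 <= G <= K with Q >= N / 4. Closer to 1 the second
  energy bounds y by the end slope, and the surplus factor sqrt (N (1 - x^2)) is at most 1.\<close>

lemma amplitude_le_right:
  assumes "0 \<le> x" "x \<le> 1"
  shows "(poly y x)\<^sup>2 \<le> 12 * sqrt (1 - x\<^sup>2) * K / N"
proof (cases "1 - x\<^sup>2 \<ge> 1 / N")
  case True
  define s where "s = 1 - x\<^sup>2"
  have "1 / N > 0" using N by simp
  then have s: "s > 0" using True unfolding s_def by linarith
  then have x: "x < 1" using assms by (cases "x = 1") (auto simp: s_def)
  have "N / 4 * ((poly y x)\<^sup>2 * sqrt s / s) \<le> Q x * ((poly y x)\<^sup>2 * sqrt s / s)"
    using s Q_ge[of x] x True assms by (intro mult_right_mono) auto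
  also have "\<dots> \<le> G x"
  proof -
    have "0 \<le> sqrt s * (poly y' x + x * poly y x / (2 * s))\<^sup>2" using s by simp
    then show ?thesis using G_eq[of x] x assms unfolding s_def by (simp only: times_divide_eq_right mult.assoc)
  qed
  also have "\<dots> \<le> K" using G_le assms x by simp
  finally have "N / 4 * ((poly y x)\<^sup>2 * sqrt s / s) \<le> K" .
  moreover have "sqrt s / s = 1 / sqrt s" using s by (simp add: real_div_sqrt field_simps)
  ultimately have "N / 4 * ((poly y x)\<^sup>2 / sqrt s) \<le> K"
    by (metis times_divide_eq_right mult.right_neutral)
  then have "(poly y x)\<^sup>2 \<le> 4 * sqrt s * K / N"
    using s N by (simp add: field_simps)
  also have "\<dots> \<le> 12 * sqrt s * K / N"
    using s N K_nonneg by (intro divide_right_mono mult_right_mono) auto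
  finally show ?thesis by (simp add: s_def)
next
  case False
  define s where "s = 1 - x\<^sup>2"
  have s: "0 \<le> s" "s \<le> 1 / N" using False assms by (auto simp: s_def power_le_one)
  then have "sqrt s \<le> 1 / sqrt N" using real_sqrt_le_mono[OF s(2)] by (simp add: real_sqrt_divide)
  then have sN: "sqrt s * sqrt N \<le> 1" using N by (simp add: field_simps)
  have "(poly y x)\<^sup>2 \<le> s * (poly y' 1)\<^sup>2 / N" using y_sq_le_end[OF assms] by (simp add: s_def)
  also have "\<dots> \<le> s * (12 * sqrt N * K) / N"
    using end_slope s N by (intro divide_right_mono mult_left_mono) auto
  also have "\<dots> = 12 * sqrt s * K / N * (sqrt s * sqrt N)"
    using s by (simp add: mult_ac)
  also have "\<dots> \<le> 12 * sqrt s * K / N * 1"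
    using s N K_nonneg sN by (intro mult_left_mono) auto
  finally show ?thesis by (simp add: s_def)
qed

text \<open>At a root both energies reduce to a multiple of the squared slope. The term 1 / sqrt N
  takes over where sqrt (1 - x^2) degenerates, in particular at the root 1 itself.\<close>

lemma root_slope_right:
  assumes "0 \<le> x" "x \<le> 1" "poly y x = 0"
  shows "K / 12 \<le> (poly y' x)\<^sup>2 * (sqrt (1 - x\<^sup>2) + 1 / sqrt N)"
proof (cases "1 - x\<^sup>2 \<ge> 1 / N")
  case True
  have "1 / N > 0" using N by simp
  then have s: "1 - x\<^sup>2 > 0" using True by linarith
  then have x: "x < 1" using assms by (cases "x = 1") auto
  have "K / 4 \<le> G x" using G_ge x assms True by auto
  also have "G x = sqrt (1 - x\<^sup>2) * (poly y' x)\<^sup>2" by (simp add: G_def assms)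
  finally have "K / 4 \<le> (poly y' x)\<^sup>2 * sqrt (1 - x\<^sup>2)" by (simp add: mult_ac)
  moreover have "(poly y' x)\<^sup>2 * (1 / sqrt N) \<ge> 0" using N by simp
  ultimately show ?thesis using K_nonneg unfolding distrib_left by linarith
next
  case False
  have x2: "x\<^sup>2 \<le> x" using assms by (simp add: power2_eq_square mult_left_le)
  have x1: "x\<^sup>2 \<le> 1" using assms by (simp add: power_le_one)
  have Hx: "H x = (poly y' x)\<^sup>2" using poly_y_eq_k[of x] assms by (auto simp: H_def)
  have "N * (1 - x) \<le> 1" using x2 False N by (simp add: pos_le_divide_eq pos_less_divide_eq not_le mult.commute) (smt (verit) mult_left_mono right_diff_distrib)
  then have "H 1 * (1 / 2) \<le> H 1 * (1 - N / 2 * (1 - x))"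
    by (intro mult_left_mono) (auto simp: H_1)
  then have "(poly y' x)\<^sup>2 \<ge> sqrt N * K / 12"
    using H_ge[of x] assms end_slope Hx H_1 by auto
  then have "(poly y' x)\<^sup>2 * (1 / sqrt N) \<ge> K / 12"
    using N by (simp add: field_simps)
  moreover have "(poly y' x)\<^sup>2 * sqrt (1 - x\<^sup>2) \<ge> 0" using x1 by simp
  ultimately show ?thesis unfolding distrib_left by linarith
qed

end

lemma lobatto_ode_reflect:
  assumes "lobatto_ode y N" shows "lobatto_ode (pcompose y [:0, -1:]) N"
proof -
  interpret lobatto_ode y N by fact
  have "[:1, 0, -1:] = pcompose [:1, 0, -1::real:] [:0, -1:]"
    by (simp add: pcompose_pCons)
  moreover have "pderiv (pderiv (pcompose y [:0, -1:])) = pcompose (pderiv (pderiv y)) [:0, -1:]"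
    by (simp add: pderiv_pcompose pderiv_pCons pderiv_mult pderiv_smult pderiv_minus)
  ultimately have "[:1, 0, -1:] * pderiv (pderiv (pcompose y [:0, -1:])) = smult (- N) (pcompose y [:0, -1:])"
    using ode by (metis pcompose_mult pcompose_smult)
  moreover have "pcompose y [:0, -1:] \<noteq> 0" using nonzero by (simp add: pcompose_eq_0_iff)
  ultimately show ?thesis using N by unfold_locales
qed

theorem lobatto_amplitude:
  assumes "lobatto_ode y N"
  obtains K where "K > 0"
    "\<And>x. \<bar>x\<bar> \<le> 1 \<Longrightarrow> (poly y x)\<^sup>2 \<le> 12 * sqrt (1 - x\<^sup>2) * K / N"
    "\<And>x. \<bar>x\<bar> \<le> 1 \<Longrightarrow> poly y x = 0 \<Longrightarrow> K / 12 \<le> (poly (pderiv y) x)\<^sup>2 * (sqrt (1 - x\<^sup>2) + 1 / sqrt N)"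
proof -
  interpret A: lobatto_ode y N by fact
  interpret B: lobatto_ode "pcompose y [:0, -1:]" N by (rule lobatto_ode_reflect[OF assms])
  have p: "poly (pcompose y [:0, -1:]) x = poly y (- x)" for x by (simp add: poly_pcompose)
  have p': "poly B.y' x = - poly A.y' (- x)" for x
    by (simp add: B.y'_def A.y'_def pderiv_pcompose poly_pcompose pderiv_pCons)
  have K: "B.K = A.K" by (simp add: A.K_def B.K_def p p')
  have 1: "(poly y x)\<^sup>2 \<le> 12 * sqrt (1 - x\<^sup>2) * A.K / N" if "\<bar>x\<bar> \<le> 1" for x
    using A.amplitude_le_right[of x] B.amplitude_le_right[of "- x"] that
    by (cases "x \<ge> 0") (auto simp: K p)
  have 2: "A.K / 12 \<le> (poly (pderiv y) x)\<^sup>2 * (sqrt (1 - x\<^sup>2) + 1 / sqrt N)"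
    if "\<bar>x\<bar> \<le> 1" "poly y x = 0" for x
    using A.root_slope_right[of x] B.root_slope_right[of "- x"] that
    by (cases "x \<ge> 0") (auto simp: K p p' A.y'_def)
  \<comment> \<open>Otherwise the amplitude bound would make y vanish on the whole interval.\<close>
  have "A.K \<noteq> 0"
  proof
    assume "A.K = 0"
    then have "{-1..1} \<subseteq> {x. poly y x = 0}" using 1 by fastforce
    then have "infinite {x. poly y x = 0}"
      by (rule infinite_super) (simp add: infinite_Icc)
    then show False using poly_roots_finite[OF A.nonzero] by simp
  qed
  then show ?thesis using that[of A.K] 1 2 A.K_nonneg by simp
qed

subsection \<open>Lagrange interpolation\<close>

definition lagrange_basis :: "nat \<Rightarrow> (nat \<Rightarrow> 'a::field) \<Rightarrow> nat \<Rightarrow> 'a poly" where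
  "lagrange_basis n z i = (\<Prod>j\<in>{..n} - {i}. smult (1 / (z i - z j)) [:- z j, 1:])"

definition node_poly :: "nat \<Rightarrow> (nat \<Rightarrow> 'a::field) \<Rightarrow> 'a poly" where
  "node_poly n z = (\<Prod>j\<le>n. [:- z j, 1:])"

lemma degree_lagrange_basis: "i \<le> n \<Longrightarrow> degree (lagrange_basis n z i) \<le> n"
proof -
  assume "i \<le> n"
  have "degree (lagrange_basis n z i) \<le> (\<Sum>j\<in>{..n} - {i}. degree (smult (1 / (z i - z j)) [:- z j, 1:]))"
    unfolding lagrange_basis_def by (rule degree_prod_sum_le[unfolded o_def]) simp
  also have "\<dots> \<le> (\<Sum>j\<in>{..n} - {i}. 1)"
    by (intro sum_mono) simp
  also have "\<dots> = n" using \<open>i \<le> n\<close> by simp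
  finally show ?thesis .
qed

lemma poly_lagrange_basis:
  "poly (lagrange_basis n z i) x = (\<Prod>j\<in>{..n} - {i}. (x - z j) / (z i - z j))"
  by (simp add: lagrange_basis_def poly_prod diff_divide_distrib)

lemma lagrange_basis_node:
  assumes "inj_on z {..n}" "i \<le> n" "j \<le> n"
  shows "poly (lagrange_basis n z i) (z j) = (if i = j then 1 else 0)"
proof (cases "i = j")
  case True
  have "z i \<noteq> z k" if "k \<in> {..n} - {i}" for k
    using inj_onD[OF assms(1), of i k] that assms by auto
  then show ?thesis using True unfolding poly_lagrange_basis by simp
next
  case False
  then have "(\<Prod>k\<in>{..n} - {i}. (z j - z k) / (z i - z k)) = 0"
    using assms by (intro prod_zero) auto
  then show ?thesis using False unfolding poly_lagrange_basis by simp
qed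

lemma poly_eq_by_nodes:
  fixes p q :: "'a::field poly"
  assumes "inj_on z {..n}" "degree p \<le> n" "degree q \<le> n" "\<And>i. i \<le> n \<Longrightarrow> poly p (z i) = poly q (z i)"
  shows "p = q"
proof (rule poly_eqI_degree[of "z ` {..n}"])
  show "degree p < card (z ` {..n})" "degree q < card (z ` {..n})"
    using assms by (simp_all add: card_image)
qed (use assms in auto)

lemma lagrange_interpolation:
  fixes p :: "'a::field poly"
  assumes "inj_on z {..n}" "degree p \<le> n"
  shows "p = (\<Sum>i\<le>n. smult (poly p (z i)) (lagrange_basis n z i))"
proof (rule poly_eq_by_nodes[OF assms])
  show "degree (\<Sum>i\<le>n. smult (poly p (z i)) (lagrange_basis n z i)) \<le> n"
    by (rule degree_sum_le) (auto intro: order.trans[OF degree_smult_le] degree_lagrange_basis)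
  show "poly p (z k) = poly (\<Sum>i\<le>n. smult (poly p (z i)) (lagrange_basis n z i)) (z k)" if "k \<le> n" for k
    using that assms by (simp add: poly_sum lagrange_basis_node mult_delta_right)
qed

lemma node_poly_node: "i \<le> n \<Longrightarrow> poly (node_poly n z) (z i) = 0"
  by (auto simp: node_poly_def poly_prod)

lemma degree_node_poly: "degree (node_poly n z) = Suc n"
  unfolding node_poly_def by (subst degree_prod_eq_sum_degree) auto

lemma lead_node_poly: "coeff (node_poly n z) (Suc n) = 1"
  using lead_coeff_prod[of "\<lambda>j. [:- z j, 1:]" "{..n}"] degree_node_poly[of n z]
  by (simp add: node_poly_def)

lemma node_poly_nz: "node_poly n z \<noteq> 0"
  using lead_node_poly[of n z] by auto

lemma node_poly_lagrange:
  assumes "inj_on z {..n}" "i \<le> n"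
  shows "node_poly n z = smult (poly (pderiv (node_poly n z)) (z i)) ([:- z i, 1:] * lagrange_basis n z i)"
proof -
  have ne: "z i \<noteq> z k" if "k \<in> {..n} - {i}" for k
    using inj_onD[OF assms(1), of i k] that assms by auto
  define c where "c = (\<Prod>j\<in>{..n} - {i}. z i - z j)"
  have "smult c (lagrange_basis n z i) = (\<Prod>j\<in>{..n} - {i}. [:- z j, 1:])"
  proof -
    have "lagrange_basis n z i = smult (\<Prod>j\<in>{..n} - {i}. 1 / (z i - z j)) (\<Prod>j\<in>{..n} - {i}. [:- z j, 1:])"
      unfolding lagrange_basis_def by (rule prod_smult)
    moreover have "c * (\<Prod>j\<in>{..n} - {i}. 1 / (z i - z j)) = 1"
      unfolding c_def prod.distrib[symmetric] using ne by (intro prod.neutral) auto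
    ultimately show ?thesis by simp
  qed
  then have eq: "node_poly n z = [:- z i, 1:] * smult c (lagrange_basis n z i)"
    unfolding node_poly_def using prod.remove[of "{..n}" i "\<lambda>j. [:- z j, 1:]"] assms by simp
  have "poly (pderiv (node_poly n z)) (z i) = c"
    unfolding eq pderiv_mult by (simp add: pderiv_pCons lagrange_basis_node assms)
  then show ?thesis using eq by simp
qed

text \<open>Translates the first-order condition on the Lagrange basis into the vanishing of the
  second derivative of the node polynomial.\<close>

lemma node_poly_deriv2:
  assumes "inj_on z {..n}" "i \<le> n"
  shows "poly (pderiv (pderiv (node_poly n z))) (z i)
     = 2 * poly (pderiv (node_poly n z)) (z i) * poly (pderiv (lagrange_basis n z i)) (z i)"
proof -
  define c where "c = poly (pderiv (node_poly n z)) (z i)"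
  have two: "2 * q = smult 2 q" for q :: "'a poly"
    by (simp add: numeral_poly)
  have "pderiv (pderiv (node_poly n z)) = smult c (pderiv (pderiv ([:- z i, 1:] * lagrange_basis n z i)))"
    using arg_cong[OF node_poly_lagrange[OF assms], of "\<lambda>p. pderiv (pderiv p)"]
    by (simp only: pderiv_smult c_def)
  also have "pderiv (pderiv ([:- z i, 1:] * lagrange_basis n z i))
    = [:- z i, 1:] * pderiv (pderiv (lagrange_basis n z i)) + smult 2 (pderiv (lagrange_basis n z i))"
    by (simp add: pderiv_mult pderiv_pCons pderiv_add pderiv_smult pderiv_diff pderiv_minus two)
  finally show ?thesis by (simp add: c_def)
qed

lemma node_poly_deriv_nz:
  assumes "inj_on z {..n}" "i \<le> n"
  shows "poly (pderiv (node_poly n z)) (z i) \<noteq> 0"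
  using node_poly_lagrange[OF assms] node_poly_nz[of n z] by (metis smult_0_left)

subsection \<open>The Lebesgue constant of the Lobatto nodes\<close>

text \<open>
  Vanishing of the derivatives of the Lagrange basis at the interior nodes is the first-order
  condition at a Fekete configuration; it is what makes the nodes the Gauss-Lobatto ones.
\<close>

locale lobatto_nodes =
  fixes n :: nat and th :: "nat \<Rightarrow> real"
  assumes n: "n > 0" and th_0: "th 0 = 0" and th_n: "th n = pi"
    and th_mono: "strict_mono_on {..n} th"
    and stationary: "\<And>i. 0 < i \<Longrightarrow> i < n \<Longrightarrow>
      poly (pderiv (lagrange_basis n (\<lambda>j. cos (th j)) i)) (cos (th i)) = 0"
begin

abbreviation "z \<equiv> \<lambda>j. cos (th j)"
abbreviation "l \<equiv> lagrange_basis n z"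
abbreviation "w \<equiv> node_poly n z"
definition "N = real n * (real n + 1)"

lemma N_ge: "N \<ge> 2" "N \<ge> (real n)\<^sup>2" "N > 0"
proof -
  have "real n * (real n + 1) \<ge> 1 * (1 + 1)" using n by (intro mult_mono) auto
  then show "N \<ge> 2" "N \<ge> (real n)\<^sup>2" "N > 0" by (auto simp: N_def power2_eq_square algebra_simps)
qed

lemma th_less: "i < j \<Longrightarrow> j \<le> n \<Longrightarrow> th i < th j"
  using th_mono by (auto simp: strict_mono_on_def)

lemma th_range: "i \<le> n \<Longrightarrow> 0 \<le> th i \<and> th i \<le> pi"
  using th_less[of 0 i] th_less[of i n] th_0 th_n by (cases "i = 0"; cases "i = n") auto

lemma inj_z: "inj_on z {..n}"
proof (rule inj_onI)
  fix i j assume ij: "i \<in> {..n}" "j \<in> {..n}" "cos (th i) = cos (th j)"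
  then have "th i = th j" using th_range[of i] th_range[of j] cos_inj_pi by auto
  then show "i = j" using th_less[of i j] th_less[of j i] ij by (cases i j rule: linorder_cases) auto
qed

text \<open>Both sides have degree at most n + 1 and vanish at the n + 1 nodes: at the two ends
  through the factor 1 - x^2, inside by stationarity. Comparing the coefficients of x^(n + 1)
  determines N.\<close>

lemma ode: "[:1, 0, -1:] * pderiv (pderiv w) = smult (- N) w"
proof (rule poly_eqI_degree_lead_coeff[where A = "z ` {..n}" and n = "Suc n"])
  have "degree (pderiv (pderiv w)) = n - 1"
    by (simp add: degree_pderiv degree_node_poly)
  then have "degree ([:1, 0, -1::real:] * pderiv (pderiv w)) \<le> 2 + (n - 1)"
    using degree_mult_le[of "[:1, 0, -1::real:]" "pderiv (pderiv w)"] by simp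
  also have "\<dots> = Suc n" using n by simp
  finally show "degree ([:1, 0, -1::real:] * pderiv (pderiv w)) \<le> Suc n" .
  obtain m where m: "n = Suc m" using n by (cases n) auto
  have "coeff ([:1, 0, -1::real:] * pderiv (pderiv w)) (Suc n) =
      coeff (pderiv (pderiv w)) (Suc n) - coeff (pderiv (pderiv w)) m"
    using m by (simp add: coeff_pCons)
  also have "coeff (pderiv (pderiv w)) (Suc n) = 0"
    by (intro coeff_eq_0) (simp add: degree_pderiv degree_node_poly)
  also have "coeff (pderiv (pderiv w)) m = real (Suc m) * (real (Suc n) * coeff w (Suc n))"
    using m by (simp add: coeff_pderiv)
  finally have c: "coeff ([:1, 0, -1::real:] * pderiv (pderiv w)) (Suc n) = - (real (Suc m) * real (Suc n))"
    by (simp add: lead_node_poly)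
  have "N = real (Suc m) * real (Suc n)" unfolding N_def using m by simp
  then show "coeff ([:1, 0, -1::real:] * pderiv (pderiv w)) (Suc n) = coeff (smult (- N) w) (Suc n)"
    unfolding c by (simp add: lead_node_poly)
  show "degree (smult (- N) w) \<le> Suc n" using degree_smult_le[of "- N" w] by (simp add: degree_node_poly)
  show "Suc n \<le> card (z ` {..n})" using inj_z by (simp add: card_image)
  fix x assume "x \<in> z ` {..n}"
  then obtain i where i: "i \<le> n" "x = z i" by auto
  consider "i = 0" | "i = n" | "0 < i" "i < n" using i by linarith
  then show "poly ([:1, 0, -1:] * pderiv (pderiv w)) x = poly (smult (- N) w) x"
  proof cases
    case 3
    then have "poly (pderiv (pderiv w)) x = 0"
      using node_poly_deriv2[OF inj_z i(1)] stationary i by simp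
    then show ?thesis using node_poly_node[of i n z] i by simp
  qed (use i node_poly_node[of i n z] in \<open>auto simp: th_0 th_n\<close>)
qed

sublocale lobatto_ode w N
  by unfold_locales (use ode N_ge node_poly_nz in auto)

text \<open>Differentiating the equation once and inserting 1 or -1 removes the third derivative and
  relates w'' to w' there.\<close>

lemma end_slopes:
  "poly (pderiv (l 0)) 1 = N / 4" "poly (pderiv (l n)) (- 1) = - N / 4"
proof -
  have "pderiv ([:1, 0, -1:] * pderiv (pderiv w)) = smult (- N) (pderiv w)"
    unfolding ode by (rule pderiv_smult)
  then have eq: "[:1, 0, -1:] * pderiv (pderiv (pderiv w)) + pderiv (pderiv w) * [:0, -2:] = smult (- N) (pderiv w)"
    unfolding pderiv_mult by (simp add: pderiv_pCons)
  have e: "(1 - x\<^sup>2) * poly (pderiv (pderiv (pderiv w))) x - 2 * x * poly (pderiv (pderiv w)) x = - N * poly (pderiv w) x" for x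
    using arg_cong[OF eq, of "\<lambda>p. poly p x"] by (simp add: algebra_simps power2_eq_square)
  have "z 0 = 1" "z n = -1" by (auto simp: th_0 th_n)
  then have "poly (pderiv w) 1 * (4 * poly (pderiv (l 0)) 1) = poly (pderiv w) 1 * N"
    "poly (pderiv w) (- 1) * (4 * poly (pderiv (l n)) (- 1)) = poly (pderiv w) (- 1) * (- N)"
    "poly (pderiv w) 1 \<noteq> 0" "poly (pderiv w) (- 1) \<noteq> 0"
    using e[of 1] e[of "-1"] node_poly_deriv2[OF inj_z, of 0] node_poly_deriv2[OF inj_z, of n]
      node_poly_deriv_nz[OF inj_z, of 0] node_poly_deriv_nz[OF inj_z, of n]
    by (auto simp: mult_ac)
  then show "poly (pderiv (l 0)) 1 = N / 4" "poly (pderiv (l n)) (- 1) = - N / 4"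
    unfolding mult_cancel_left by auto
qed

text \<open>
  Fejer's argument: the Hermite interpolant of the constant \<open>1\<close> is the constant itself, and
  its coefficients \<open>v\<close> are at least \<open>1\<close> on the interval.
\<close>

lemma sum_lagrange_sq_le:
  assumes "\<bar>x\<bar> \<le> 1" shows "(\<Sum>i\<le>n. (poly (l i) x)\<^sup>2) \<le> 1"
proof -
  define d where "d i = poly (pderiv (l i)) (z i)" for i
  define v where "v i = [:1 + 2 * d i * z i, - 2 * d i:]" for i
  define D where "D = (\<Sum>i\<le>n. (l i)\<^sup>2 * v i) - 1"
  have v: "poly (v i) t = 1 - 2 * d i * (t - z i)" for i t
    by (simp add: v_def algebra_simps)
  have D: "poly D t = (\<Sum>i\<le>n. (poly (l i) t)\<^sup>2 * poly (v i) t) - 1" for t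
    by (simp add: D_def poly_sum)
  have D0: "poly D (z k) = 0" if "k \<le> n" for k
  proof -
    have "(\<Sum>i\<le>n. (poly (l i) (z k))\<^sup>2 * poly (v i) (z k)) = (\<Sum>i\<le>n. if i = k then 1 else 0)"
      by (rule sum.cong) (use that in \<open>auto simp: lagrange_basis_node[OF inj_z] v\<close>)
    then show ?thesis using that by (simp add: D)
  qed
  have D'0: "poly (pderiv D) (z k) = 0" if "k \<le> n" for k
  proof -
    have pderiv_sum: "pderiv (\<Sum>i\<le>m. f i) = (\<Sum>i\<le>m. pderiv (f i))" for f :: "nat \<Rightarrow> real poly" and m
      by (induction m) (simp_all add: pderiv_add)
    have "pderiv D = (\<Sum>i\<le>n. 2 * l i * pderiv (l i) * v i + (l i)\<^sup>2 * [:- 2 * d i:])"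
    proof -
      have "pderiv (v i) = [:- 2 * d i:]" for i by (simp add: v_def pderiv_pCons)
      then have "pderiv ((l i)\<^sup>2 * v i) = 2 * l i * pderiv (l i) * v i + (l i)\<^sup>2 * [:- 2 * d i:]" for i
        unfolding pderiv_mult power2_eq_square by (simp only:) (simp only: algebra_simps mult_2)
      then show ?thesis unfolding D_def pderiv_diff pderiv_sum by simp
    qed
    then have "poly (pderiv D) (z k) = (\<Sum>i\<le>n. 2 * poly (l i) (z k) * poly (pderiv (l i)) (z k) * poly (v i) (z k)
         + (poly (l i) (z k))\<^sup>2 * (- 2 * d i))"
      by (simp add: poly_sum mult_ac)
    also have "\<dots> = (\<Sum>i\<le>n. 0)"
      by (rule sum.cong) (use that in \<open>auto simp: lagrange_basis_node[OF inj_z] v d_def\<close>)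
    finally show ?thesis by simp
  qed
  \<comment> \<open>\<open>D\<close> has double zeros at n + 1 nodes and degree at most 2 n + 1. One
    factor \<open>w\<close> is split off by division; the quotient then vanishes at all nodes too
    and has degree at most n.\<close>
  have "D mod w = 0"
  proof (rule poly_eq_by_nodes[OF inj_z])
    show "degree (D mod w) \<le> n"
      using degree_mod_less'[of w D] node_poly_nz[of n z] degree_node_poly[of n z] by (cases "D mod w = 0") auto
    show "poly (D mod w) (z k) = poly 0 (z k)" if "k \<le> n" for k
      using D0[OF that] node_poly_node[OF that, of z] arg_cong[OF div_mult_mod_eq[of D w], of "\<lambda>p. poly p (z k)"] by simp
  qed simp
  then obtain g where g: "D = w * g" by (metis mod_0_imp_dvd dvdE)
  have "D = 0"
  proof (rule ccontr)
    assume "D \<noteq> 0"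
    have "degree D \<le> 2 * n + 1"
      unfolding D_def
    proof (rule degree_diff_le)
      show "degree (\<Sum>i\<le>n. (l i)\<^sup>2 * v i) \<le> 2 * n + 1"
      proof (rule degree_sum_le)
        fix i assume "i \<in> {..n}"
        then have "degree (l i) \<le> n" by (simp add: degree_lagrange_basis)
        then have "degree ((l i)\<^sup>2) \<le> 2 * n" using degree_power_le[of "l i" 2] by simp
        moreover have "degree (v i) \<le> 1" by (simp add: v_def)
        ultimately show "degree ((l i)\<^sup>2 * v i) \<le> 2 * n + 1"
          using degree_mult_le[of "(l i)\<^sup>2" "v i"] by linarith
      qed simp
    qed simp
    then have dg: "degree g \<le> n"
      using \<open>D \<noteq> 0\<close> node_poly_nz[of n z] by (simp add: g degree_mult_eq degree_node_poly)
    have "g = 0"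
    proof (rule poly_eq_by_nodes[OF inj_z dg])
      show "poly g (z k) = poly 0 (z k)" if "k \<le> n" for k
        using D'0[OF that] node_poly_node[OF that, of z] node_poly_deriv_nz[OF inj_z that]
        by (simp add: g pderiv_mult)
    qed simp
    then show False using \<open>D \<noteq> 0\<close> g by simp
  qed
  \<comment> \<open>At interior nodes stationarity makes \<open>v i\<close> constantly 1. At the
    node 1 its slope is - N / 2 and at the node -1 it is N / 2, so it only grows towards the
    interior.\<close>
  have v1: "poly (v i) x \<ge> 1" if i: "i \<le> n" for i
  proof -
    consider "i = 0" | "i = n" | "0 < i" "i < n" using i by linarith
    then show ?thesis
    proof cases
      case 1
      then have "d i = N / 4" "z i = 1" using end_slopes th_0 by (auto simp: d_def)
      then show ?thesis using assms N_ge by (auto simp: v intro!: mult_nonneg_nonpos)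
    next
      case 2
      then have "d i = - N / 4" "z i = - 1" using end_slopes th_n by (auto simp: d_def)
      then show ?thesis using assms N_ge by (auto simp: v)
    next
      case 3
      then show ?thesis using stationary by (simp add: v d_def)
    qed
  qed
  have "(\<Sum>i\<le>n. (poly (l i) x)\<^sup>2) \<le> (\<Sum>i\<le>n. (poly (l i) x)\<^sup>2 * poly (v i) x)"
    using mult_left_mono[OF v1] by (intro sum_mono) force
  also have "\<dots> = 1" using D[of x] \<open>D = 0\<close> by simp
  finally show ?thesis .
qed

lemma lagrange_le_1:
  assumes "\<bar>x\<bar> \<le> 1" "i \<le> n" shows "\<bar>poly (l i) x\<bar> \<le> 1"
proof -
  have "(poly (l i) x)\<^sup>2 \<le> (\<Sum>i\<le>n. (poly (l i) x)\<^sup>2)"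
    using assms by (intro member_le_sum) auto
  then have "(poly (l i) x)\<^sup>2 \<le> 1" using sum_lagrange_sq_le[OF assms(1)] by linarith
  then show ?thesis by (simp add: abs_square_le_1)
qed

text \<open>The basis polynomial drops from 1 to 0 between two nodes, while being bounded by 1 makes
  it Lipschitz with constant n in the angle.\<close>

lemma th_separated:
  assumes "i < j" "j \<le> n" shows "1 \<le> real n * (th j - th i)"
proof -
  have "\<bar>poly (l i) (z i) - poly (l i) (z j)\<bar> \<le> real n * 1 * \<bar>th i - th j\<bar>"
    using assms by (intro cheb_lipschitz degree_lagrange_basis lagrange_le_1) auto
  then show ?thesis
    using assms th_less[OF assms] by (simp add: lagrange_basis_node[OF inj_z])
qed

lemma th_separated_nat:
  assumes "i \<le> j" "j \<le> n" shows "real (j - i) \<le> real n * (th j - th i)"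
  using assms
proof (induction j rule: dec_induct)
  case (step j)
  then show ?case using th_separated[of j "Suc j"] by (simp add: algebra_simps of_nat_diff Suc_diff_le)
qed simp

text \<open>The basis polynomial is the node polynomial divided by its slope at the node and by cos
  t - cos (th i). The amplitude theorem estimates the first two through the same K, which cancels;
  the last is, up to sign, 2 \<open>S\<close> \<open>s\<close>. Within 1 / sqrt N of the node the
  bound by 1 is enough.\<close>

lemma lagrange_decay:
  assumes "0 \<le> t" "t \<le> pi" "i \<le> n"
  shows "\<bar>poly (l i) (cos t)\<bar> * (real n * \<bar>t - th i\<bar>) \<le> 72"
proof (cases "\<bar>t - th i\<bar> * sqrt N \<le> 1")
  case True
  have "real n \<le> sqrt N" using N_ge by (simp add: real_le_rsqrt)
  then have "real n * \<bar>t - th i\<bar> \<le> sqrt N * \<bar>t - th i\<bar>" by (intro mult_right_mono) auto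
  then have "real n * \<bar>t - th i\<bar> \<le> 1" using True by (simp add: mult.commute)
  then have "\<bar>poly (l i) (cos t)\<bar> * (real n * \<bar>t - th i\<bar>) \<le> 1 * 1"
    using lagrange_le_1[of "cos t" i] assms by (intro mult_mono) auto
  then show ?thesis by simp
next
  case False
  define \<delta> where "\<delta> = \<bar>t - th i\<bar>"
  define S where "S = sin ((t + th i) / 2)"
  define s where "s = sin (\<delta> / 2)"
  have thi: "0 \<le> th i" "th i \<le> pi" using th_range assms by auto
  have d: "0 < \<delta>" "\<delta> \<le> pi" using False thi assms by (auto simp: \<delta>_def)
  have dN: "1 / sqrt N \<le> \<delta>" using False N_ge by (simp add: \<delta>_def field_simps)
  have sd: "\<delta> / 4 \<le> s" using half_le_sin[of "\<delta> / 2"] d by (simp add: s_def)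
  then have s0: "s > 0" using d by linarith
  have S0: "S \<ge> 0" unfolding S_def using thi assms by (intro sin_ge_zero) auto
  have sin0: "sin t \<ge> 0" "sin (th i) \<ge> 0" using thi assms by (auto intro: sin_ge_zero)
  have neg: "(sin ((a - b) / 2))\<^sup>2 = (sin ((b - a) / 2))\<^sup>2" for a b :: real
  proof -
    have "(a - b) / 2 = - ((b - a) / 2)" by (simp add: field_simps)
    then show ?thesis by (simp only: sin_minus power2_minus)
  qed
  have s2: "s\<^sup>2 = (sin ((t - th i) / 2))\<^sup>2"
    using neg[of t "th i"] by (simp add: s_def \<delta>_def abs_if)
  have prod: "sin t * sin (th i) = S\<^sup>2 - s\<^sup>2"
  proof -
    define a where "a = t / 2" define b where "b = th i / 2"
    have "t = 2 * a" "th i = 2 * b" by (auto simp: a_def b_def)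
    have "S\<^sup>2 - s\<^sup>2 = (sin (a + b))\<^sup>2 - (sin (a - b))\<^sup>2"
      unfolding s2 S_def a_def b_def by (simp add: add_divide_distrib diff_divide_distrib)
    also have "\<dots> = 4 * (sin a * cos a) * (sin b * cos b)"
      by (simp add: sin_add sin_diff power2_eq_square algebra_simps)
    also have "\<dots> = sin (2 * a) * sin (2 * b)" by (simp add: sin_double)
    finally show ?thesis by (simp add: a_def b_def)
  qed
  have sS: "s \<le> S"
  proof (rule power2_le_imp_le)
    show "s\<^sup>2 \<le> S\<^sup>2" using prod sin0 mult_nonneg_nonneg[of "sin t" "sin (th i)"] by linarith
  qed (rule S0)
  then have Spos: "S > 0" using s0 by linarith
  have diff: "(cos t - z i)\<^sup>2 = 4 * S\<^sup>2 * s\<^sup>2"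
  proof -
    have "cos t - z i = 2 * sin ((t + th i) / 2) * sin ((th i - t) / 2)"
      by (rule cos_diff_cos)
    then have "(cos t - z i)\<^sup>2 = 4 * S\<^sup>2 * (sin ((th i - t) / 2))\<^sup>2"
      by (simp add: S_def power_mult_distrib)
    also have "(sin ((th i - t) / 2))\<^sup>2 = s\<^sup>2"
      unfolding s2 by (rule neg)
    finally show ?thesis .
  qed
  have sin_le: "sin t \<le> 2 * S"
  proof -
    have "sin t + sin (th i) = 2 * sin ((t + th i) / 2) * cos ((t - th i) / 2)"
      by (rule sin_plus_sin)
    also have "\<dots> \<le> 2 * S * 1" using S0 unfolding S_def by (intro mult_left_mono) auto
    finally show ?thesis using sin0 by simp
  qed
  obtain K where K: "K > 0"
    "\<And>x. \<bar>x\<bar> \<le> 1 \<Longrightarrow> (poly w x)\<^sup>2 \<le> 12 * sqrt (1 - x\<^sup>2) * K / N"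
    "\<And>x. \<bar>x\<bar> \<le> 1 \<Longrightarrow> poly w x = 0 \<Longrightarrow> K / 12 \<le> (poly (pderiv w) x)\<^sup>2 * (sqrt (1 - x\<^sup>2) + 1 / sqrt N)"
    using lobatto_amplitude[OF lobatto_ode_axioms] by blast
  have sq: "sqrt (1 - (cos t)\<^sup>2) = sin t" "sqrt (1 - (z i)\<^sup>2) = sin (th i)"
    using sin0 by (simp_all add: sin_squared_eq[symmetric])
  define L where "L = poly (l i) (cos t)"
  define p where "p = poly (pderiv w) (z i)"
  have w: "poly w (cos t) = p * ((cos t - z i) * L)"
    using arg_cong[OF node_poly_lagrange[OF inj_z assms(3)], of "\<lambda>q. poly q (cos t)"]
    by (simp add: L_def p_def algebra_simps)
  have K1: "(p * ((cos t - z i) * L))\<^sup>2 \<le> 12 * sin t * K / N"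
    using K(2)[of "cos t"] unfolding w sq by simp
  have K2: "K / 12 \<le> p\<^sup>2 * (sin (th i) + 1 / sqrt N)"
    using K(3)[of "z i"] node_poly_node[OF assms(3), of z] unfolding sq p_def by simp
  define M where "M = sin t * (sin (th i) + 1 / sqrt N)"
  \<comment> \<open>Away from the node, 1 / sqrt N <= \<delta> <= 4 s <= 4 S. With sin t <= 2 S this
    accounts for 8 of the 9.\<close>
  have M: "M \<le> 9 * S\<^sup>2"
  proof -
    have "sin t * (1 / sqrt N) \<le> (2 * S) * (4 * S)"
      using sin_le dN sd sS S0 N_ge by (intro mult_mono) auto
    moreover have "sin t * sin (th i) \<le> S\<^sup>2" unfolding prod by simp
    ultimately show ?thesis by (simp add: M_def distrib_left power2_eq_square)
  qed
  have "(K / 12) * ((cos t - z i) * L)\<^sup>2 \<le> p\<^sup>2 * (sin (th i) + 1 / sqrt N) * ((cos t - z i) * L)\<^sup>2"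
    using K2 by (intro mult_right_mono) auto
  also have "\<dots> = (p * ((cos t - z i) * L))\<^sup>2 * (sin (th i) + 1 / sqrt N)"
    by (simp add: power_mult_distrib mult_ac)
  also have "\<dots> \<le> (12 * sin t * K / N) * (sin (th i) + 1 / sqrt N)"
    using K1 sin0 N_ge by (intro mult_right_mono) auto
  also have "\<dots> = 12 * K / N * M" by (simp add: M_def)
  also have "\<dots> \<le> 12 * K / N * (9 * S\<^sup>2)" using M K(1) N_ge by (intro mult_left_mono) auto
  \<comment> \<open>The number 1296 is 12 * 12 * 9. Cancelling leaves N s^2 L^2 <= 324 = 18^2, and
    \<delta> / 4 <= s turns 18 into 72.\<close>
  finally have "(K / 12) * (4 * S\<^sup>2 * s\<^sup>2 * L\<^sup>2) \<le> (K / 12) * (1296 / N * S\<^sup>2)"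
    by (simp add: power_mult_distrib diff mult_ac)
  then have "4 * S\<^sup>2 * s\<^sup>2 * L\<^sup>2 \<le> 1296 / N * S\<^sup>2" using K(1) by (simp only: mult_le_cancel_left_pos divide_pos_pos zero_less_numeral)
  then have "S\<^sup>2 * (4 * s\<^sup>2 * L\<^sup>2) \<le> S\<^sup>2 * (1296 / N)" by (simp add: mult_ac)
  then have "4 * s\<^sup>2 * L\<^sup>2 \<le> 1296 / N" using Spos by (simp only: mult_le_cancel_left_pos zero_less_power)
  then have "N * (s\<^sup>2 * L\<^sup>2) \<le> 324" using N_ge by (simp add: field_simps)
  moreover have "(real n)\<^sup>2 * ((\<delta> / 4)\<^sup>2 * L\<^sup>2) \<le> N * (s\<^sup>2 * L\<^sup>2)"
    using N_ge sd d by (intro mult_mono[OF _ mult_right_mono[OF power_mono]]) auto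
  ultimately have "(\<bar>L\<bar> * (real n * \<delta>))\<^sup>2 \<le> 72\<^sup>2"
    by (simp add: power_mult_distrib power_divide mult_ac)
  then have "\<bar>L\<bar> * (real n * \<delta>) \<le> 72" by (rule power2_le_imp_le) simp
  then show ?thesis by (simp add: L_def \<delta>_def)
qed

theorem lobatto_lebesgue_constant:
  assumes "\<bar>x\<bar> \<le> 1" shows "(\<Sum>i\<le>n. \<bar>poly (l i) x\<bar>) \<le> 2 * (1 + 72 * (harm n :: real))"
proof -
  define t where "t = arccos x"
  have t: "0 \<le> t" "t \<le> pi" "cos t = x" using assms by (auto simp: t_def arccos_lbound arccos_ubound)
  define f where "f i = \<bar>poly (l i) x\<bar>" for i
  define b where "b j = (if j = 0 then 1 else 72 / real j)" for j :: nat
  have f1: "f i \<le> 1" if "i \<le> n" for i using lagrange_le_1[OF assms that] by (simp add: f_def)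
  have fb: "f i \<le> b j" if "i \<le> n" "real j \<le> real n * \<bar>t - th i\<bar>" for i j
  proof (cases "j = 0")
    case False
    have "f i * real j \<le> f i * (real n * \<bar>t - th i\<bar>)" using that by (intro mult_left_mono) (auto simp: f_def)
    also have "\<dots> \<le> 72" using lagrange_decay[OF t(1,2) that(1)] t by (simp add: f_def)
    finally show ?thesis using False by (simp add: b_def field_simps)
  qed (use f1 that in \<open>simp add: b_def\<close>)
  have bsum: "(\<Sum>j<k. b j) \<le> 1 + 72 * harm n" if "k \<le> Suc n" for k
  proof -
    have "(\<Sum>j<k. b j) \<le> (\<Sum>j<Suc n. b j)" using that by (intro sum_mono2) (auto simp: b_def)
    also have "\<dots> = b 0 + (\<Sum>j<n. b (Suc j))" by (rule sum.lessThan_Suc_shift)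
    also have "\<dots> = 1 + 72 * harm n"
      by (simp add: b_def harm_altdef sum_distrib_left divide_inverse)
    finally show ?thesis .
  qed
  \<comment> \<open>The first node whose angle is not below t, or \<open>Suc n\<close> if there is
    none. Counting outwards from here with j = 0 first, the j-th node on either side is at distance
    at least j / n, so each side contributes at most 1 plus 72 times a harmonic number.\<close>
  define m where "m = (LEAST i. i = Suc n \<or> th i \<ge> t)"
  have mP: "m = Suc n \<or> th m \<ge> t" unfolding m_def by (rule LeastI[of _ "Suc n"]) simp
  have mn: "m \<le> Suc n" unfolding m_def by (rule Least_le) simp
  have mL: "th i < t" if "i < m" for i using not_less_Least[of i] that unfolding m_def by force
  have "(\<Sum>i<m. f i) = (\<Sum>j<m. f (m - Suc j))" by (rule sum.nat_diff_reindex[symmetric])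
  also have "\<dots> \<le> (\<Sum>j<m. b j)"
  proof (rule sum_mono)
    fix j assume "j \<in> {..<m}"
    then have j: "j < m" by simp
    have "real j \<le> real n * (th (m - 1) - th (m - Suc j))"
      using th_separated_nat[of "m - Suc j" "m - 1"] j mn by simp
    also have "\<dots> \<le> real n * \<bar>t - th (m - Suc j)\<bar>"
      using mL[of "m - 1"] j by (intro mult_left_mono) auto
    finally show "f (m - Suc j) \<le> b j" using j mn by (intro fb) auto
  qed
  also have "\<dots> \<le> 1 + 72 * harm n" by (rule bsum[OF mn])
  finally have 1: "(\<Sum>i<m. f i) \<le> 1 + 72 * harm n" .
  have "(\<Sum>i=m..<Suc n. f i) = (\<Sum>j<Suc n - m. f (j + m))"
    using sum.shift_bounds_nat_ivl[of f 0 m "Suc n - m"] mn by (simp add: atLeast0LessThan)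
  also have "\<dots> \<le> (\<Sum>j<Suc n - m. b j)"
  proof (rule sum_mono)
    fix j assume "j \<in> {..<Suc n - m}"
    then have j: "j + m \<le> n" by simp
    have "real j \<le> real n * (th (j + m) - th m)"
      using th_separated_nat[of m "j + m"] j by simp
    also have "\<dots> \<le> real n * \<bar>t - th (j + m)\<bar>"
      using mP j by (intro mult_left_mono) auto
    finally show "f (j + m) \<le> b j" using j by (intro fb) auto
  qed
  also have "\<dots> \<le> 1 + 72 * harm n" by (rule bsum) simp
  finally have 2: "(\<Sum>i=m..<Suc n. f i) \<le> 1 + 72 * harm n" .
  have "(\<Sum>i\<le>n. f i) = (\<Sum>i<m. f i) + (\<Sum>i=m..<Suc n. f i)"
    using sum.atLeastLessThan_concat[of 0 m "Suc n" f] mn by (simp add: atLeast0LessThan lessThan_Suc_atMost)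
  then show ?thesis using 1 2 by (simp add: f_def)
qed

end

subsection \<open>Fourier multipliers with an even power series\<close>

text \<open>The function sin z / z, extended by 1, is entire without zeros in |z| < pi, so its
  reciprocal has a power series in that disc. Taking real parts and averaging over t and -t makes
  the coefficients real and even. At 0 the quotient t / sin t is 0 / 0 = 0, hence the
  exclusion.\<close>

lemma x_over_sin_power_series:
  obtains \<beta> :: "nat \<Rightarrow> real" where
    "\<And>m. odd m \<Longrightarrow> \<beta> m = 0"
    "\<And>t. 0 < \<bar>t\<bar> \<Longrightarrow> \<bar>t\<bar> < pi \<Longrightarrow> (\<lambda>m. \<beta> m * t ^ m) sums (t / sin t)"
proof -
  define g :: "complex \<Rightarrow> complex" where "g z = (if z = 0 then 1 else sin z / z)" for z
  have sin_nz: "sin z \<noteq> 0" if "z \<noteq> 0" "norm z < pi" for z :: complex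
  proof
    assume "sin z = 0"
    then obtain k :: int where k: "z = of_real (of_int k * pi)"
      by (auto simp: sin_eq_0)
    then have "\<bar>of_int k\<bar> * pi < 1 * pi" using that by (simp add: norm_mult abs_mult)
    then have "\<bar>real_of_int k\<bar> < 1" by simp
    then have "k = 0" by linarith
    then show False using k that by simp
  qed
  have "g holomorphic_on UNIV"
  proof (rule no_isolated_singularity'[of "{0}"])
    show "g holomorphic_on UNIV - {0}"
      by (rule holomorphic_transform[of "\<lambda>z. sin z / z"]) (auto intro!: holomorphic_intros simp: g_def)
    have "((\<lambda>z::complex. (sin z - sin 0) / (z - 0)) \<longlongrightarrow> cos 0) (at 0)"
      using DERIV_sin[of "0::complex"] unfolding has_field_derivative_iff .
    then have "((\<lambda>z::complex. sin z / z) \<longlongrightarrow> 1) (at 0)" by simp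
    then have "(g \<longlongrightarrow> 1) (at 0)"
      by (rule Lim_transform_eventually) (auto simp: g_def eventually_at_filter)
    then show "\<And>z. z \<in> {0} \<Longrightarrow> (g \<longlongrightarrow> g z) (at z within UNIV)"
      by (simp add: g_def)
  qed auto
  then have "g holomorphic_on ball 0 pi" by (rule holomorphic_on_subset) simp
  moreover have "g z \<noteq> 0" if "z \<in> ball 0 pi" for z
    using sin_nz[of z] that by (simp add: g_def)
  ultimately have "(\<lambda>z. 1 / g z) holomorphic_on ball 0 pi"
    by (intro holomorphic_on_divide holomorphic_on_const)
  then have ser: "(\<lambda>m. (deriv ^^ m) (\<lambda>z. 1 / g z) 0 / fact m * (z - 0) ^ m) sums (1 / g z)" if "norm z < pi" for z
    by (rule holomorphic_power_series) (use that in simp)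
  define c where "c m = Re ((deriv ^^ m) (\<lambda>z. 1 / g z) 0 / fact m)" for m
  have c: "(\<lambda>m. c m * t ^ m) sums (t / sin t)" if "0 < \<bar>t\<bar>" "\<bar>t\<bar> < pi" for t :: real
  proof -
    have "(\<lambda>m. (deriv ^^ m) (\<lambda>z. 1 / g z) 0 / fact m * of_real (t ^ m)) sums (1 / g (of_real t))"
      using ser[of "of_real t"] that by simp
    then have "(\<lambda>m. Re ((deriv ^^ m) (\<lambda>z. 1 / g z) 0 / fact m * of_real (t ^ m))) sums Re (1 / g (of_real t))"
      by (rule sums_Re)
    moreover have "1 / g (of_real t) = of_real (t / sin t)"
      using that by (simp add: g_def flip: sin_of_real)
    moreover have "Re (a * of_real x) = Re a * x" for a x by simp
    ultimately show ?thesis by (simp only: c_def Re_complex_of_real)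
  qed
  have even: "(\<lambda>m. (if even m then c m else 0) * t ^ m) sums (t / sin t)" if "0 < \<bar>t\<bar>" "\<bar>t\<bar> < pi" for t
  proof -
    have "(\<lambda>m. (c m * t ^ m + c m * (- t) ^ m) / 2) sums ((t / sin t + (- t) / sin (- t)) / 2)"
      by (intro sums_divide sums_add c) (use that in auto)
    moreover have "(c m * t ^ m + c m * (- t) ^ m) / 2 = (if even m then c m else 0) * t ^ m" for m
      by (cases "even m") (auto simp: power_minus_odd)
    ultimately show ?thesis by simp
  qed
  show ?thesis
    by (rule that[of "\<lambda>m. if even m then c m else 0"]) (use even in auto)
qed

text \<open>The weight m amounts to absolute convergence of the derivative of the series at L. It is
  needed where differences of multipliers at neighbouring frequencies occur.\<close>

locale even_multiplier =
  fixes \<beta> :: "nat \<Rightarrow> real" and L :: real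
  assumes odd_zero: "odd m \<Longrightarrow> \<beta> m = 0"
    and L: "L > 0"
    and summable_weight: "summable (\<lambda>m. real m * \<bar>\<beta> m\<bar> * L ^ m)"
begin

definition "psi t = (\<Sum>m. \<beta> m * t ^ m)"
definition "C0 = (\<Sum>m. \<bar>\<beta> m\<bar> * L ^ m)"
definition "C1 = (\<Sum>m. real m * \<bar>\<beta> m\<bar> * L ^ m)"

lemma summable_abs: "summable (\<lambda>m. \<bar>\<beta> m\<bar> * L ^ m)"
proof (rule summable_comparison_test'[OF summable_weight])
  show "norm (\<bar>\<beta> m\<bar> * L ^ m) \<le> real m * \<bar>\<beta> m\<bar> * L ^ m" if "m \<ge> 1" for m
    using mult_right_mono[of 1 "real m" "\<bar>\<beta> m\<bar> * L ^ m"] that L by (simp add: abs_mult mult.assoc)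
qed

lemma psi_sums:
  assumes "\<bar>t\<bar> \<le> L" shows "(\<lambda>m. \<beta> m * t ^ m) sums psi t"
proof -
  have "summable (\<lambda>m. \<beta> m * t ^ m)"
  proof (rule summable_comparison_test'[OF summable_abs])
    show "norm (\<beta> m * t ^ m) \<le> \<bar>\<beta> m\<bar> * L ^ m" for m
      using power_mono[OF assms, of m] by (simp add: abs_mult power_abs mult_left_mono)
  qed
  then show ?thesis unfolding psi_def by (rule summable_sums)
qed

lemma C_nonneg: "C0 \<ge> 0" "C1 \<ge> 0"
  unfolding C0_def C1_def using L by (auto intro!: suminf_nonneg summable_abs summable_weight)

end

text \<open>
  If \<open>Q t = (\<Sum>k\<le>n. A k * cos (k t))\<close>, then \<open>E m\<close> and \<open>D m\<close> are the functions with
  \<open>(d/dt)\<^sup>m (sin t * Q t) = sin t * E m t + cos t * D m t\<close> obtained by differentiating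
  \<open>sin t * cos (k t) = (sin ((k + 1) t) - sin ((k - 1) t)) / 2\<close>.
\<close>

locale cosine_poly =
  fixes A :: "nat \<Rightarrow> real" and n :: nat and B :: real
  assumes n: "n > 0"
    and bound: "\<And>t. \<bar>\<Sum>k\<le>n. A k * cos (real k * t)\<bar> \<le> B"
begin

lemma B: "B \<ge> 0" using bound[of 0] by linarith

definition "e m k = ((k + 1) ^ m + (k - 1) ^ m) / (2::real)" for k :: real
definition "d m k = ((k + 1) ^ m - (k - 1) ^ m) / (2::real)" for k :: real
definition "E m t = (\<Sum>k\<le>n. A k * e m (real k) * cos (real k * t + real m * pi / 2))"
definition "D m t = (\<Sum>k\<le>n. A k * d m (real k) * cos (real k * t + (real m * pi / 2 - pi / 2)))"

lemma E_Suc: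
  "E (Suc m) t = (\<Sum>k\<le>n. A k * e m (real k) * real k * cos (real k * t + real m * pi / 2 + pi / 2)) - D m t"
  unfolding E_def D_def sum_subtractf[symmetric]
proof (rule sum.cong[OF refl])
  fix k
  have "e (Suc m) (real k) = real k * e m (real k) + d m (real k)"
    by (simp add: e_def d_def field_simps)
  moreover have "real k * t + real (Suc m) * pi / 2 = real k * t + real m * pi / 2 + pi / 2"
    by (simp add: field_simps)
  moreover have "cos (real k * t + (real m * pi / 2 - pi / 2)) = - cos (real k * t + real m * pi / 2 + pi / 2)"
    using cos_minus_pi[of "real k * t + real m * pi / 2 + pi / 2"] by (simp add: algebra_simps)
  ultimately show "A k * e (Suc m) (real k) * cos (real k * t + real (Suc m) * pi / 2) =
      A k * e m (real k) * real k * cos (real k * t + real m * pi / 2 + pi / 2)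
       - A k * d m (real k) * cos (real k * t + (real m * pi / 2 - pi / 2))"
    by (simp only:) (simp add: algebra_simps)
qed

lemma D_Suc:
  "D (Suc m) t = (\<Sum>k\<le>n. A k * d m (real k) * real k * cos (real k * t + (real m * pi / 2 - pi / 2) + pi / 2)) + E m t"
  unfolding E_def D_def sum.distrib[symmetric]
proof (rule sum.cong[OF refl])
  fix k
  have "d (Suc m) (real k) = real k * d m (real k) + e m (real k)"
    by (simp add: e_def d_def field_simps)
  moreover have "real k * t + (real (Suc m) * pi / 2 - pi / 2) = real k * t + real m * pi / 2"
    by (simp add: field_simps)
  moreover have "real k * t + (real m * pi / 2 - pi / 2) + pi / 2 = real k * t + real m * pi / 2"
    by simp
  ultimately show "A k * d (Suc m) (real k) * cos (real k * t + (real (Suc m) * pi / 2 - pi / 2)) =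
      A k * d m (real k) * real k * cos (real k * t + (real m * pi / 2 - pi / 2) + pi / 2)
       + A k * e m (real k) * cos (real k * t + real m * pi / 2)"
    by (simp only:) (simp add: algebra_simps)
qed

text \<open>\<open>E_Suc\<close> and \<open>D_Suc\<close> say that E at m + 1 is the derivative of E
  minus D, and D at m + 1 is the derivative of D plus E. Bernstein turns a derivative into a factor
  n, and \<open>e\<close>, \<open>d\<close> at n obey this recursion with plus signs.\<close>

lemma E_D_le:
  "\<bar>E m t\<bar> \<le> e m (real n) * B \<and> \<bar>D m t\<bar> \<le> d m (real n) * B"
proof (induction m arbitrary: t)
  case 0
  then show ?case using bound[of t] by (simp add: E_def D_def e_def d_def)
next
  case (Suc m)
  have "\<bar>\<Sum>k\<le>n. A k * e m (real k) * real k * cos (real k * t + real m * pi / 2 + pi / 2)\<bar> \<le> real n * (e m (real n) * B)"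
    by (rule bernstein_inequality) (use Suc in \<open>simp add: E_def\<close>)
  moreover have "\<bar>\<Sum>k\<le>n. A k * d m (real k) * real k * cos (real k * t + (real m * pi / 2 - pi / 2) + pi / 2)\<bar>
      \<le> real n * (d m (real n) * B)"
    by (rule bernstein_inequality) (use Suc in \<open>simp add: D_def\<close>)
  moreover have "e (Suc m) (real n) * B = real n * (e m (real n) * B) + d m (real n) * B"
    "d (Suc m) (real n) * B = real n * (d m (real n) * B) + e m (real n) * B"
    by (simp_all add: e_def d_def field_simps)
  ultimately show ?case using Suc[of t] unfolding E_Suc D_Suc by linarith
qed

lemma e_le: "e m (real n) \<le> (real n + 1) ^ m"
  using n power_mono[of "real n - 1" "real n + 1" m] by (simp add: e_def)

text \<open>Two m-th powers whose bases differ by 2 have a difference smaller by one power, at the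
  price of a factor m. The gain of n + 1 pays for the Lipschitz constant in
  \<open>R_le_sin\<close>.\<close>

lemma d_le: "(real n + 1) * d m (real n) \<le> real m * (real n + 1) ^ m"
proof -
  define r q where "r = real n + 1" and "q = real n - 1"
  have rq: "0 \<le> q" "q \<le> r" "r = q + 2" using n by (auto simp: r_def q_def)
  have "r * (r ^ m - q ^ m) \<le> 2 * real m * r ^ m"
  proof (induction m)
    case (Suc m)
    have "r * (r ^ Suc m - q ^ Suc m) = r * (r * (r ^ m - q ^ m)) + 2 * (r * q ^ m)"
      using rq by (simp add: algebra_simps)
    also have "\<dots> \<le> r * (2 * real m * r ^ m) + 2 * (r * r ^ m)"
      using Suc rq power_mono[of q r m] by (intro add_mono mult_left_mono) auto
    finally show ?case by (simp add: algebra_simps)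
  qed simp
  then show ?thesis by (simp add: d_def r_def q_def)
qed

end

locale multiplied_cosine_poly = even_multiplier + cosine_poly +
  fixes \<rho> :: real
  assumes rho: "\<rho> > 0" "\<rho> * (real n + 1) \<le> L"
begin

text \<open>Applying the multiplier \<open>psi\<close> to sin t times the cosine sum gives sin t *
  \<open>Phi\<close> + cos t * \<open>R\<close>. Only the second summand is not visibly divisible by
  sin t.\<close>

definition "Phi t = (\<Sum>k\<le>n. A k * ((psi (\<rho> * (real k + 1)) + psi (\<rho> * (real k - 1))) / 2) * cos (real k * t))"
definition "R t = (\<Sum>k\<le>n. A k * ((psi (\<rho> * (real k + 1)) - psi (\<rho> * (real k - 1))) / 2) * cos (real k * t + - pi / 2))"

lemma psi_sums_k:
  assumes "k \<le> n"
  shows "(\<lambda>m. \<beta> m * \<rho> ^ m * e m (real k)) sums ((psi (\<rho> * (real k + 1)) + psi (\<rho> * (real k - 1))) / 2)"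
    and "(\<lambda>m. \<beta> m * \<rho> ^ m * d m (real k)) sums ((psi (\<rho> * (real k + 1)) - psi (\<rho> * (real k - 1))) / 2)"
proof -
  have "\<rho> * \<bar>real k + 1\<bar> \<le> \<rho> * (real n + 1)" "\<rho> * \<bar>real k - 1\<bar> \<le> \<rho> * (real n + 1)"
    using assms rho by (intro mult_left_mono; simp)+
  then have "\<bar>\<rho> * (real k + 1)\<bar> \<le> L" "\<bar>\<rho> * (real k - 1)\<bar> \<le> L"
    using rho by (simp_all only: abs_mult abs_of_pos[OF rho(1)])
  note s = this[THEN psi_sums]
  show "(\<lambda>m. \<beta> m * \<rho> ^ m * e m (real k)) sums ((psi (\<rho> * (real k + 1)) + psi (\<rho> * (real k - 1))) / 2)"
  proof -
    have "\<beta> m * \<rho> ^ m * e m (real k) = (\<beta> m * (\<rho> * (real k + 1)) ^ m + \<beta> m * (\<rho> * (real k - 1)) ^ m) / 2" for m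
      unfolding e_def power_mult_distrib by (simp add: distrib_left mult.assoc)
    then show ?thesis by (simp only:) (rule sums_divide[OF sums_add[OF s]])
  qed
  show "(\<lambda>m. \<beta> m * \<rho> ^ m * d m (real k)) sums ((psi (\<rho> * (real k + 1)) - psi (\<rho> * (real k - 1))) / 2)"
  proof -
    have "\<beta> m * \<rho> ^ m * d m (real k) = (\<beta> m * (\<rho> * (real k + 1)) ^ m - \<beta> m * (\<rho> * (real k - 1)) ^ m) / 2" for m
      unfolding d_def power_mult_distrib by (simp add: right_diff_distrib mult.assoc)
    then show ?thesis by (simp only:) (rule sums_divide[OF sums_diff[OF s]])
  qed
qed

text \<open>For even m the factor cos (m pi / 2) is the sign (-1)^(m / 2) by which the m-th
  derivative of cos (k t) differs from k^m cos (k t). It turns powers of the frequency into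
  derivatives.\<close>

lemma cos_shift_even:
  assumes "even m"
  shows "cos (real m * pi / 2) * cos (x + real m * pi / 2) = cos x"
    and "cos (real m * pi / 2) * cos (x + (real m * pi / 2 - pi / 2)) = cos (x + - pi / 2)"
proof -
  obtain j where "m = 2 * j" using assms by auto
  then have m: "real m * pi / 2 = real j * pi" by simp
  have sq: "(-1::real) ^ j * (-1) ^ j = 1" by (simp flip: power_add mult_2)
  show "cos (real m * pi / 2) * cos (x + real m * pi / 2) = cos x"
    using sq unfolding m by (simp add: cos_add mult.left_commute[of _ "cos x"])
  show "cos (real m * pi / 2) * cos (x + (real m * pi / 2 - pi / 2)) = cos (x + - pi / 2)"
    using sq unfolding m by (simp add: cos_add cos_diff sin_diff mult.left_commute[of _ "sin x"])
qed

lemma Phi_sums: "(\<lambda>m. \<beta> m * \<rho> ^ m * cos (real m * pi / 2) * E m t) sums Phi t"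
proof -
  have "(\<lambda>m. \<Sum>k\<le>n. A k * (\<beta> m * \<rho> ^ m * e m (real k)) * cos (real k * t)) sums Phi t"
    unfolding Phi_def by (intro sums_sum sums_mult2 sums_mult psi_sums_k) simp
  moreover have "(\<Sum>k\<le>n. A k * (\<beta> m * \<rho> ^ m * e m (real k)) * cos (real k * t))
      = \<beta> m * \<rho> ^ m * cos (real m * pi / 2) * E m t" for m
  proof (cases "even m")
    case True
    show ?thesis unfolding E_def sum_distrib_left
      by (intro sum.cong[OF refl], subst cos_shift_even(1)[OF True, symmetric]) (simp only: mult_ac)
  qed (simp add: odd_zero)
  ultimately show ?thesis by simp
qed

lemma R_sums: "(\<lambda>m. \<beta> m * \<rho> ^ m * cos (real m * pi / 2) * D m t) sums R t"
proof -
  have "(\<lambda>m. \<Sum>k\<le>n. A k * (\<beta> m * \<rho> ^ m * d m (real k)) * cos (real k * t + - pi / 2)) sums R t"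
    unfolding R_def by (intro sums_sum sums_mult2 sums_mult psi_sums_k) simp
  moreover have "(\<Sum>k\<le>n. A k * (\<beta> m * \<rho> ^ m * d m (real k)) * cos (real k * t + - pi / 2))
      = \<beta> m * \<rho> ^ m * cos (real m * pi / 2) * D m t" for m
  proof (cases "even m")
    case True
    show ?thesis unfolding D_def sum_distrib_left
      by (intro sum.cong[OF refl], subst cos_shift_even(2)[OF True, symmetric]) (simp only: mult_ac)
  qed (simp add: odd_zero)
  ultimately show ?thesis by simp
qed

lemma rho_power_le: "\<rho> ^ m * (real n + 1) ^ m \<le> L ^ m"
  using rho by (simp flip: power_mult_distrib add: power_mono)

lemma Phi_le: "\<bar>Phi t\<bar> \<le> C0 * B"
proof -
  have le: "norm (\<beta> m * \<rho> ^ m * cos (real m * pi / 2) * E m t) \<le> \<bar>\<beta> m\<bar> * L ^ m * B" for m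
  proof -
    have "\<bar>E m t\<bar> \<le> (real n + 1) ^ m * B"
      using E_D_le[of m t] mult_right_mono[OF e_le B, of m] by linarith
    then have "\<bar>\<beta> m * \<rho> ^ m * cos (real m * pi / 2) * E m t\<bar> \<le> \<bar>\<beta> m\<bar> * \<rho> ^ m * 1 * ((real n + 1) ^ m * B)"
      unfolding abs_mult using rho by (intro mult_mono) auto
    also have "\<dots> = \<bar>\<beta> m\<bar> * (\<rho> ^ m * (real n + 1) ^ m) * B" by simp
    also have "\<dots> \<le> \<bar>\<beta> m\<bar> * L ^ m * B"
      using rho_power_le B by (intro mult_right_mono mult_left_mono) auto
    finally show ?thesis by simp
  qed
  have "norm (Phi t) \<le> (\<Sum>m. \<bar>\<beta> m\<bar> * L ^ m * B)"
    unfolding sums_unique[OF Phi_sums]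
    by (rule norm_suminf_le[OF le]) (intro summable_mult2 summable_abs)
  then show ?thesis by (simp add: C0_def suminf_mult2[OF summable_abs, symmetric])
qed

lemma R_le: "\<bar>R t\<bar> \<le> C1 * (B / (real n + 1))"
proof -
  have le: "norm (\<beta> m * \<rho> ^ m * cos (real m * pi / 2) * D m t) \<le> real m * \<bar>\<beta> m\<bar> * L ^ m * (B / (real n + 1))" for m
  proof -
    have "d m (real n) \<le> real m * (real n + 1) ^ m / (real n + 1)"
      using d_le[of m] by (simp add: field_simps)
    then have "d m (real n) * B \<le> real m * (real n + 1) ^ m / (real n + 1) * B"
      using B by (rule mult_right_mono)
    then have "\<bar>D m t\<bar> \<le> real m * (real n + 1) ^ m / (real n + 1) * B"
      using E_D_le[of m t] by linarith
    then have "\<bar>\<beta> m * \<rho> ^ m * cos (real m * pi / 2) * D m t\<bar>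
        \<le> \<bar>\<beta> m\<bar> * \<rho> ^ m * 1 * (real m * (real n + 1) ^ m / (real n + 1) * B)"
      unfolding abs_mult using rho by (intro mult_mono) auto
    also have "\<dots> = \<bar>\<beta> m\<bar> * real m * (\<rho> ^ m * (real n + 1) ^ m) * (B / (real n + 1))" by simp
    also have "\<dots> \<le> \<bar>\<beta> m\<bar> * real m * L ^ m * (B / (real n + 1))"
      using rho_power_le B by (intro mult_right_mono mult_left_mono) auto
    finally show ?thesis by (simp add: mult_ac)
  qed
  have "norm (R t) \<le> (\<Sum>m. real m * \<bar>\<beta> m\<bar> * L ^ m * (B / (real n + 1)))"
    unfolding sums_unique[OF R_sums]
    by (rule norm_suminf_le[OF le]) (intro summable_mult2 summable_weight)
  then show ?thesis
    unfolding C1_def using suminf_mult2[OF summable_weight, of "B / (real n + 1)"] by simp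
qed

text \<open>\<open>R\<close> vanishes at 0 and pi and is Lipschitz with a constant independent of n,
  so it is bounded by the distance to the nearer end point, which is at most 2 sin t.\<close>

lemma R_le_sin:
  assumes "0 \<le> t" "t \<le> pi" shows "\<bar>R t\<bar> \<le> 2 * C1 * B * sin t"
proof -
  have "real n / (real n + 1) \<le> 1" by simp
  then have "real n / (real n + 1) * (C1 * B) \<le> 1 * (C1 * B)"
    using C_nonneg B by (intro mult_right_mono) auto
  then have le: "real n * (C1 * (B / (real n + 1))) \<le> C1 * B" by (simp add: mult_ac)
  have lip: "\<bar>R t - R s\<bar> \<le> C1 * B * \<bar>t - s\<bar>" for t s
  proof -
    have "\<bar>R t - R s\<bar> \<le> real n * (C1 * (B / (real n + 1))) * \<bar>t - s\<bar>"
      unfolding R_def by (rule trig_lipschitz) (use R_le in \<open>simp add: R_def\<close>)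
    also have "\<dots> \<le> C1 * B * \<bar>t - s\<bar>" using le by (intro mult_right_mono) auto
    finally show ?thesis .
  qed
  have c: "cos (x + - pi / 2) = sin x" for x by (simp add: cos_diff)
  have zero: "R 0 = 0" "R pi = 0"
    unfolding R_def c by simp_all
  show ?thesis
  proof (cases "t \<le> pi / 2")
    case True
    have "\<bar>R t\<bar> \<le> C1 * B * t" using lip[of t 0] zero assms by simp
    also have "\<dots> \<le> C1 * B * (2 * sin t)"
      using half_le_sin[of t] True assms C_nonneg B by (intro mult_left_mono) auto
    finally show ?thesis by simp
  next
    case False
    have "\<bar>R t\<bar> \<le> C1 * B * (pi - t)" using lip[of t pi] zero assms by simp
    also have "\<dots> \<le> C1 * B * (2 * sin t)"
      using half_le_sin[of "pi - t"] False assms C_nonneg B by (intro mult_left_mono) auto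
    finally show ?thesis by simp
  qed
qed

theorem multiplied_sine_poly_le:
  assumes "0 \<le> t" "t \<le> pi"
  shows "\<bar>\<Sum>k\<le>n. A k * ((psi (\<rho> * (real k + 1)) * sin ((real k + 1) * t) - psi (\<rho> * (real k - 1)) * sin ((real k - 1) * t)) / 2)\<bar>
    \<le> (C0 + 2 * C1) * B * sin t"
proof -
  have "(\<Sum>k\<le>n. A k * ((psi (\<rho> * (real k + 1)) * sin ((real k + 1) * t) - psi (\<rho> * (real k - 1)) * sin ((real k - 1) * t)) / 2))
     = sin t * Phi t + cos t * R t"
    unfolding Phi_def R_def sum_distrib_left sum.distrib[symmetric]
  proof (rule sum.cong[OF refl])
    fix k
    have s: "sin ((real k + 1) * t) = sin (real k * t) * cos t + cos (real k * t) * sin t"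
      "sin ((real k - 1) * t) = sin (real k * t) * cos t - cos (real k * t) * sin t"
      by (simp_all add: distrib_right left_diff_distrib sin_add sin_diff)
    have c: "cos (real k * t + - pi / 2) = sin (real k * t)" by (simp add: cos_diff)
    show "A k * ((psi (\<rho> * (real k + 1)) * sin ((real k + 1) * t) - psi (\<rho> * (real k - 1)) * sin ((real k - 1) * t)) / 2)
      = sin t * (A k * ((psi (\<rho> * (real k + 1)) + psi (\<rho> * (real k - 1))) / 2) * cos (real k * t))
       + cos t * (A k * ((psi (\<rho> * (real k + 1)) - psi (\<rho> * (real k - 1))) / 2) * cos (real k * t + - pi / 2))"
      unfolding s c by (simp add: field_simps)
  qed
  also have "\<bar>\<dots>\<bar> \<le> sin t * (C0 * B) + 1 * (2 * C1 * B * sin t)"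
  proof (rule order.trans[OF abs_triangle_ineq add_mono])
    show "\<bar>sin t * Phi t\<bar> \<le> sin t * (C0 * B)"
      using Phi_le sin_ge_zero[OF assms] by (simp add: abs_mult mult_left_mono)
    show "\<bar>cos t * R t\<bar> \<le> 1 * (2 * C1 * B * sin t)"
      unfolding abs_mult using R_le_sin[OF assms] by (intro mult_mono) auto
  qed
  finally show ?thesis by (simp add: algebra_simps)
qed

end

lemma even_multiplier_exists:
  assumes "0 < L" "L < pi"
  obtains \<beta> where "even_multiplier \<beta> L"
    "\<And>t. 0 < \<bar>t\<bar> \<Longrightarrow> \<bar>t\<bar> \<le> L \<Longrightarrow> even_multiplier.psi \<beta> t = t / sin t"
proof -
  obtain \<beta> :: "nat \<Rightarrow> real" where b: "\<And>m. odd m \<Longrightarrow> \<beta> m = 0"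
    "\<And>t. 0 < \<bar>t\<bar> \<Longrightarrow> \<bar>t\<bar> < pi \<Longrightarrow> (\<lambda>m. \<beta> m * t ^ m) sums (t / sin t)"
    using x_over_sin_power_series by blast
  \<comment> \<open>A radius strictly between L and pi: convergence up to \<open>M\<close> yields
    absolute convergence of the differentiated series at L.\<close>
  define M where "M = (L + pi) / 2"
  have M: "L < M" "M < pi" "M > 0" using assms by (auto simp: M_def)
  have sM: "summable (\<lambda>m. \<bar>\<beta> m\<bar> * x ^ m)" if "norm x < M" for x :: real
  proof -
    have "summable (\<lambda>m. \<beta> m * M ^ m)" using b(2)[of M] M by (auto simp: sums_iff)
    then have "summable (\<lambda>m. norm (\<beta> m * x ^ m))"
      by (rule powser_insidea) (use that M in auto)
    then show ?thesis
      using summable_norm_cancel[of "\<lambda>m. \<bar>\<beta> m\<bar> * x ^ m"] by (simp add: abs_mult)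
  qed
  have "summable (\<lambda>m. diffs (\<lambda>m. \<bar>\<beta> m\<bar>) m * L ^ m)"
    by (rule termdiff_converges[of L M]) (use sM assms M in auto)
  then have "summable (\<lambda>m. L * (diffs (\<lambda>m. \<bar>\<beta> m\<bar>) m * L ^ m))" by (rule summable_mult)
  then have "summable (\<lambda>m. real (Suc m) * \<bar>\<beta> (Suc m)\<bar> * L ^ Suc m)"
    by (simp add: diffs_def mult_ac)
  then have "summable (\<lambda>m. real m * \<bar>\<beta> m\<bar> * L ^ m)"
    by (rule summable_Suc_iff[THEN iffD1])
  then interpret even_multiplier \<beta> L
    using b assms by unfold_locales auto
  have "psi t = t / sin t" if "0 < \<bar>t\<bar>" "\<bar>t\<bar> \<le> L" for t
    using sums_unique2[OF psi_sums[OF that(2)] b(2)] that assms by simp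
  then show ?thesis using that even_multiplier_axioms by blast
qed

subsection \<open>Growth outside the interval\<close>

text \<open>Since cosh s is the cosine of an imaginary angle, the value at cosh s is the Taylor
  series at 0 of p (cos t) with its alternating signs removed. Iterated Bernstein bounds the m-th
  derivative by n^m B, and the majorant sums to cosh (n s) B.\<close>

lemma poly_cosh_le:
  assumes "degree p \<le> n" "\<And>x. \<bar>x\<bar> \<le> 1 \<Longrightarrow> \<bar>poly p x\<bar> \<le> B"
  shows "\<bar>poly p (cosh s)\<bar> \<le> cosh (real n * s) * B"
proof -
  obtain a where a: "p = (\<Sum>k\<le>n. smult (a k) (chebT k))"
    using cheb_expansion[OF assms(1)] .
  have "\<bar>\<Sum>k\<le>n. a k * real k ^ m * cos (real k * t + real m * pi / 2)\<bar> \<le> real n ^ m * B" for m t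
  proof (induction m arbitrary: t)
    case 0
    have "poly p (cos t) = (\<Sum>k\<le>n. a k * cos (real k * t))"
      by (simp add: a poly_sum chebT_cos)
    then show ?case using assms(2)[of "cos t"] by simp
  next
    case (Suc m)
    have "\<bar>\<Sum>k\<le>n. a k * real k ^ m * real k * cos (real k * t + real m * pi / 2 + pi / 2)\<bar> \<le> real n * (real n ^ m * B)"
      by (rule bernstein_inequality) (rule Suc)
    moreover have "real k * t + real (Suc m) * pi / 2 = real k * t + real m * pi / 2 + pi / 2" for k
      by (simp add: field_simps)
    ultimately show ?case by (simp only: power_Suc2 mult.assoc) (simp only: mult_ac)
  qed
  note der = this
  have sum_le: "\<bar>\<Sum>k\<le>n. a k * real k ^ m\<bar> \<le> real n ^ m * B" if "even m" for m
  proof -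
    obtain j where "m = 2 * j" using \<open>even m\<close> by auto
    then have m: "real k * 0 + real m * pi / 2 = real j * pi" for k by simp
    have "(\<Sum>k\<le>n. a k * real k ^ m * (- 1) ^ j) = (\<Sum>k\<le>n. a k * real k ^ m) * (- 1) ^ j"
      by (rule sum_distrib_right[symmetric])
    then show ?thesis using der[of m 0] unfolding m cos_npi by (simp add: abs_mult)
  qed
  have B: "B \<ge> 0" using assms(2)[of 0] by linarith
  have ser: "(\<lambda>m. \<Sum>k\<le>n. a k * (if even m then (real k * s) ^ m /\<^sub>R fact m else 0)) sums poly p (cosh s)"
    unfolding a poly_sum poly_smult chebT_cosh by (intro sums_sum sums_mult cosh_converges)
  have up: "(\<lambda>m. (if even m then (real n * s) ^ m /\<^sub>R fact m else 0) * B) sums (cosh (real n * s) * B)"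
    by (intro sums_mult2 cosh_converges)
  have le: "norm (\<Sum>k\<le>n. a k * (if even m then (real k * s) ^ m /\<^sub>R fact m else 0))
      \<le> (if even m then (real n * s) ^ m /\<^sub>R fact m else 0) * B" for m
  proof (cases "even m")
    case True
    have "(\<Sum>k\<le>n. a k * (if even m then (real k * s) ^ m /\<^sub>R fact m else 0))
       = (\<Sum>k\<le>n. a k * real k ^ m) * (s ^ m / fact m)"
      unfolding sum_distrib_right
      by (intro sum.cong refl) (simp add: True power_mult_distrib divide_inverse mult_ac)
    also have "norm \<dots> \<le> real n ^ m * B * (s ^ m / fact m)"
    proof -
      have sm: "0 \<le> s ^ m / fact m" using True by (simp add: zero_le_even_power)
      show ?thesis
        unfolding real_norm_def abs_mult abs_of_nonneg[OF sm]
        by (rule mult_right_mono[OF sum_le[OF True] sm])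
    qed
    finally show ?thesis using True by (simp add: power_mult_distrib divide_inverse mult_ac)
  qed simp
  have "norm (poly p (cosh s)) \<le> (\<Sum>m. (if even m then (real n * s) ^ m /\<^sub>R fact m else 0) * B)"
    unfolding sums_unique[OF ser] by (rule norm_suminf_le[OF le sums_summable[OF up]])
  then show ?thesis using sums_unique[OF up] by simp
qed

lemma poly_growth:
  assumes "degree q \<le> n" "\<And>x. \<bar>x\<bar> \<le> c \<Longrightarrow> \<bar>poly q x\<bar> \<le> B" "0 < c" "0 \<le> h" "1 \<le> c * cosh h" "\<bar>x\<bar> \<le> 1"
  shows "\<bar>poly q x\<bar> \<le> cosh (real n * h) * B"
proof (cases "\<bar>x\<bar> \<le> c")
  case True
  have "B \<ge> 0" using assms(2)[of 0] assms(3) by simp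
  then have "1 * B \<le> cosh (real n * h) * B" by (intro mult_right_mono cosh_real_ge_1)
  then show ?thesis using assms(2)[OF True] by simp
next
  case False
  \<comment> \<open>The sign is absorbed into the rescaling, so that only points to the right of the
    interval remain.\<close>
  define \<sigma> :: real where "\<sigma> = sgn x"
  have \<sigma>: "\<bar>\<sigma>\<bar> = 1" "\<sigma> * \<bar>x\<bar> = x" using False assms(3) by (auto simp: \<sigma>_def sgn_if)
  define p where "p = pcompose q [:0, c * \<sigma>:]"
  have p: "poly p y = poly q (c * \<sigma> * y)" for y by (simp add: p_def poly_pcompose mult_ac)
  have dp: "degree p \<le> n" using assms(1) by (simp add: p_def order.trans[OF degree_pcompose_le])
  define s where "s = arcosh (\<bar>x\<bar> / c)"
  have y1: "\<bar>x\<bar> / c \<ge> 1" using False assms(3) by simp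
  then have s: "cosh s = \<bar>x\<bar> / c" "s \<ge> 0" by (auto simp: s_def cosh_arcosh_real)
  have "cosh s \<le> cosh h"
  proof -
    have "\<bar>x\<bar> / c \<le> 1 / c" using assms by (intro divide_right_mono) auto
    also have "\<dots> \<le> cosh h" using assms by (simp add: field_simps)
    finally show ?thesis using s by simp
  qed
  then have "s \<le> h" using s assms(4) cosh_real_nonneg_le_iff by blast
  have "\<bar>poly p (cosh s)\<bar> \<le> cosh (real n * s) * B"
  proof (rule poly_cosh_le[OF dp])
    show "\<bar>poly p y\<bar> \<le> B" if "\<bar>y\<bar> \<le> 1" for y
      unfolding p using assms(3) that \<sigma> by (intro assms(2)) (simp add: abs_mult mult_left_le)
  qed
  also have "poly p (cosh s) = poly q x"
  proof -
    have "c * \<sigma> * (\<bar>x\<bar> / c) = x" using assms(3) \<sigma> by simp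
    then show ?thesis unfolding p s by simp
  qed
  also have "cosh (real n * s) * B \<le> cosh (real n * h) * B"
  proof (rule mult_right_mono)
    have "real n * s \<le> real n * h" using \<open>s \<le> h\<close> by (intro mult_left_mono) auto
    then show "cosh (real n * s) \<le> cosh (real n * h)"
      using s assms(4) by (subst cosh_real_nonneg_le_iff) auto
    show "B \<ge> 0" using assms(2)[of 0] assms(3) by simp
  qed
  finally show ?thesis .
qed

lemma cosh_ge_quadratic:
  fixes h :: real
  assumes "h \<ge> 0" shows "1 + h\<^sup>2 / 4 \<le> cosh h"
proof -
  have "1 + h + h\<^sup>2 / 2 \<le> exp h" using exp_lower_Taylor_quadratic[OF assms] .
  moreover have "1 - h \<le> exp (- h)" using exp_ge_add_one_self[of "- h"] by simp
  ultimately show ?thesis by (simp add: cosh_def)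
qed

text \<open>From 1 / cos^2 = 1 + tan^2 and the quadratic lower bound for cosh. It shows that h = 2
  tan \<rho> suffices to reach from cos \<rho> to 1 in \<open>poly_growth\<close>; as h is of order
  \<rho>, the product n h will stay bounded.\<close>

lemma cos_cosh_tan_ge_1:
  assumes "0 \<le> \<rho>" "\<rho> < pi / 2" shows "1 \<le> cos \<rho> * cosh (2 * tan \<rho>)"
proof -
  have c: "0 < cos \<rho>" "cos \<rho> \<le> 1" using assms by (auto intro: cos_gt_zero_pi)
  have "1 \<le> 1 / cos \<rho>" using c by simp
  also have "1 / cos \<rho> = cos \<rho> * (1 + (2 * tan \<rho>)\<^sup>2 / 4)"
  proof -
    have "cos \<rho> * (1 + (2 * tan \<rho>)\<^sup>2 / 4) = ((cos \<rho>)\<^sup>2 + (sin \<rho>)\<^sup>2) / cos \<rho>"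
      using c by (simp add: tan_def field_simps power2_eq_square)
    then show ?thesis by simp
  qed
  also have "\<dots> \<le> cos \<rho> * cosh (2 * tan \<rho>)"
    using c assms by (intro mult_left_mono cosh_ge_quadratic) (auto simp: tan_def sin_ge_zero)
  finally show ?thesis .
qed

subsection \<open>Averages over segments\<close>

lemma arc_segment_interval:
  assumes "0 \<le> \<rho>" "\<rho> \<le> t" "t \<le> pi - \<rho>"
  shows "cos (t + \<rho>) \<le> cos (t - \<rho>)" "arc_segment \<rho> t \<subseteq> {-1..1}"
    "measure lborel (arc_segment \<rho> t) = 2 * sin t * sin \<rho>"
proof -
  show *: "cos (t + \<rho>) \<le> cos (t - \<rho>)"
    using assms by (intro cos_monotone_0_pi_le) auto
  show "arc_segment \<rho> t \<subseteq> {-1..1}"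
    unfolding arc_segment_def by (auto intro: order.trans[OF cos_ge_minus_one] order.trans[OF _ cos_le_one])
  show "measure lborel (arc_segment \<rho> t) = 2 * sin t * sin \<rho>"
    using * unfolding arc_segment_def by (simp add: cos_add cos_diff)
qed

lemma poly_integrable_segment: "poly p integrable_on arc_segment \<rho> t"
  unfolding arc_segment_def by (intro integrable_continuous_real continuous_intros)

lemma average_poly_sum:
  assumes "finite K"
  shows "average (arc_segment \<rho> t) (poly (\<Sum>k\<in>K. smult (a k) (p k))) = (\<Sum>k\<in>K. a k * average (arc_segment \<rho> t) (poly (p k)))"
proof -
  have "poly (\<Sum>k\<in>K. smult (a k) (p k)) = (\<lambda>x. \<Sum>k\<in>K. a k * poly (p k) x)"
    by (simp add: poly_sum fun_eq_iff)
  then have "integral (arc_segment \<rho> t) (poly (\<Sum>k\<in>K. smult (a k) (p k)))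
     = integral (arc_segment \<rho> t) (\<lambda>x. \<Sum>k\<in>K. a k * poly (p k) x)"
    by simp
  also have "\<dots> = (\<Sum>k\<in>K. a k * integral (arc_segment \<rho> t) (poly (p k)))"
    using assms by (subst integral_sum) (auto intro!: integrable_on_mult_right poly_integrable_segment)
  finally show ?thesis by (simp add: average_def sum_divide_distrib)
qed

lemma average_poly_diff:
  "average (arc_segment \<rho> t) (poly (p - q)) = average (arc_segment \<rho> t) (poly p) - average (arc_segment \<rho> t) (poly q)"
proof -
  have "integral (arc_segment \<rho> t) (\<lambda>x. poly p x - poly q x)
    = integral (arc_segment \<rho> t) (poly p) - integral (arc_segment \<rho> t) (poly q)"
    by (intro integral_diff poly_integrable_segment)
  moreover have "poly (p - q) = (\<lambda>x. poly p x - poly q x)" by auto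
  ultimately show ?thesis by (simp add: average_def diff_divide_distrib)
qed

text \<open>The antiderivative \<open>chebT (Suc k)\<close> / (k + 1) has cosines as end point
  values. Their difference is a product of two sines, and so is the length of the segment.\<close>

lemma average_chebU:
  assumes "0 < \<rho>" "\<rho> < pi / 2" "\<rho> \<le> t" "t \<le> pi - \<rho>"
  shows "average (arc_segment \<rho> t) (poly (chebU k))
     = sin (real (Suc k) * \<rho>) / (real (Suc k) * sin \<rho>) * poly (chebU k) (cos t)"
proof -
  have s: "sin t > 0" "sin \<rho> > 0" using assms by (auto intro!: sin_gt_zero)
  define F where "F x = poly (chebT (Suc k)) x / real (Suc k)" for x
  have "(poly (chebU k) has_integral (F (cos (t - \<rho>)) - F (cos (t + \<rho>)))) {cos (t + \<rho>)..cos (t - \<rho>)}"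
  proof (rule fundamental_theorem_of_calculus)
    show "cos (t + \<rho>) \<le> cos (t - \<rho>)" using arc_segment_interval[of \<rho> t] assms by simp
    fix x
    have "(F has_real_derivative poly (chebU k) x) (at x)"
      unfolding F_def chebU_def by (auto intro!: derivative_eq_intros poly_DERIV simp del: chebT.simps)
    then show "(F has_vector_derivative poly (chebU k) x) (at x within {cos (t + \<rho>)..cos (t - \<rho>)})"
      by (simp add: has_real_derivative_iff_has_vector_derivative has_vector_derivative_at_within)
  qed
  then have "integral (arc_segment \<rho> t) (poly (chebU k)) = F (cos (t - \<rho>)) - F (cos (t + \<rho>))"
    unfolding arc_segment_def by (rule integral_unique)
  also have "\<dots> = (cos (real (Suc k) * t - real (Suc k) * \<rho>) - cos (real (Suc k) * t + real (Suc k) * \<rho>)) / real (Suc k)"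
    unfolding F_def chebT_cos by (simp only: diff_divide_distrib distrib_left right_diff_distrib)
  also have "\<dots> = 2 * sin (real (Suc k) * t) * sin (real (Suc k) * \<rho>) / real (Suc k)"
    by (simp only: cos_add cos_diff) simp
  also have "\<dots> = 2 * (sin t * poly (chebU k) (cos t)) * sin (real (Suc k) * \<rho>) / real (Suc k)"
    unfolding chebU_cos ..
  finally have int: "integral (arc_segment \<rho> t) (poly (chebU k))
    = 2 * (sin t * poly (chebU k) (cos t)) * sin (real (Suc k) * \<rho>) / real (Suc k)" .
  have "1 / (2 * a * b) * (2 * (a * u) * x / d) = x / (d * b) * u" if "a > 0" "b > 0" for a b d u x :: real
    using that by (simp add: mult_ac)
  from this[OF s] show ?thesis
    using arc_segment_interval(3)[of \<rho> t] assms unfolding average_def int by simp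
qed

lemma average_le:
  assumes "0 < \<rho>" "\<rho> < pi / 2" "\<rho> \<le> t" "t \<le> pi - \<rho>"
    and f: "continuous_on {-1..1} f" "\<And>x. x \<in> {-1..1} \<Longrightarrow> \<bar>f x\<bar> \<le> 1"
  shows "\<bar>average (arc_segment \<rho> t) f\<bar> \<le> 1"
proof -
  note s = arc_segment_interval[of \<rho> t]
  have pos: "measure lborel (arc_segment \<rho> t) > 0"
    using assms s by (auto intro!: mult_pos_pos sin_gt_zero)
  have sub: "{cos (t + \<rho>)..cos (t - \<rho>)} \<subseteq> {-1..1}"
    using s(2) assms unfolding arc_segment_def by simp
  then have "f integrable_on cbox (cos (t + \<rho>)) (cos (t - \<rho>))"
    using integrable_continuous_real[OF continuous_on_subset[OF f(1) sub]] by simp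
  moreover have "norm (f x) \<le> 1" if "x \<in> cbox (cos (t + \<rho>)) (cos (t - \<rho>))" for x
    using f(2)[OF subsetD[OF sub that[unfolded cbox_interval]]] by simp
  ultimately have "norm (integral (cbox (cos (t + \<rho>)) (cos (t - \<rho>))) f)
      \<le> 1 * measure lborel (cbox (cos (t + \<rho>)) (cos (t - \<rho>)))"
    by (intro integrable_bound) auto
  then have "\<bar>integral (arc_segment \<rho> t) f\<bar> \<le> measure lborel (arc_segment \<rho> t)"
    unfolding arc_segment_def by simp
  then have "\<bar>integral (arc_segment \<rho> t) f\<bar> / measure lborel (arc_segment \<rho> t) \<le> 1"
    using pos by simp
  moreover have "\<bar>average (arc_segment \<rho> t) f\<bar>
      = \<bar>integral (arc_segment \<rho> t) f\<bar> / measure lborel (arc_segment \<rho> t)"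
    using pos unfolding average_def by (simp only: abs_mult abs_divide abs_one abs_of_pos) simp
  ultimately show ?thesis by simp
qed

lemma average_poly_smult:
  "average (arc_segment \<rho> t) (poly (smult a p)) = a * average (arc_segment \<rho> t) (poly p)"
  using average_poly_sum[of "{0::nat}" \<rho> t "\<lambda>_. a" "\<lambda>_. p"] by simp

text \<open>The argument is real so that k - 1 may be -1. At 0 the value is 0 / 0 = 0, and it occurs
  there only next to the factor sin 0.\<close>

definition averaging_inverse :: "real \<Rightarrow> real \<Rightarrow> real" where
  "averaging_inverse \<rho> x = x * sin \<rho> / sin (x * \<rho>)"

lemma averaging_inverse_minus: "averaging_inverse \<rho> (- x) = averaging_inverse \<rho> x"
  by (simp add: averaging_inverse_def)

text \<open>
  Averaging multiplies \<open>chebU k\<close> by \<open>1 / averaging_inverse \<rho> (k + 1)\<close>, so \<open>chebW \<rho> k\<close> is the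
  polynomial whose averages are the values of \<open>chebT k = (chebU k - chebU (k - 2)) / 2\<close>.
\<close>

fun chebW :: "real \<Rightarrow> nat \<Rightarrow> real poly" where
  "chebW \<rho> 0 = smult (averaging_inverse \<rho> 1) (chebU 0)"
| "chebW \<rho> (Suc 0) = smult (averaging_inverse \<rho> 2 / 2) (chebU 1)"
| "chebW \<rho> (Suc (Suc k)) = smult (averaging_inverse \<rho> (real k + 3) / 2) (chebU (Suc (Suc k)))
     - smult (averaging_inverse \<rho> (real k + 1) / 2) (chebU k)"

lemma degree_chebW: "degree (chebW \<rho> k) \<le> k"
proof (cases "(\<rho>, k)" rule: chebW.cases)
  case (3 \<rho>' j)
  then show ?thesis
    by (auto intro!: degree_diff_le order.trans[OF degree_smult_le] simp: degree_chebU)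
qed (auto intro!: order.trans[OF degree_smult_le] simp: degree_chebU)

text \<open>One formula for the three defining cases: for k = 0 evenness folds -1 onto 1, and for k
  = 1 the second term vanishes.\<close>

lemma chebW_cos:
  "sin t * poly (chebW \<rho> k) (cos t) =
    (averaging_inverse \<rho> (real k + 1) * sin ((real k + 1) * t)
      - averaging_inverse \<rho> (real k - 1) * sin ((real k - 1) * t)) / 2"
proof -
  have U: "sin t * (a * poly (chebU j) (cos t)) = a * sin ((real j + 1) * t)" for a j
    using chebU_cos[of t j] by (simp add: mult.left_commute add.commute)
  show ?thesis
  proof (cases "(\<rho>, k)" rule: chebW.cases)
    case (1 \<rho>')
    then show ?thesis
      using averaging_inverse_minus[of \<rho> 1] by (simp add: U)
  next
    case (2 \<rho>')
    then show ?thesis by (simp add: U)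
  next
    case (3 \<rho>' j)
    then have "sin t * poly (chebW \<rho> k) (cos t)
        = sin t * (averaging_inverse \<rho> (real j + 3) / 2 * poly (chebU (Suc (Suc j))) (cos t))
         - sin t * (averaging_inverse \<rho> (real j + 1) / 2 * poly (chebU j) (cos t))"
      by (simp add: right_diff_distrib)
    also have "\<dots> = averaging_inverse \<rho> (real j + 3) / 2 * sin ((real j + 3) * t)
        - averaging_inverse \<rho> (real j + 1) / 2 * sin ((real j + 1) * t)"
      unfolding U by (simp add: add.commute)
    finally have *: "sin t * poly (chebW \<rho> k) (cos t) = averaging_inverse \<rho> (real j + 3) / 2 * sin ((real j + 3) * t)
        - averaging_inverse \<rho> (real j + 1) / 2 * sin ((real j + 1) * t)" .
    have "real j + 3 = real k + 1" "real j + 1 = real k - 1" using 3 by auto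
    then show ?thesis using * by (simp only:) (simp add: diff_divide_distrib)
  qed
qed

lemma average_chebW:
  assumes "0 < \<rho>" "\<rho> < pi / 2" "\<rho> \<le> t" "t \<le> pi - \<rho>" "(real k + 1) * \<rho> < pi"
  shows "average (arc_segment \<rho> t) (poly (chebW \<rho> k)) = poly (chebT k) (cos t)"
proof -
  have st: "sin t > 0" using assms by (auto intro!: sin_gt_zero)
  have sr: "sin \<rho> > 0" using assms by (auto intro!: sin_gt_zero)
  have avgU: "sin t * average (arc_segment \<rho> t) (poly (smult (averaging_inverse \<rho> x / a) (chebU j)))
      = sin (x * t) / a" if "j \<le> k" "x = real j + 1" for j x a
  proof -
    have "(real j + 1) * \<rho> \<le> (real k + 1) * \<rho>"
      using that assms by (intro mult_right_mono) auto
    then have "(real j + 1) * \<rho> < pi" using assms by linarith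
    then have "sin (x * \<rho>) > 0" using assms that by (intro sin_gt_zero) auto
    moreover have "x > 0" using that by simp
    ultimately have *: "averaging_inverse \<rho> x * (sin (x * \<rho>) / (x * sin \<rho>)) = 1"
      using sr by (simp add: averaging_inverse_def)
    have x: "real (Suc j) = x" using that by simp
    have "sin t * average (arc_segment \<rho> t) (poly (smult (averaging_inverse \<rho> x / a) (chebU j)))
      = (averaging_inverse \<rho> x * (sin (x * \<rho>) / (x * sin \<rho>))) * (sin t * poly (chebU j) (cos t)) / a"
      unfolding average_poly_smult average_chebU[OF assms(1-4)] x by (simp add: mult_ac)
    then show ?thesis unfolding * chebU_cos x by simp
  qed
  have "sin t * average (arc_segment \<rho> t) (poly (chebW \<rho> k)) = sin t * cos (real k * t)"
  proof (cases "(\<rho>, k)" rule: chebW.cases)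
    case (1 \<rho>')
    then show ?thesis using avgU[of 0 1 1] by simp
  next
    case (2 \<rho>')
    then show ?thesis using avgU[of 1 2 2] by (simp add: sin_double)
  next
    case (3 \<rho>' j)
    have "sin t * average (arc_segment \<rho> t) (poly (chebW \<rho> k)) = sin ((real j + 3) * t) / 2 - sin ((real j + 1) * t) / 2"
      using avgU[of "Suc (Suc j)" "real j + 3" 2] avgU[of j "real j + 1" 2] 3
      by (simp add: average_poly_diff right_diff_distrib)
    moreover have "(real j + 3) * t = real k * t + t" "(real j + 1) * t = real k * t - t"
      using 3 by (simp_all add: algebra_simps)
    ultimately show ?thesis by (simp only: sin_add sin_diff) (simp add: field_simps)
  qed
  then show ?thesis using st by (simp add: chebT_cos)
qed

section \<open>Interpolation on a family of n + 1 segments\<close>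

locale segment_family =
  fixes n :: nat and \<rho> :: real and \<tau> :: "nat \<Rightarrow> real"
  assumes n: "n > 0" and rho: "\<rho> > 0" "(real n + 1) * \<rho> < pi" and arc: "arc_angles (Suc n) \<rho> \<tau>"
begin

lemma rho_less: "\<rho> < pi / 2"
proof -
  have "2 * \<rho> \<le> (real n + 1) * \<rho>" using n rho by (intro mult_right_mono) auto
  then show ?thesis using rho by linarith
qed

lemma tau: "i \<le> n \<Longrightarrow> \<rho> \<le> \<tau> i \<and> \<tau> i \<le> pi - \<rho>"
  using arc by (auto simp: arc_angles_def)

lemma tau_less: "i < j \<Longrightarrow> j \<le> n \<Longrightarrow> \<tau> i < \<tau> j"
  using arc by (auto simp: arc_angles_def strict_mono_on_def)

abbreviation "x \<equiv> \<lambda>i. cos (\<tau> i)"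
abbreviation "l \<equiv> lagrange_basis n x"
abbreviation "avg i f \<equiv> average (arc_segment \<rho> (\<tau> i)) f"

lemma x_less: "i < j \<Longrightarrow> j \<le> n \<Longrightarrow> x j < x i"
  using tau[of i] tau[of j] tau_less[of i j] rho by (intro cos_monotone_0_pi) auto

lemma inj_x: "inj_on x {..n}"
proof (rule inj_onI)
  fix i j assume "i \<in> {..n}" "j \<in> {..n}" "x i = x j"
  then show "i = j" using x_less[of i j] x_less[of j i] by (cases i j rule: linorder_cases) auto
qed

text \<open>Averaging is diagonal in \<open>chebU\<close>, and (n + 1) * \<rho> < pi keeps its
  entries nonzero, hence it is injective. Since q does not depend on t, questions about averages
  become questions about values at midpoints.\<close>

lemma averaged_poly:
  assumes "degree p \<le> n"
  obtains q where "degree q \<le> n" "q = 0 \<Longrightarrow> p = 0"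
    "\<And>t. \<rho> \<le> t \<Longrightarrow> t \<le> pi - \<rho> \<Longrightarrow> average (arc_segment \<rho> t) (poly p) = poly q (cos t)"
proof -
  have U0: "chebU 0 \<noteq> 0" by (simp add: chebU_def pderiv_pCons)
  obtain a where a: "p = (\<Sum>k\<le>n. smult (a k) (chebU k))"
    by (rule poly_expansion[OF degree_chebU U0 assms])
  define m where "m k = sin (real (Suc k) * \<rho>) / (real (Suc k) * sin \<rho>)" for k
  have m: "m k \<noteq> 0" if "k \<le> n" for k
  proof -
    have "real (Suc k) * \<rho> \<le> (real n + 1) * \<rho>" using that rho by (intro mult_right_mono) auto
    then have "real (Suc k) * \<rho> < pi" using rho by linarith
    then have "sin (real (Suc k) * \<rho>) > 0" using rho by (intro sin_gt_zero mult_pos_pos) auto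
    moreover have "sin \<rho> > 0" using rho rho_less by (intro sin_gt_zero) auto
    ultimately show ?thesis by (simp add: m_def del: of_nat_Suc)
  qed
  show ?thesis
  proof (rule that[of "\<Sum>k\<le>n. smult (a k * m k) (chebU k)"])
    show "degree (\<Sum>k\<le>n. smult (a k * m k) (chebU k)) \<le> n"
      by (rule degree_sum_le) (auto intro: order.trans[OF degree_smult_le] simp: degree_chebU)
    show "p = 0" if "(\<Sum>k\<le>n. smult (a k * m k) (chebU k)) = 0"
    proof -
      have "a k * m k = 0" if "k \<le> n" for k
        by (rule poly_expansion_zero[OF degree_chebU U0 \<open>(\<Sum>k\<le>n. smult (a k * m k) (chebU k)) = 0\<close> that])
      then show ?thesis unfolding a using m by (intro sum.neutral) auto
    qed
    show "average (arc_segment \<rho> t) (poly p) = poly (\<Sum>k\<le>n. smult (a k * m k) (chebU k)) (cos t)"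
      if "\<rho> \<le> t" "t \<le> pi - \<rho>" for t
      unfolding a average_poly_sum[OF finite_atMost] average_chebU[OF rho(1) rho_less that]
      by (simp add: poly_sum m_def mult_ac)
  qed
qed

lemma unisolvent:
  assumes "degree p \<le> n" "\<And>i. i \<le> n \<Longrightarrow> avg i (poly p) = 0" shows "p = 0"
proof -
  obtain q where q: "degree q \<le> n" "q = 0 \<Longrightarrow> p = 0"
    "\<And>t. \<rho> \<le> t \<Longrightarrow> t \<le> pi - \<rho> \<Longrightarrow> average (arc_segment \<rho> t) (poly p) = poly q (cos t)"
    using averaged_poly[OF assms(1)] by blast
  have "q = 0"
    by (rule poly_eq_by_nodes[OF inj_x q(1)]) (use assms(2) q(3) tau in auto)
  then show ?thesis by (rule q(2))
qed

lemma segment_interpolant_eqI: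
  assumes "degree p \<le> n" "\<And>i. i \<le> n \<Longrightarrow> avg i (poly p) = avg i f"
  shows "segment_interpolant (Suc n) (arc_segments (Suc n) \<rho> \<tau>) f = p"
  unfolding segment_interpolant_def
proof (rule the_equality)
  show "degree p \<le> Suc n - 1 \<and> (\<forall>s\<in>arc_segments (Suc n) \<rho> \<tau>. average s (poly p) = average s f)"
    using assms by (auto simp: arc_segments_def)
  fix q assume q: "degree q \<le> Suc n - 1 \<and> (\<forall>s\<in>arc_segments (Suc n) \<rho> \<tau>. average s (poly q) = average s f)"
  have "q - p = 0"
  proof (rule unisolvent)
    show "degree (q - p) \<le> n" using q assms by (intro degree_diff_le) auto
    show "avg i (poly (q - p)) = 0" if "i \<le> n" for i
      using q assms(2)[OF that] that by (simp add: average_poly_diff arc_segments_def)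
  qed
  then show "q = p" by simp
qed

text \<open>The preimage is explicit: the Chebyshev coefficients stay and each
  \<open>chebT k\<close> is replaced by \<open>chebW \<rho> k\<close>. The norm estimate works with
  this form.\<close>

lemma averaging_surjective:
  assumes "degree q \<le> n"
  obtains a where "q = (\<Sum>k\<le>n. smult (a k) (chebT k))"
    "degree (\<Sum>k\<le>n. smult (a k) (chebW \<rho> k)) \<le> n"
    "\<And>i. i \<le> n \<Longrightarrow> avg i (poly (\<Sum>k\<le>n. smult (a k) (chebW \<rho> k))) = poly q (x i)"
proof -
  obtain a where a: "q = (\<Sum>k\<le>n. smult (a k) (chebT k))"
    using cheb_expansion[OF assms] .
  show ?thesis
  proof (rule that[OF a])
    show "degree (\<Sum>k\<le>n. smult (a k) (chebW \<rho> k)) \<le> n"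
      by (rule degree_sum_le) (auto intro: order.trans[OF degree_smult_le] order.trans[OF degree_chebW])
    show "avg i (poly (\<Sum>k\<le>n. smult (a k) (chebW \<rho> k))) = poly q (x i)" if "i \<le> n" for i
    proof -
      have "avg i (poly (chebW \<rho> k)) = poly (chebT k) (x i)" if "k \<le> n" for k
      proof (rule average_chebW)
        have "(real k + 1) * \<rho> \<le> (real n + 1) * \<rho>"
          using \<open>k \<le> n\<close> rho by (intro mult_right_mono) auto
        then show "(real k + 1) * \<rho> < pi" using rho by linarith
      qed (use rho rho_less tau[OF \<open>i \<le> n\<close>] in auto)
      then show ?thesis unfolding average_poly_sum[OF finite_atMost] a by (simp add: poly_sum)
    qed
  qed
qed

theorem interpolant_le:
  assumes mult: "even_multiplier \<beta> L" "(real n + 1) * \<rho> \<le> L" "L < pi"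
      "\<And>t. 0 < \<bar>t\<bar> \<Longrightarrow> \<bar>t\<bar> \<le> L \<Longrightarrow> even_multiplier.psi \<beta> t = t / sin t"
    and leb: "\<And>y. \<bar>y\<bar> \<le> cos \<rho> \<Longrightarrow> (\<Sum>i\<le>n. \<bar>poly (l i) y\<bar>) \<le> \<Lambda>"
    and f: "continuous_on {-1..1} f" "\<And>y. y \<in> {-1..1} \<Longrightarrow> \<bar>f y\<bar> \<le> 1"
    and y: "\<bar>y\<bar> \<le> 1"
  shows "\<bar>poly (segment_interpolant (Suc n) (arc_segments (Suc n) \<rho> \<tau>) f) y\<bar>
    \<le> (even_multiplier.C0 \<beta> L + 2 * even_multiplier.C1 \<beta> L) * (cosh (real n * (2 * tan \<rho>)) * \<Lambda>)"
proof -
  interpret even_multiplier \<beta> L by fact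
  define q where "q = (\<Sum>i\<le>n. smult (avg i f) (l i))"
  define B where "B = cosh (real n * (2 * tan \<rho>)) * \<Lambda>"
  have dq: "degree q \<le> n" unfolding q_def
    by (rule degree_sum_le) (auto intro: order.trans[OF degree_smult_le] degree_lagrange_basis)
  have qx: "poly q (x i) = avg i f" if "i \<le> n" for i
    using that by (simp add: q_def poly_sum lagrange_basis_node[OF inj_x] mult_delta_right)
  have "\<bar>poly q z\<bar> \<le> \<Lambda>" if "\<bar>z\<bar> \<le> cos \<rho>" for z
  proof -
    have "\<bar>poly q z\<bar> \<le> (\<Sum>i\<le>n. \<bar>avg i f * poly (l i) z\<bar>)"
      by (simp add: q_def poly_sum sum_abs)
    also have "\<dots> \<le> (\<Sum>i\<le>n. 1 * \<bar>poly (l i) z\<bar>)"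
      unfolding abs_mult
      using average_le[OF rho(1) rho_less _ _ f] tau by (intro sum_mono mult_right_mono) auto
    also have "\<dots> \<le> \<Lambda>" using leb[OF that] by simp
    finally show ?thesis .
  qed
  moreover have "cos \<rho> > 0" "tan \<rho> \<ge> 0"
    using rho rho_less by (auto intro!: cos_gt_zero_pi sin_ge_zero divide_nonneg_pos simp: tan_def)
  ultimately have qB: "\<bar>poly q z\<bar> \<le> B" if "\<bar>z\<bar> \<le> 1" for z
    unfolding B_def using rho rho_less that
    by (intro poly_growth[OF dq, of "cos \<rho>"] cos_cosh_tan_ge_1) auto
  obtain a where a: "q = (\<Sum>k\<le>n. smult (a k) (chebT k))"
    "degree (\<Sum>k\<le>n. smult (a k) (chebW \<rho> k)) \<le> n"
    "\<And>i. i \<le> n \<Longrightarrow> avg i (poly (\<Sum>k\<le>n. smult (a k) (chebW \<rho> k))) = poly q (x i)"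
    using averaging_surjective[OF dq] by blast
  define p where "p = (\<Sum>k\<le>n. smult (a k) (chebW \<rho> k))"
  have p: "segment_interpolant (Suc n) (arc_segments (Suc n) \<rho> \<tau>) f = p"
    by (rule segment_interpolant_eqI) (use a qx in \<open>auto simp: p_def\<close>)
  have bd: "\<bar>\<Sum>k\<le>n. a k * cos (real k * t)\<bar> \<le> B" for t
    using qB[of "cos t"] by (simp add: a(1) poly_sum chebT_cos)
  interpret multiplied_cosine_poly \<beta> L a n B \<rho>
    by unfold_locales (use n bd rho mult in \<open>auto simp: mult.commute\<close>)
  \<comment> \<open>The multiplier is \<open>psi\<close> up to the factor sin \<rho> / \<rho> <= 1.
    At z = 0, where \<open>psi\<close> is not known to be t / sin t, both sides contain sin
    0.\<close>
  have inv: "averaging_inverse \<rho> z * sin (z * t) = sin \<rho> / \<rho> * (psi (\<rho> * z) * sin (z * t))"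
    if "\<bar>z\<bar> \<le> real n + 1" for z t
  proof (cases "z = 0")
    case False
    have "\<rho> * \<bar>z\<bar> \<le> \<rho> * (real n + 1)" using that rho by (intro mult_left_mono) auto
    moreover have "\<bar>\<rho> * z\<bar> = \<rho> * \<bar>z\<bar>" using rho by (simp add: abs_mult)
    moreover have "\<rho> * (real n + 1) \<le> L" using mult(2) by (simp add: mult.commute)
    ultimately have "\<bar>\<rho> * z\<bar> \<le> L" by linarith
    then have "psi (\<rho> * z) = \<rho> * z / sin (\<rho> * z)" using False rho by (intro mult(4)) auto
    then show ?thesis using rho by (simp add: averaging_inverse_def mult.commute)
  qed simp
  have rr: "0 \<le> sin \<rho> / \<rho>" "sin \<rho> / \<rho> \<le> 1"
    using rho rho_less sin_x_le_x[of \<rho>] by (auto intro!: sin_ge_zero divide_nonneg_pos)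
  have le: "\<bar>poly p z\<bar> \<le> (C0 + 2 * C1) * B" if z: "z \<in> {-1<..<1}" for z
  proof -
    define t where "t = arccos z"
    have t: "0 < t" "t < pi" "cos t = z" using z by (auto simp: t_def arccos_lt_bounded)
    have st: "sin t > 0" using t by (auto intro: sin_gt_zero)
    have "sin t * poly p (cos t) = (\<Sum>k\<le>n. a k * (sin t * poly (chebW \<rho> k) (cos t)))"
      by (simp add: p_def poly_sum sum_distrib_left mult_ac)
    also have "\<dots> = (\<Sum>k\<le>n. sin \<rho> / \<rho> * (a k * ((psi (\<rho> * (real k + 1)) * sin ((real k + 1) * t)
        - psi (\<rho> * (real k - 1)) * sin ((real k - 1) * t)) / 2)))"
    proof (rule sum.cong[OF refl])
      fix k assume "k \<in> {..n}"
      then have k: "\<bar>real k + 1\<bar> \<le> real n + 1" "\<bar>real k - 1\<bar> \<le> real n + 1" by auto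
      show "a k * (sin t * poly (chebW \<rho> k) (cos t)) = sin \<rho> / \<rho> * (a k * ((psi (\<rho> * (real k + 1)) * sin ((real k + 1) * t)
        - psi (\<rho> * (real k - 1)) * sin ((real k - 1) * t)) / 2))"
        unfolding chebW_cos inv[OF k(1)] inv[OF k(2)] by (simp only: right_diff_distrib[symmetric]) (simp add: mult_ac)
    qed
    also have "\<dots> = sin \<rho> / \<rho> * (\<Sum>k\<le>n. a k * ((psi (\<rho> * (real k + 1)) * sin ((real k + 1) * t)
        - psi (\<rho> * (real k - 1)) * sin ((real k - 1) * t)) / 2))"
      by (rule sum_distrib_left[symmetric])
    also have "\<bar>\<dots>\<bar> \<le> 1 * ((C0 + 2 * C1) * B * sin t)"
      unfolding abs_mult[of "sin \<rho> / \<rho>"]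
      by (rule mult_mono[OF _ multiplied_sine_poly_le]) (use rr t in auto)
    finally have "sin t * \<bar>poly p z\<bar> \<le> sin t * ((C0 + 2 * C1) * B)"
      using st t by (simp add: abs_mult mult_ac)
    then show ?thesis using st by simp
  qed
  \<comment> \<open>Division by sin t leaves out the end points, which are reached by
    continuity.\<close>
  have "\<bar>poly p y\<bar> \<le> (C0 + 2 * C1) * B"
  proof (rule continuous_le_on_closure[of "{-1<..<1}" "\<lambda>y. \<bar>poly p y\<bar>"])
    show "y \<in> closure {-1<..<1}" using y by (simp add: closure_greaterThanLessThan abs_le_iff)
  qed (use le in \<open>auto intro!: continuous_intros\<close>)
  then show ?thesis unfolding p B_def .
qed

end

subsection \<open>Fekete segments\<close>

context segment_family
begin

lemma module_smult: "Modules.module (smult :: real \<Rightarrow> real poly \<Rightarrow> real poly)"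
  by unfold_locales (auto simp: smult_add_right smult_add_left)

lemma poly_basis_degree:
  assumes "poly_basis (Suc n) B" "j \<le> n" shows "degree (B j) \<le> n"
proof -
  interpret Modules.module "smult :: real \<Rightarrow> real poly \<Rightarrow> real poly" by (rule module_smult)
  have "B j \<in> span (B ` {..<Suc n})" using assms(2) by (intro span_base) auto
  then show ?thesis using assms(1) by (auto simp: poly_basis_def)
qed

text \<open>\<open>poly_basis\<close> speaks of a set of polynomials; injectivity of B transports
  coefficients from indices to that set.\<close>

lemma poly_basis_independent:
  assumes "poly_basis (Suc n) B" "(\<Sum>j<Suc n. smult (v j) (B j)) = 0" "j \<le> n"
  shows "v j = 0"
proof -
  interpret Modules.module "smult :: real \<Rightarrow> real poly \<Rightarrow> real poly" by (rule module_smult)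
  have inj: "inj_on B {..<Suc n}" and ind: "\<not> dependent (B ` {..<Suc n})"
    using assms(1) by (auto simp: poly_basis_def)
  define u where "u = v \<circ> inv_into {..<Suc n} B"
  have u: "u (B i) = v i" if "i < Suc n" for i using that inj by (simp add: u_def)
  have "(\<Sum>b\<in>B ` {..<Suc n}. smult (u b) b) = (\<Sum>j<Suc n. smult (v j) (B j))"
    using inj u by (simp add: sum.reindex)
  then have "u (B j) = 0"
    using ind assms(2,3) unfolding dependent_explicit by fastforce
  then show ?thesis using u assms(3) by simp
qed

text \<open>A kernel vector of the matrix is the coefficient vector of a polynomial all of whose
  averages vanish.\<close>

lemma det_segment_vandermonde_nz:
  assumes "poly_basis (Suc n) B"
  shows "Determinant.det (segment_vandermonde B (Suc n) \<rho> \<tau>) \<noteq> 0"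
proof
  let ?V = "segment_vandermonde B (Suc n) \<rho> \<tau>"
  assume "Determinant.det ?V = 0"
  moreover have V: "?V \<in> carrier_mat (Suc n) (Suc n)" by (simp add: segment_vandermonde_def)
  ultimately obtain v where v: "v \<in> carrier_vec (Suc n)" "v \<noteq> 0\<^sub>v (Suc n)" "?V *\<^sub>v v = 0\<^sub>v (Suc n)"
    using det_0_iff_vec_prod_zero by blast
  define p where "p = (\<Sum>j<Suc n. smult (vec_index v j) (B j))"
  have "p = 0"
  proof (rule unisolvent)
    show "degree p \<le> n" unfolding p_def
      by (rule degree_sum_le) (auto intro: order.trans[OF degree_smult_le] poly_basis_degree[OF assms])
    show "avg i (poly p) = 0" if "i \<le> n" for i
    proof -
      have "avg i (poly p) = (\<Sum>j<Suc n. vec_index v j * avg i (poly (B j)))"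
        unfolding p_def by (rule average_poly_sum) simp
      also have "\<dots> = vec_index (?V *\<^sub>v v) i"
        using that v(1) by (simp add: segment_vandermonde_def scalar_prod_def mult.commute atLeast0LessThan)
      also have "\<dots> = 0" using v(3) that by simp
      finally show ?thesis .
    qed
  qed
  then have "vec_index v j = 0" if "j \<le> n" for j
    using poly_basis_independent[OF assms _ that] unfolding p_def by blast
  then have "v = 0\<^sub>v (Suc n)" using v(1) by (intro eq_vecI) auto
  then show False using v(2) by simp
qed

text \<open>
  Moving the \<open>i\<close>-th segment replaces the \<open>i\<close>-th row of the matrix by the combination of its
  rows whose coefficients are the values of the Lagrange basis, so this is Cramer's rule.
\<close>

lemma det_segment_vandermonde_move:
  assumes "poly_basis (Suc n) B" "i \<le> n" "\<rho> \<le> t" "t \<le> pi - \<rho>"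
  shows "Determinant.det (segment_vandermonde B (Suc n) \<rho> (\<tau>(i := t)))
    = poly (l i) (cos t) * Determinant.det (segment_vandermonde B (Suc n) \<rho> \<tau>)"
proof -
  let ?V = "segment_vandermonde B (Suc n) \<rho> \<tau>"
  let ?W = "segment_vandermonde B (Suc n) \<rho> (\<tau>(i := t))"
  define u where "u = vec (Suc n) (\<lambda>k. poly (l k) (cos t))"
  have V: "?V \<in> carrier_mat (Suc n) (Suc n)" "?W \<in> carrier_mat (Suc n) (Suc n)"
    by (simp_all add: segment_vandermonde_def)
  have row: "average (arc_segment \<rho> t) (poly (B j)) = (\<Sum>k\<le>n. avg k (poly (B j)) * poly (l k) (cos t))"
    if j: "j \<le> n" for j
  proof -
    obtain q where q: "degree q \<le> n"
      "\<And>t. \<rho> \<le> t \<Longrightarrow> t \<le> pi - \<rho> \<Longrightarrow> average (arc_segment \<rho> t) (poly (B j)) = poly q (cos t)"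
      using averaged_poly[OF poly_basis_degree[OF assms(1) j]] by blast
    have "poly q (cos t) = (\<Sum>k\<le>n. poly q (x k) * poly (l k) (cos t))"
      by (subst lagrange_interpolation[OF inj_x q(1)]) (simp add: poly_sum)
    then show ?thesis using q(2) assms(3,4) tau by simp
  qed
  \<comment> \<open>Cramer's rule is used in its column form, hence the transposes.\<close>
  have "transpose_mat ?W = replace_col (transpose_mat ?V) (transpose_mat ?V *\<^sub>v u) i"
  proof (rule eq_matI)
    fix j k assume "j < dim_row (replace_col (transpose_mat ?V) (transpose_mat ?V *\<^sub>v u) i)"
      "k < dim_col (replace_col (transpose_mat ?V) (transpose_mat ?V *\<^sub>v u) i)"
    then have jk: "j < Suc n" "k < Suc n" by (auto simp: replace_col_def segment_vandermonde_def)
    then show "transpose_mat ?W $$ (j, k) = replace_col (transpose_mat ?V) (transpose_mat ?V *\<^sub>v u) i $$ (j, k)"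
      using row[of j]
      by (auto simp: replace_col_def segment_vandermonde_def u_def scalar_prod_def
          atLeast0LessThan lessThan_Suc_atMost)
  qed (simp_all add: replace_col_def segment_vandermonde_def)
  then have "Determinant.det (transpose_mat ?W) = vec_index u i * Determinant.det (transpose_mat ?V)"
    using cramer_lemma_mat[of "transpose_mat ?V" "Suc n" u i] V assms(2) by (simp add: u_def)
  then show ?thesis
    using V assms(2) by (simp add: det_transpose u_def)
qed

end

section \<open>Consequences of the maximality of the determinant\<close>

locale fekete_family = segment_family +
  fixes B :: "nat \<Rightarrow> real poly"
  assumes basis: "poly_basis (Suc n) B" and fekete: "fekete_angles B (Suc n) \<rho> \<tau>"
begin

text \<open>The new determinant is the old one times the value of the basis polynomial, and the old
  one is nonzero and maximal. Admissibility of the moved tuple means that t passes no other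
  angle.\<close>

lemma lagrange_le_1_move:
  assumes "i \<le> n" "arc_angles (Suc n) \<rho> (\<tau>(i := t))"
  shows "\<bar>poly (l i) (cos t)\<bar> \<le> 1"
proof -
  have t: "\<rho> \<le> t" "t \<le> pi - \<rho>"
    using assms unfolding arc_angles_def by (auto dest!: spec[of _ i])
  let ?d = "\<bar>Determinant.det (segment_vandermonde B (Suc n) \<rho> \<tau>)\<bar>"
  have "\<bar>poly (l i) (cos t)\<bar> * ?d \<le> 1 * ?d"
    using fekete assms(2) unfolding fekete_angles_def
    by (auto simp: abs_mult det_segment_vandermonde_move[OF basis assms(1) t] dest!: spec[of _ "\<tau>(i := t)"])
  then show ?thesis using det_segment_vandermonde_nz[OF basis] by simp
qed

text \<open>Moving the first segment to the boundary keeps the order, and if it were not there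
  already, every factor of its basis polynomial would exceed 1 at the new midpoint.\<close>

lemma first_angle: "\<tau> 0 = \<rho>"
proof (rule ccontr)
  assume "\<tau> 0 \<noteq> \<rho>"
  then have less: "\<rho> < \<tau> 0" using tau[of 0] by simp
  have "arc_angles (Suc n) \<rho> (\<tau>(0 := \<rho>))"
    unfolding arc_angles_def strict_mono_on_def
  proof (intro conjI allI impI)
    fix i j assume ij: "i \<in> {..<Suc n} \<and> j \<in> {..<Suc n} \<and> i < j"
    then have "\<tau> 0 < \<tau> j" using tau_less[of 0 j] by auto
    then show "(\<tau>(0 := \<rho>)) i < (\<tau>(0 := \<rho>)) j"
      using ij less tau_less[of i j] by auto
  qed (use tau rho rho_less in \<open>auto simp: less_Suc_eq_le\<close>)
  then have "\<bar>poly (l 0) (cos \<rho>)\<bar> \<le> 1" by (intro lagrange_le_1_move) auto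
  moreover have "1 < (\<Prod>j\<in>{..n} - {0}. (cos \<rho> - x j) / (x 0 - x j))"
  proof (rule less_1_prod)
    show "{..n} - {0} \<noteq> {}" using n by auto
    fix j assume "j \<in> {..n} - {0}"
    then have "x j < x 0" using x_less[of 0 j] by auto
    moreover have "x 0 < cos \<rho>" using less tau[of 0] rho by (intro cos_monotone_0_pi) auto
    ultimately show "1 < (cos \<rho> - x j) / (x 0 - x j)" by simp
  qed simp
  ultimately show False by (simp add: poly_lagrange_basis)
qed

lemma last_angle: "\<tau> n = pi - \<rho>"
proof (rule ccontr)
  assume "\<tau> n \<noteq> pi - \<rho>"
  then have less: "\<tau> n < pi - \<rho>" using tau[of n] by simp
  have "arc_angles (Suc n) \<rho> (\<tau>(n := pi - \<rho>))"
    unfolding arc_angles_def strict_mono_on_def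
  proof (intro conjI allI impI)
    fix i j assume ij: "i \<in> {..<Suc n} \<and> j \<in> {..<Suc n} \<and> i < j"
    then have "\<tau> i < \<tau> n" using tau_less[of i n] by auto
    then show "(\<tau>(n := pi - \<rho>)) i < (\<tau>(n := pi - \<rho>)) j"
      using ij less tau_less[of i j] by auto
  qed (use tau rho rho_less in \<open>auto simp: less_Suc_eq_le\<close>)
  then have "\<bar>poly (l n) (cos (pi - \<rho>))\<bar> \<le> 1" by (intro lagrange_le_1_move) auto
  moreover have "1 < (\<Prod>j\<in>{..n} - {n}. (cos (pi - \<rho>) - x j) / (x n - x j))"
  proof (rule less_1_prod)
    show "{..n} - {n} \<noteq> {}" using n by auto
    fix j assume "j \<in> {..n} - {n}"
    then have "x n < x j" using x_less[of j n] by auto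
    moreover have "cos (pi - \<rho>) < x n" using less tau[of n] rho by (intro cos_monotone_0_pi) auto
    ultimately show "1 < (cos (pi - \<rho>) - x j) / (x n - x j)" by (simp add: neg_less_divide_eq)
  qed simp
  ultimately show False unfolding poly_lagrange_basis by linarith
qed

text \<open>Moves shorter than the gap to either neighbour are admissible, so the basis polynomial
  has a local maximum with value 1 in the angle. As the sine is positive there, its derivative in x
  vanishes too.\<close>

lemma stationary_angle:
  assumes "0 < i" "i < n" shows "poly (pderiv (l i)) (x i) = 0"
proof -
  define d where "d = min (\<tau> i - \<tau> (i - 1)) (\<tau> (i + 1) - \<tau> i)"
  have d: "d > 0" using tau_less[of "i - 1" i] tau_less[of i "i + 1"] assms by (simp add: d_def)
  have "((\<lambda>t. poly (l i) (cos t)) has_real_derivative poly (pderiv (l i)) (x i) * - sin (\<tau> i)) (at (\<tau> i))"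
    by (rule DERIV_chain2[OF poly_DERIV DERIV_cos])
  moreover have "poly (l i) (cos t) \<le> poly (l i) (x i)" if t: "\<bar>\<tau> i - t\<bar> < d" for t
  proof -
    have b: "\<tau> (i - 1) < t" "t < \<tau> (i + 1)" using t by (auto simp: d_def)
    have lo: "\<tau> j < t" if "j < i" for j
    proof (cases "j = i - 1")
      case False
      then have "j < i - 1" using that by linarith
      then have "\<tau> j < \<tau> (i - 1)" using assms by (intro tau_less) auto
      then show ?thesis using b by linarith
    qed (use b in simp)
    have hi: "t < \<tau> j" if "i < j" "j \<le> n" for j
    proof (cases "j = i + 1")
      case False
      then have "\<tau> (i + 1) < \<tau> j" using that by (intro tau_less) auto
      then show ?thesis using b by linarith
    qed (use b in simp)
    have "arc_angles (Suc n) \<rho> (\<tau>(i := t))"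
      unfolding arc_angles_def strict_mono_on_def
    proof (intro conjI allI impI)
      fix j k assume "j \<in> {..<Suc n} \<and> k \<in> {..<Suc n} \<and> j < k"
      then show "(\<tau>(i := t)) j < (\<tau>(i := t)) k" using lo[of j] hi[of k] tau_less[of j k] by auto
    next
      fix j assume j: "j < Suc n"
      have im: "i - 1 \<le> n" "i + 1 \<le> n" using assms by auto
      show "\<rho> \<le> (\<tau>(i := t)) j" "(\<tau>(i := t)) j \<le> pi - \<rho>"
        using j tau[of j] tau[OF im(1)] tau[OF im(2)] b by auto
    qed
    then have "\<bar>poly (l i) (cos t)\<bar> \<le> 1" using assms by (intro lagrange_le_1_move) auto
    then show ?thesis using lagrange_basis_node[OF inj_x, of i i] assms by simp
  qed
  ultimately have "poly (pderiv (l i)) (x i) * - sin (\<tau> i) = 0"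
    by (intro DERIV_local_max[OF _ d]) auto
  moreover have "sin (\<tau> i) > 0" using tau[of i] assms rho by (intro sin_gt_zero) auto
  ultimately show ?thesis by simp
qed

lemma cos_rho_pos: "cos \<rho> > 0"
  using rho rho_less by (intro cos_gt_zero_pi) auto

text \<open>Angles after stretching [-cos \<rho>, cos \<rho>] to [-1, 1]; the outermost ones become
  0 and pi.\<close>

definition "th i = arccos (x i / cos \<rho>)"

lemma x_scaled: "i \<le> n \<Longrightarrow> \<bar>x i / cos \<rho>\<bar> \<le> 1"
proof -
  assume i: "i \<le> n"
  have "x i \<le> cos \<rho>" using tau[OF i] rho by (intro cos_monotone_0_pi_le) auto
  moreover have "cos (pi - \<rho>) \<le> x i" using tau[OF i] rho by (intro cos_monotone_0_pi_le) auto
  ultimately show ?thesis using cos_rho_pos by (simp add: abs_le_iff field_simps)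
qed

lemma cos_th: "i \<le> n \<Longrightarrow> cos (th i) = x i / cos \<rho>"
  using x_scaled[of i] unfolding th_def by (intro cos_arccos_abs)

lemma lagrange_scaled:
  assumes "i \<le> n"
  shows "lagrange_basis n (\<lambda>j. cos (th j)) i = pcompose (l i) [:0, cos \<rho>:]"
proof (rule poly_eq_poly_eq_iff[THEN iffD1], rule ext)
  fix y
  have "poly (lagrange_basis n (\<lambda>j. cos (th j)) i) y = (\<Prod>j\<in>{..n} - {i}. (y - x j / cos \<rho>) / (x i / cos \<rho> - x j / cos \<rho>))"
    unfolding poly_lagrange_basis by (intro prod.cong) (use assms in \<open>auto simp: cos_th\<close>)
  also have "\<dots> = (\<Prod>j\<in>{..n} - {i}. (cos \<rho> * y - x j) / (x i - x j))"
  proof (rule prod.cong[OF refl])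
    fix j
    have "y - x j / cos \<rho> = (cos \<rho> * y - x j) / cos \<rho>" "x i / cos \<rho> - x j / cos \<rho> = (x i - x j) / cos \<rho>"
      using cos_rho_pos by (simp_all add: field_simps)
    then show "(y - x j / cos \<rho>) / (x i / cos \<rho> - x j / cos \<rho>) = (cos \<rho> * y - x j) / (x i - x j)"
      using cos_rho_pos by simp
  qed
  also have "\<dots> = poly (pcompose (l i) [:0, cos \<rho>:]) y"
    by (simp add: poly_pcompose poly_lagrange_basis mult.commute)
  finally show "poly (lagrange_basis n (\<lambda>j. cos (th j)) i) y = poly (pcompose (l i) [:0, cos \<rho>:]) y" .
qed

sublocale scaled: lobatto_nodes n th
proof
  show "0 < n" by (rule n)
  show "th 0 = 0" using cos_rho_pos by (simp add: th_def first_angle)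
  show "th n = pi" using cos_rho_pos by (simp add: th_def last_angle)
  show "strict_mono_on {..n} th"
  proof (rule strict_mono_onI)
    fix i j assume "i \<in> {..n}" "j \<in> {..n}" "i < j"
    then show "th i < th j"
      using x_less[of i j] x_scaled[of i] x_scaled[of j] cos_rho_pos unfolding th_def
      by (intro arccos_less_mono[THEN iffD2]) (auto simp: divide_strict_right_mono)
  qed
  show "poly (pderiv (lagrange_basis n (\<lambda>j. cos (th j)) i)) (cos (th i)) = 0" if "0 < i" "i < n" for i
    using stationary_angle[OF that] that cos_rho_pos
    by (simp add: lagrange_scaled cos_th pderiv_pcompose poly_pcompose pderiv_pCons)
qed

lemma fekete_lebesgue_constant:
  assumes "\<bar>y\<bar> \<le> cos \<rho>" shows "(\<Sum>i\<le>n. \<bar>poly (l i) y\<bar>) \<le> 2 * (1 + 72 * harm n)"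
proof -
  have "\<bar>y / cos \<rho>\<bar> \<le> 1" using assms cos_rho_pos by simp
  from scaled.lobatto_lebesgue_constant[OF this] show ?thesis
    using cos_rho_pos by (simp add: lagrange_scaled poly_pcompose)
qed

end

subsection \<open>The lower bound\<close>

lemma has_integral_cos_int:
  "((\<lambda>s. cos (of_int j * s)) has_integral (if j = 0 then pi else 0)) {0..pi}"
proof (cases "j = 0")
  case True
  then show ?thesis using has_integral_const_real[of "1::real" 0 pi] by simp
next
  case False
  have "((\<lambda>s. cos (of_int j * s)) has_integral (sin (of_int j * pi) / of_int j - sin (of_int j * 0) / of_int j)) {0..pi}"
  proof (rule fundamental_theorem_of_calculus)
    fix s
    have "((\<lambda>s. sin (of_int j * s) / of_int j) has_real_derivative cos (of_int j * s)) (at s)"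
      using False by (auto intro!: derivative_eq_intros)
    then show "((\<lambda>s. sin (of_int j * s) / of_int j) has_vector_derivative cos (of_int j * s)) (at s within {0..pi})"
      by (simp add: has_real_derivative_iff_has_vector_derivative has_vector_derivative_at_within)
  qed simp
  moreover have "sin (of_int j * pi) = 0" unfolding sin_zero_iff_int2 by blast
  ultimately show ?thesis using False by simp
qed

text \<open>Squared L2 norms of the cosines on [0, pi].\<close>

definition cos_weight :: "nat \<Rightarrow> real" where
  "cos_weight k = (if k = 0 then pi else pi / 2)"

lemma has_integral_cos_cos:
  "((\<lambda>s. cos (real m * s) * cos (real k * s)) has_integral (if m = k then cos_weight k else 0)) {0..pi}"
proof -
  have "((\<lambda>s. (cos (of_int (int m - int k) * s) + cos (of_int (int m + int k) * s)) / 2) has_integral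
      ((if int m - int k = 0 then pi else 0) + (if int m + int k = 0 then pi else 0)) / 2) {0..pi}"
    by (intro has_integral_divide has_integral_add has_integral_cos_int)
  moreover have "(cos (of_int (int m - int k) * s) + cos (of_int (int m + int k) * s)) / 2 = cos (real m * s) * cos (real k * s)" for s
    by (simp add: cos_times_cos left_diff_distrib distrib_right)
  moreover have "((if int m - int k = 0 then pi else 0) + (if int m + int k = 0 then pi else 0)) / 2
      = (if m = k then cos_weight k else 0)"
    by (auto simp: cos_weight_def)
  ultimately show ?thesis by simp
qed

lemma has_integral_cosine_sum:
  "((\<lambda>s. (\<Sum>m\<le>d. a m * cos (real m * s)) * cos (real k * s)) has_integral
     (if k \<le> d then a k * cos_weight k else 0)) {0..pi}"
proof -
  have "((\<lambda>s. \<Sum>m\<le>d. a m * (cos (real m * s) * cos (real k * s))) has_integral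
     (\<Sum>m\<le>d. a m * (if m = k then cos_weight k else 0))) {0..pi}"
    by (intro has_integral_sum has_integral_mult_right has_integral_cos_cos) simp
  moreover have "(\<Sum>m\<le>d. a m * (if m = k then cos_weight k else 0)) = (if k \<le> d then a k * cos_weight k else 0)"
    by (simp add: mult_delta_right)
  ultimately show ?thesis by (simp add: sum_distrib_right mult.assoc)
qed

lemma abs_le_sup_norm:
  assumes "continuous_on {-1..1} f" "y \<in> {-1..1}" shows "\<bar>f y\<bar> \<le> sup_norm f"
proof -
  have "compact ((\<lambda>x. \<bar>f x\<bar>) ` {-1..1})"
    using assms(1) by (intro compact_continuous_image continuous_intros) auto
  then have "bdd_above ((\<lambda>x. \<bar>f x\<bar>) ` {-1..1})"
    by (intro bounded_imp_bdd_above compact_imp_bounded)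
  then show ?thesis unfolding sup_norm_def using assms(2) by (intro cSUP_upper)
qed

lemma sup_norm_le:
  assumes "\<And>y. \<bar>y\<bar> \<le> 1 \<Longrightarrow> \<bar>f y\<bar> \<le> b" shows "sup_norm f \<le> b"
  unfolding sup_norm_def by (rule cSUP_least) (use assms in auto)

text \<open>Frequency 0 enters with coefficient 1, so this is half of the Dirichlet kernel plus 1.
  The factor 1/2 and the -1 of the lower bound originate here.\<close>

definition cosine_kernel :: "nat \<Rightarrow> real \<Rightarrow> real" where
  "cosine_kernel n t = (\<Sum>k\<le>n. cos (real k * t))"

lemma continuous_cosine_kernel: "continuous_on S (cosine_kernel n)"
  unfolding cosine_kernel_def[abs_def] by (intro continuous_intros)

context segment_family
begin

lemma interpolant_exists:
  obtains p where "degree p \<le> n" "\<And>i. i \<le> n \<Longrightarrow> avg i (poly p) = b i"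
proof -
  define q where "q = (\<Sum>i\<le>n. smult (b i) (l i))"
  have "degree q \<le> n" unfolding q_def
    by (rule degree_sum_le) (auto intro: order.trans[OF degree_smult_le] degree_lagrange_basis)
  moreover have "poly q (x i) = b i" if "i \<le> n" for i
    using that by (simp add: q_def poly_sum lagrange_basis_node[OF inj_x] mult_delta_right)
  ultimately show ?thesis using averaging_surjective[of q] that by metis
qed

text \<open>
  Berman's averaging argument: if \<open>F = (\<Sum>m. A m * chebT m)\<close>, the symmetrised translate of \<open>F\<close>
  by \<open>s\<close> is \<open>(\<Sum>m. A m * cos (m s) * chebT m)\<close>. Evaluating its interpolant at \<open>cos s\<close> and
  integrating over \<open>s\<close> retains only the terms with \<open>m \<le> n\<close>.
\<close>

lemma interpolation_norm_ge_pairing: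
  assumes b: "\<And>f. continuous_on {-1..1} f \<Longrightarrow> sup_norm f \<le> 1 \<Longrightarrow>
      sup_norm (poly (segment_interpolant (Suc n) (arc_segments (Suc n) \<rho> \<tau>) f)) \<le> b"
    and F: "\<And>y. \<bar>y\<bar> \<le> 1 \<Longrightarrow> \<bar>poly F y\<bar> \<le> 1"
  shows "integral {0..pi} (\<lambda>t. poly F (cos t) * cosine_kernel n t) \<le> pi * b"
proof -
  define D where "D = max (degree F) n"
  obtain A where A: "F = (\<Sum>m\<le>D. smult (A m) (chebT m))"
    using cheb_expansion[of F D] by (auto simp: D_def)
  have nD: "n \<le> D" by (simp add: D_def)
  define P where "P m = (SOME p. degree p \<le> n \<and> (\<forall>i\<le>n. avg i (poly p) = avg i (poly (chebT m))))" for m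
  have P: "degree (P m) \<le> n" "i \<le> n \<Longrightarrow> avg i (poly (P m)) = avg i (poly (chebT m))" for m i
  proof -
    have "\<exists>p. degree p \<le> n \<and> (\<forall>i\<le>n. avg i (poly p) = avg i (poly (chebT m)))"
      using interpolant_exists[of "\<lambda>i. avg i (poly (chebT m))"] by metis
    from someI_ex[OF this] show "degree (P m) \<le> n"
      "i \<le> n \<Longrightarrow> avg i (poly (P m)) = avg i (poly (chebT m))" by (auto simp: P_def)
  qed
  have Pm: "P m = chebT m" if "m \<le> n" for m
  proof -
    have "P m - chebT m = 0"
      by (rule unisolvent) (use P that in \<open>auto intro!: degree_diff_le simp: degree_chebT average_poly_diff\<close>)
    then show ?thesis by simp
  qed
  define g where "g s = (\<Sum>m\<le>D. A m * (cos (real m * s) * poly (P m) (cos s)))" for s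
  have g_le: "g s \<le> b" for s
  proof -
    define Fs where "Fs = (\<Sum>m\<le>D. smult (A m * cos (real m * s)) (chebT m))"
    have Fs: "poly Fs (cos t) = (poly F (cos (t + s)) + poly F (cos (t - s))) / 2" for t
    proof -
      have "A m * cos (real m * s) * cos (real m * t)
          = (A m * cos (real m * (t + s)) + A m * cos (real m * (t - s))) / 2" for m
        by (simp add: distrib_left right_diff_distrib cos_add cos_diff)
      then show ?thesis
        unfolding Fs_def A poly_sum poly_smult chebT_cos
        by (simp only: sum_divide_distrib[symmetric] sum.distrib)
    qed
    have Fs1: "\<bar>poly Fs y\<bar> \<le> 1" if "\<bar>y\<bar> \<le> 1" for y
    proof -
      have "y = cos (arccos y)" using that by (simp add: cos_arccos_abs)
      then have "poly Fs y = (poly F (cos (arccos y + s)) + poly F (cos (arccos y - s))) / 2"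
        using Fs[of "arccos y"] by simp
      then show ?thesis
        using F[of "cos (arccos y + s)"] F[of "cos (arccos y - s)"] by (auto simp: abs_le_iff)
    qed
    define G where "G = (\<Sum>m\<le>D. smult (A m * cos (real m * s)) (P m))"
    have "segment_interpolant (Suc n) (arc_segments (Suc n) \<rho> \<tau>) (poly Fs) = G"
    proof (rule segment_interpolant_eqI)
      show "degree G \<le> n" unfolding G_def
        by (rule degree_sum_le) (auto intro: order.trans[OF degree_smult_le] P)
      show "avg i (poly G) = avg i (poly Fs)" if "i \<le> n" for i
        unfolding G_def Fs_def average_poly_sum[OF finite_atMost] using P(2)[OF that] by simp
    qed
    moreover have "sup_norm (poly (segment_interpolant (Suc n) (arc_segments (Suc n) \<rho> \<tau>) (poly Fs))) \<le> b"
      by (intro b sup_norm_le Fs1 continuous_intros)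
    ultimately have "sup_norm (poly G) \<le> b" by simp
    moreover have "\<bar>poly G (cos s)\<bar> \<le> sup_norm (poly G)"
      by (rule abs_le_sup_norm) (auto intro!: continuous_intros)
    moreover have "poly G (cos s) = g s"
      by (simp add: G_def g_def poly_sum mult.assoc)
    ultimately show ?thesis by linarith
  qed
  \<comment> \<open>For m <= n interpolation reproduces \<open>chebT m\<close>, whose m-th
    coefficient is 1. For m > n the polynomial \<open>P m\<close> has degree at most n, hence no
    m-th cosine coefficient.\<close>
  have w: "((\<lambda>s. cos (real m * s) * poly (P m) (cos s)) has_integral (if m \<le> n then cos_weight m else 0)) {0..pi}" for m
  proof -
    obtain a where a: "P m = (\<Sum>k\<le>n. smult (a k) (chebT k))"
      using cheb_expansion[OF P(1)] .
    have "((\<lambda>s. poly (P m) (cos s) * cos (real m * s)) has_integral (if m \<le> n then a m * cos_weight m else 0)) {0..pi}"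
      using has_integral_cosine_sum[where d = n and a = a and k = m] by (simp add: a poly_sum chebT_cos)
    moreover have "a m = 1" if "m \<le> n"
    proof -
      have "(\<Sum>k\<le>n. smult (a k - (if k = m then 1 else 0)) (chebT k)) = P m - (\<Sum>k\<le>n. smult (if k = m then 1 else 0) (chebT k))"
        by (simp add: a smult_diff_left sum_subtractf)
      also have "(\<Sum>k\<le>n. smult (if k = m then 1 else 0) (chebT k)) = (\<Sum>k\<le>n. if k = m then chebT k else 0)"
        by (rule sum.cong) auto
      also have "\<dots> = chebT m" using that by simp
      finally have "(\<Sum>k\<le>n. smult (a k - (if k = m then 1 else 0)) (chebT k)) = 0"
        using Pm[OF that] by simp
      from poly_expansion_zero[OF degree_chebT _ this that] show ?thesis by simp
    qed
    ultimately show ?thesis by (cases "m \<le> n") (simp_all add: mult.commute)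
  qed
  have "(g has_integral (\<Sum>m\<le>D. A m * (if m \<le> n then cos_weight m else 0))) {0..pi}"
    unfolding g_def[abs_def] by (intro has_integral_sum has_integral_mult_right w) simp
  moreover have "((\<lambda>s. b) has_integral pi * b) {0..pi}"
    using has_integral_const_real[of b 0 pi] by simp
  ultimately have "(\<Sum>m\<le>D. A m * (if m \<le> n then cos_weight m else 0)) \<le> pi * b"
    by (rule has_integral_le) (rule g_le)
  moreover have "(\<Sum>m\<le>D. A m * (if m \<le> n then cos_weight m else 0)) = (\<Sum>m\<le>n. A m * cos_weight m)"
  proof -
    have "(\<Sum>m\<le>D. A m * (if m \<le> n then cos_weight m else 0)) = (\<Sum>m\<le>n. A m * (if m \<le> n then cos_weight m else 0))"
      using nD by (intro sum.mono_neutral_right) auto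
    also have "\<dots> = (\<Sum>m\<le>n. A m * cos_weight m)" by (rule sum.cong) auto
    finally show ?thesis .
  qed
  moreover have "((\<lambda>t. poly F (cos t) * cosine_kernel n t) has_integral (\<Sum>k\<le>n. A k * cos_weight k)) {0..pi}"
  proof -
    have "((\<lambda>t. \<Sum>k\<le>n. (\<Sum>m\<le>D. A m * cos (real m * t)) * cos (real k * t)) has_integral
        (\<Sum>k\<le>n. if k \<le> D then A k * cos_weight k else 0)) {0..pi}"
      by (intro has_integral_sum has_integral_cosine_sum) simp
    moreover have "(\<Sum>k\<le>n. if k \<le> D then A k * cos_weight k else 0) = (\<Sum>k\<le>n. A k * cos_weight k)"
      using nD by (intro sum.cong) auto
    ultimately show ?thesis
      by (simp add: A poly_sum chebT_cos cosine_kernel_def sum_distrib_left)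
  qed
  ultimately show ?thesis by (simp add: integral_unique)
qed

text \<open>Duality: the ideal test function is the sign of the kernel. It is replaced by a
  continuous function and then, by Weierstrass, by a polynomial, as the pairing inequality
  requires.\<close>

lemma interpolation_norm_ge_kernel:
  assumes b: "\<And>f. continuous_on {-1..1} f \<Longrightarrow> sup_norm f \<le> 1 \<Longrightarrow>
      sup_norm (poly (segment_interpolant (Suc n) (arc_segments (Suc n) \<rho> \<tau>) f)) \<le> b"
  shows "integral {0..pi} (\<lambda>t. \<bar>cosine_kernel n t\<bar>) \<le> pi * b"
proof -
  define J where "J = integral {0..pi} (\<lambda>t. \<bar>cosine_kernel n t\<bar>)"
  define \<kappa> where "\<kappa> = (\<Sum>k\<le>n. chebT k)"
  have \<kappa>: "poly \<kappa> (cos t) = cosine_kernel n t" for t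
    by (simp add: \<kappa>_def cosine_kernel_def poly_sum chebT_cos)
  have Kle: "\<bar>cosine_kernel n t\<bar> \<le> real n + 1" for t
  proof -
    have "\<bar>cosine_kernel n t\<bar> \<le> (\<Sum>k\<le>n. \<bar>cos (real k * t)\<bar>)"
      unfolding cosine_kernel_def by (rule sum_abs)
    also have "\<dots> \<le> (\<Sum>k\<le>n. 1)" by (rule sum_mono) simp
    finally show ?thesis by simp
  qed
  have int: "continuous_on {0..pi} f \<Longrightarrow> f integrable_on {0..pi}" for f :: "real \<Rightarrow> real"
    by (rule integrable_continuous_real)
  have approx: "J \<le> pi * b + e * (pi * (\<bar>b\<bar> + real n + 2))" if e: "e > 0" for e
  proof -
    \<comment> \<open>A continuous substitute for the sign of \<kappa>: it is bounded by 1, and h *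
      \<kappa> >= |\<kappa>| - e.\<close>
    define h where "h y = poly \<kappa> y / (\<bar>poly \<kappa> y\<bar> + e)" for y
    have "continuous_on {-1..1} h"
      unfolding h_def using e by (intro continuous_intros) (auto intro: add_nonneg_pos simp: add_nonneg_eq_0_iff)
    then obtain p0 where p0: "real_polynomial_function p0" "\<And>y. y \<in> {-1..1} \<Longrightarrow> \<bar>h y - p0 y\<bar> < e"
      using Stone_Weierstrass_real_polynomial_function[of "{-1..1}" h e] e by auto
    then obtain c N where "p0 = (\<lambda>y. \<Sum>i\<le>N. c i * y ^ i)"
      using real_polynomial_function_iff_sum by auto
    then have "p0 = poly (\<Sum>i\<le>N. Polynomial.monom (c i) i)"
      by (simp add: fun_eq_iff poly_sum poly_monom)
    then obtain p where p: "\<And>y. y \<in> {-1..1} \<Longrightarrow> \<bar>h y - poly p y\<bar> < e"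
      using p0(2) by blast
    have h1: "\<bar>h y\<bar> \<le> 1" for y
      using e by (simp add: h_def)
    define F where "F = smult (1 / (1 + e)) p"
    have F: "\<bar>poly F y\<bar> \<le> 1" if "\<bar>y\<bar> \<le> 1" for y
    proof -
      have "\<bar>poly p y\<bar> \<le> 1 + e" using p[of y] h1[of y] that by (auto simp: abs_le_iff)
      then show ?thesis using e by (simp add: F_def)
    qed
    have pF: "poly p (cos t) = (1 + e) * poly F (cos t)" for t using e by (simp add: F_def)
    define I where "I = integral {0..pi} (\<lambda>t. poly p (cos t) * cosine_kernel n t)"
    have "(1 + e) * integral {0..pi} (\<lambda>t. poly F (cos t) * cosine_kernel n t) \<le> (1 + e) * (pi * b)"
      using interpolation_norm_ge_pairing[OF b F] e by (intro mult_left_mono) auto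
    moreover have "(1 + e) * integral {0..pi} (\<lambda>t. poly F (cos t) * cosine_kernel n t)
        = I"
      by (simp add: I_def pF mult.assoc flip: integral_mult_right)
    ultimately have I_le: "I \<le> (1 + e) * (pi * b)" by simp
    \<comment> \<open>Replacing the sign by \<open>h\<close> costs e, and replacing \<open>h\<close>
      by p costs e * (n + 1).\<close>
    have "integral {0..pi} (\<lambda>t. \<bar>cosine_kernel n t\<bar> - e * (real n + 2))
        \<le> I"
      unfolding I_def
    proof (rule integral_le)
      fix t
      define y where "y = cosine_kernel n t"
      have hy: "h (cos t) * y \<ge> \<bar>y\<bar> - e"
      proof -
        have "\<bar>y\<bar> * \<bar>y\<bar> - e * e \<le> y * y" using e by simp
        then have "(\<bar>y\<bar> - e) * (\<bar>y\<bar> + e) \<le> y * y" by (simp add: algebra_simps)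
        then show ?thesis using e by (simp add: h_def \<kappa> y_def[symmetric] pos_le_divide_eq add_nonneg_pos)
      qed
      have "\<bar>(h (cos t) - poly p (cos t)) * y\<bar> \<le> e * (real n + 1)"
        unfolding abs_mult using p[of "cos t"] Kle[of t] e by (intro mult_mono) (auto simp: y_def)
      then have "(h (cos t) - poly p (cos t)) * y \<le> e * (real n + 1)" by linarith
      then show "\<bar>cosine_kernel n t\<bar> - e * (real n + 2) \<le> poly p (cos t) * cosine_kernel n t"
        using hy unfolding y_def[symmetric] by (simp add: algebra_simps)
    qed (intro int continuous_intros continuous_cosine_kernel)+
    moreover have "integral {0..pi} (\<lambda>t. \<bar>cosine_kernel n t\<bar> - e * (real n + 2)) = J - pi * (e * (real n + 2))"
    proof -
      have "integral {0..pi} (\<lambda>t. e * (real n + 2)) = pi * (e * (real n + 2))" by simp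
      then show ?thesis unfolding J_def
        by (subst integral_diff) (auto intro!: int continuous_intros continuous_cosine_kernel)
    qed
    ultimately have "J \<le> (1 + e) * (pi * b) + pi * (e * (real n + 2))"
      using I_le by simp
    also have "\<dots> = pi * b + (e * (pi * b) + pi * (e * (real n + 2)))" by (simp add: algebra_simps)
    also have "\<dots> \<le> pi * b + (e * (pi * \<bar>b\<bar>) + pi * (e * (real n + 2)))"
      using e by (intro add_mono mult_left_mono) auto
    also have "\<dots> = pi * b + e * (pi * (\<bar>b\<bar> + real n + 2))" by (simp add: algebra_simps)
    finally show ?thesis .
  qed
  have "J \<le> pi * b + d" if "d > 0" for d
  proof -
    define M where "M = pi * (\<bar>b\<bar> + real n + 2)"
    have "M > 0" unfolding M_def by (intro mult_pos_pos) auto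
    then show ?thesis using approx[of "d / M"] that unfolding M_def[symmetric] by simp
  qed
  then have "J \<le> pi * b" by (rule field_le_epsilon)
  then show ?thesis by (simp add: J_def)
qed

end

section \<open>The L1 norm of the Dirichlet kernel\<close>

lemma dirichlet_kernel:
  "sin (t / 2) * (2 * cosine_kernel n t - 1) = sin ((real n + 1 / 2) * t)"
proof (induction n)
  case (Suc n)
  have s: "2 * (sin (t/2) * cos (real (Suc n) * t)) = sin ((real n + 1 + 1/2) * t) - sin ((real n + 1 / 2) * t)"
  proof -
    have "(real n + 1 + 1/2) * t = real (Suc n) * t + t / 2" "(real n + 1/2) * t = real (Suc n) * t - t / 2"
      by (simp_all add: field_simps)
    then show ?thesis by (simp only: sin_add sin_diff) simp
  qed
  have "sin (t / 2) * (2 * cosine_kernel (Suc n) t - 1)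
      = sin (t / 2) * (2 * cosine_kernel n t - 1) + 2 * (sin (t/2) * cos (real (Suc n) * t))"
    by (simp add: cosine_kernel_def algebra_simps)
  also have "\<dots> = sin ((real n + 1 + 1/2) * t)" unfolding Suc s by simp
  finally show ?case by (simp add: add.commute)
qed (simp add: cosine_kernel_def)

text \<open>
  The interval of integration contains \<open>n\<close> half periods of \<open>sin ((n + 1/2) t)\<close>, and on the
  \<open>k\<close>-th of them the Dirichlet kernel dominates a multiple of order \<open>1 / k\<close> of this function.
\<close>

lemma dirichlet_lower_bound:
  "4 / pi * harm n \<le> integral {0..pi} (\<lambda>t. \<bar>2 * cosine_kernel n t - 1\<bar>)"
proof -
  define a where "a = real n + 1 / 2"
  have a: "a > 0" by (simp add: a_def)
  define D where "D t = \<bar>2 * cosine_kernel n t - 1\<bar>" for t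
  have contD: "continuous_on S D" for S
    unfolding D_def by (intro continuous_intros continuous_cosine_kernel)
  then have intD: "D integrable_on {u..v}" for u v by (intro integrable_continuous_real)
  have "4 / pi * harm k \<le> integral {0..real k * pi / a} D" if "k \<le> n" for k
    using that
  proof (induction k)
    case (Suc k)
    define u v where "u = real k * pi / a" and "v = real (Suc k) * pi / a"
    have uv: "0 \<le> u" "u \<le> v" using a by (auto simp: u_def v_def divide_right_mono)
    \<comment> \<open>On this half period sin (t / 2) <= v / 2, and c * v = 2 is just what places c
      * |sin (a t)| below \<open>D\<close>.\<close>
    define c where "c = 2 * a / (real (Suc k) * pi)"
    have c: "c > 0" "c * v = 2" using a by (auto simp: c_def v_def simp del: of_nat_Suc)
    \<comment> \<open>The sign (-1)^k is that of the sine between \<open>u\<close> and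
      \<open>v\<close>, so the integral counts a full half wave, 2 c / a.\<close>
    have "((\<lambda>t. c * ((-1) ^ k * sin (a * t))) has_integral
        (c * ((-1) ^ k * (- cos (a * v) / a)) - c * ((-1) ^ k * (- cos (a * u) / a)))) {u..v}"
    proof (rule fundamental_theorem_of_calculus[OF uv(2)])
      fix t
      have "((\<lambda>t. c * ((-1) ^ k * (- cos (a * t) / a))) has_real_derivative c * ((-1) ^ k * sin (a * t))) (at t)"
        using a by (auto intro!: derivative_eq_intros)
      then show "((\<lambda>t. c * ((-1) ^ k * (- cos (a * t) / a))) has_vector_derivative c * ((-1) ^ k * sin (a * t))) (at t within {u..v})"
        by (simp add: has_real_derivative_iff_has_vector_derivative has_vector_derivative_at_within)
    qed
    also have "c * ((-1) ^ k * (- cos (a * v) / a)) - c * ((-1) ^ k * (- cos (a * u) / a)) = 4 / pi * inverse (real (Suc k))"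
    proof -
      have "a * v = real (Suc k) * pi" "a * u = real k * pi" using a by (simp_all add: u_def v_def)
      then have "cos (a * v) = - ((-1) ^ k)" "cos (a * u) = (-1) ^ k"
        by (simp_all only: cos_npi) simp
      moreover have "(-1::real) ^ k * (-1) ^ k = 1" by (simp flip: power_add mult_2)
      ultimately have "c * ((-1) ^ k * (- cos (a * v) / a)) - c * ((-1) ^ k * (- cos (a * u) / a)) = 2 * c / a"
        by simp
      then show ?thesis using a by (simp add: c_def divide_inverse)
    qed
    finally have I: "((\<lambda>t. c * ((-1) ^ k * sin (a * t))) has_integral 4 / pi * inverse (real (Suc k))) {u..v}" .
    have "4 / pi * inverse (real (Suc k)) \<le> integral {u..v} D"
    proof (rule has_integral_le[OF I integrable_integral[OF intD]])
      fix t assume t: "t \<in> {u..v}"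
      have "real (Suc k) * pi / a \<le> a * pi / a"
        using Suc.prems a by (intro divide_right_mono mult_right_mono) (auto simp: a_def)
      then have "v \<le> pi" using a by (simp add: v_def)
      then have s: "0 \<le> sin (t / 2)" "sin (t / 2) \<le> t / 2"
        using t uv sin_x_le_x[of "t / 2"] by (auto intro!: sin_ge_zero)
      have "(-1) ^ k * sin (a * t) \<le> \<bar>sin (a * t)\<bar>"
        using abs_ge_self[of "(-1) ^ k * sin (a * t)"] by (simp add: abs_mult)
      also have "\<dots> = sin (t / 2) * D t"
        using s by (simp add: a_def D_def dirichlet_kernel[symmetric] abs_mult)
      also have "\<dots> \<le> v / 2 * D t"
        using s t by (intro mult_right_mono) (auto simp: D_def)
      finally have "c * ((-1) ^ k * sin (a * t)) \<le> c * (v / 2 * D t)"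
        using c by (intro mult_left_mono) auto
      also have "\<dots> = (c * v) * D t / 2" by simp
      finally show "c * ((-1) ^ k * sin (a * t)) \<le> D t" using c by simp
    qed
    moreover have "4 / pi * harm k \<le> integral {0..u} D"
      using Suc by (simp add: u_def)
    moreover have "integral {0..u} D + integral {u..v} D = integral {0..v} D"
      by (rule Henstock_Kurzweil_Integration.integral_combine[OF uv intD])
    ultimately show ?case by (simp add: harm_Suc v_def distrib_left)
  qed (simp add: harm_def)
  then have "4 / pi * harm n \<le> integral {0..real n * pi / a} D" by simp
  also have "\<dots> \<le> integral {0..pi} D"
  proof (rule integral_subset_le)
    have "real n * pi / a \<le> pi" using a by (simp add: a_def field_simps)
    then show "{0..real n * pi / a} \<subseteq> {0..pi}" by auto
  qed (auto simp: intD D_def)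
  finally show ?thesis by (simp add: D_def[abs_def])
qed

text \<open>The Dirichlet kernel is at most twice this kernel plus 1 in absolute value; the 1
  integrates to pi, which becomes the -1.\<close>

lemma cosine_kernel_lower_bound:
  "pi * (1 / 2 * (4 / pi\<^sup>2 * harm n - 1)) \<le> integral {0..pi} (\<lambda>t. \<bar>cosine_kernel n t\<bar>)"
proof -
  have int: "continuous_on {0..pi} f \<Longrightarrow> f integrable_on {0..pi}" for f :: "real \<Rightarrow> real"
    by (rule integrable_continuous_real)
  have "integral {0..pi} (\<lambda>t. \<bar>2 * cosine_kernel n t - 1\<bar>) \<le> integral {0..pi} (\<lambda>t. 2 * \<bar>cosine_kernel n t\<bar> + 1)"
    by (intro integral_le int continuous_intros continuous_cosine_kernel) auto
  also have "\<dots> = 2 * integral {0..pi} (\<lambda>t. \<bar>cosine_kernel n t\<bar>) + pi"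
  proof -
    have "integral {0..pi} (\<lambda>t. 1::real) = pi" by simp
    then show ?thesis
      by (subst integral_add) (auto intro!: int continuous_intros continuous_cosine_kernel)
  qed
  finally have "4 / pi * harm n \<le> 2 * integral {0..pi} (\<lambda>t. \<bar>cosine_kernel n t\<bar>) + pi"
    using dirichlet_lower_bound[of n] by linarith
  moreover have "pi * (1 / 2 * (4 / pi\<^sup>2 * harm n - 1)) = (4 / pi * harm n - pi) / 2"
    by (simp add: field_simps power2_eq_square)
  ultimately show ?thesis by simp
qed

section \<open>The two bounds for the operator norm\<close>

theorem (in fekete_family) interpolation_op_norm_ge:
  "ereal (1 / 2 * (4 / pi\<^sup>2 * ln (real n) - 1)) \<le> interpolation_op_norm (Suc n) (arc_segments (Suc n) \<rho> \<tau>)"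
proof (rule ccontr)
  let ?c = "1 / 2 * (4 / pi\<^sup>2 * ln (real n) - 1)"
  let ?X = "interpolation_op_norm (Suc n) (arc_segments (Suc n) \<rho> \<tau>)"
  let ?I = "segment_interpolant (Suc n) (arc_segments (Suc n) \<rho> \<tau>)"
  assume "\<not> ereal ?c \<le> ?X"
  then have less: "?X < ereal ?c" by simp
  have le: "ereal (sup_norm (poly (?I f))) \<le> ?X" if "continuous_on {-1..1} f" "sup_norm f \<le> 1" for f
    unfolding interpolation_op_norm_def using that by (intro SUP_upper) auto
  \<comment> \<open>The zero function keeps the supremum above minus infinity; lying below a real
    number, it is then a real \<open>b\<close>.\<close>
  have "ereal (sup_norm (poly (?I (\<lambda>_. 0)))) \<le> ?X" by (rule le) (auto simp: sup_norm_def)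
  then obtain b where b: "?X = ereal b" using less by (cases ?X) auto
  have "sup_norm (poly (?I f)) \<le> b" if "continuous_on {-1..1} f" "sup_norm f \<le> 1" for f
    using le[OF that] b by simp
  then have "integral {0..pi} (\<lambda>t. \<bar>cosine_kernel n t\<bar>) \<le> pi * b"
    by (rule interpolation_norm_ge_kernel)
  then have "pi * (1 / 2 * (4 / pi\<^sup>2 * harm n - 1)) \<le> pi * b"
    using cosine_kernel_lower_bound[of n] by linarith
  then have "1 / 2 * (4 / pi\<^sup>2 * harm n - 1) \<le> b" by (simp only: mult_le_cancel_left_pos pi_gt_zero)
  moreover have "ln (real n) \<le> harm n"
  proof -
    have "ln (real n) \<le> ln (real n + 1)" using n by simp
    then show ?thesis using ln_le_harm[of n] by linarith
  qed
  then have "4 / pi\<^sup>2 * ln (real n) \<le> 4 / pi\<^sup>2 * harm n" by (rule mult_left_mono) simp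
  ultimately have "?c \<le> b" by simp
  then show False using less b by simp
qed

theorem (in fekete_family) interpolation_op_norm_le:
  assumes mult: "even_multiplier \<beta> L" "(real n + 1) * \<rho> \<le> L" "L < pi"
      "\<And>t. 0 < \<bar>t\<bar> \<Longrightarrow> \<bar>t\<bar> \<le> L \<Longrightarrow> even_multiplier.psi \<beta> t = t / sin t"
    and h: "real n * (2 * tan \<rho>) \<le> h"
  shows "interpolation_op_norm (Suc n) (arc_segments (Suc n) \<rho> \<tau>) \<le>
    ereal ((even_multiplier.C0 \<beta> L + 2 * even_multiplier.C1 \<beta> L) * (cosh h * (2 * (1 + 72 * harm n))))"
  unfolding interpolation_op_norm_def
proof (rule SUP_least)
  fix f :: "real \<Rightarrow> real"
  assume "f \<in> {f. continuous_on {- 1..1} f \<and> sup_norm f \<le> 1}"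
  then have f: "continuous_on {-1..1} f" "\<And>y. y \<in> {-1..1} \<Longrightarrow> \<bar>f y\<bar> \<le> 1"
    using abs_le_sup_norm[of f] by force+
  interpret M: even_multiplier \<beta> L by fact
  have "tan \<rho> \<ge> 0" using cos_rho_pos rho rho_less by (simp add: tan_def sin_ge_zero)
  then have "cosh (real n * (2 * tan \<rho>)) \<le> cosh h"
    using h by (subst cosh_real_nonneg_le_iff) (auto intro: order.trans[OF _ h])
  then have "(M.C0 + 2 * M.C1) * (cosh (real n * (2 * tan \<rho>)) * (2 * (1 + 72 * harm n)))
      \<le> (M.C0 + 2 * M.C1) * (cosh h * (2 * (1 + 72 * harm n)))"
    using M.C_nonneg harm_nonneg[of n, where ?'a = real] by (intro mult_left_mono mult_right_mono) auto
  moreover have "sup_norm (poly (segment_interpolant (Suc n) (arc_segments (Suc n) \<rho> \<tau>) f))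
     \<le> (M.C0 + 2 * M.C1) * (cosh (real n * (2 * tan \<rho>)) * (2 * (1 + 72 * harm n)))"
    by (intro sup_norm_le interpolant_le[OF mult fekete_lebesgue_constant f])
  ultimately show "ereal (sup_norm (poly (segment_interpolant (Suc n) (arc_segments (Suc n) \<rho> \<tau>) f)))
    \<le> ereal ((M.C0 + 2 * M.C1) * (cosh h * (2 * (1 + 72 * harm n))))"
    by simp
qed

theorem proposition18:
  fixes lam :: real
  assumes "0 < lam" and "lam < 1"
  shows "\<exists>C::real. \<forall>r::nat. \<forall>\<rho>::real. \<forall>B::nat \<Rightarrow> real poly. \<forall>\<tau>::nat \<Rightarrow> real.
           2 \<le> r \<longrightarrow> \<rho> = lam * (pi / real r) \<longrightarrow> poly_basis r B \<longrightarrow> fekete_angles B r \<rho> \<tau> \<longrightarrow>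
             ereal (1 / 2 * (4 / pi\<^sup>2 * ln (real r - 1) - 1))
               \<le> interpolation_op_norm r (arc_segments r \<rho> \<tau>) \<and>
             interpolation_op_norm r (arc_segments r \<rho> \<tau>) \<le> ereal (C * ln (real r))"
proof -
  \<comment> \<open>For every r this equals r * \<rho>, so one multiplier and its constants serve
    all r.\<close>
  define L where "L = lam * pi"
  have L: "0 < L" "L < pi" using assms by (auto simp: L_def)
  obtain \<beta> where \<beta>: "even_multiplier \<beta> L"
    "\<And>t. 0 < \<bar>t\<bar> \<Longrightarrow> \<bar>t\<bar> \<le> L \<Longrightarrow> even_multiplier.psi \<beta> t = t / sin t"
    using even_multiplier_exists[OF L] by blast
  interpret M: even_multiplier \<beta> L by fact
  \<comment> \<open>From r >= 2 follows \<rho> <= L / 2, hence tan \<rho> <= \<rho> / cos (L / 2);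
    multiplied by 2 n < 2 r this stays below \<open>h\<close>.\<close>
  define h where "h = 2 * L / cos (L / 2)"
  \<comment> \<open>The estimate harm n <= 1 + ln n produces 73 + 72 ln r, and r >= 2 absorbs the
    constant through 73 <= 73 ln r / ln 2.\<close>
  define C where "C = (M.C0 + 2 * M.C1) * (cosh h * (2 * (73 / ln 2 + 72)))"
  have cosL: "cos (L / 2) > 0" using L by (intro cos_gt_zero_pi) auto
  show ?thesis
  proof (intro exI[of _ C] allI impI)
    fix r :: nat and \<rho> :: real and B :: "nat \<Rightarrow> real poly" and \<tau> :: "nat \<Rightarrow> real"
    assume r: "2 \<le> r" and \<rho>: "\<rho> = lam * (pi / real r)" and B: "poly_basis r B" and fek: "fekete_angles B r \<rho> \<tau>"
    define n where "n = r - 1"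
    have rn: "r = Suc n" "n > 0" "real n = real r - 1" using r by (auto simp: n_def)
    have rhoL: "(real n + 1) * \<rho> = L" using rn by (simp add: \<rho> L_def)
    have rho0: "\<rho> > 0" using assms rn by (simp add: \<rho>)
    interpret fekete_family n \<rho> \<tau> B
      by unfold_locales (use B fek rn rhoL rho0 L in \<open>auto simp: fekete_angles_def\<close>)
    have h: "real n * (2 * tan \<rho>) \<le> h"
    proof -
      have "2 * \<rho> \<le> (real n + 1) * \<rho>" using n rho0 by (intro mult_right_mono) auto
      then have "2 * \<rho> \<le> L" using rhoL by linarith
      then have "cos (L / 2) \<le> cos \<rho>" using rho0 L by (intro cos_monotone_0_pi_le) auto
      then have "tan \<rho> \<le> \<rho> / cos (L / 2)"
        unfolding tan_def using rho0 cosL sin_x_le_x[of \<rho>] by (intro frac_le) auto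
      moreover have "0 \<le> tan \<rho>"
        using rho0 rho_less cos_rho_pos by (simp add: tan_def sin_ge_zero)
      ultimately have "real n * (2 * tan \<rho>) \<le> (real n + 1) * (2 * (\<rho> / cos (L / 2)))"
        using rho0 cosL by (intro mult_mono) auto
      also have "\<dots> = h" by (simp add: h_def flip: rhoL)
      finally show ?thesis .
    qed
    have "(M.C0 + 2 * M.C1) * (cosh h * (2 * (1 + 72 * harm n))) \<le> C * ln (real r)"
    proof -
      have "harm n \<le> 1 + ln (real n)"
        using euler_mascheroni_sequence_decreasing[of 1 n] n by (simp add: harm_expand)
      moreover have "ln (real n) \<le> ln (real r)" "ln 2 \<le> ln (real r)" using rn r n by auto
      moreover from this have "1 \<le> ln (real r) / ln 2" by simp
      ultimately have "1 + 72 * harm n \<le> 73 * (ln (real r) / ln 2) + 72 * ln (real r)" by linarith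
      then have "1 + 72 * harm n \<le> (73 / ln 2 + 72) * ln (real r)" by (simp add: algebra_simps)
      then have "(M.C0 + 2 * M.C1) * (cosh h * (2 * (1 + 72 * harm n)))
          \<le> (M.C0 + 2 * M.C1) * (cosh h * (2 * ((73 / ln 2 + 72) * ln (real r))))"
        using M.C_nonneg by (intro mult_left_mono) auto
      then show ?thesis by (simp only: C_def mult.assoc)
    qed
    moreover have "interpolation_op_norm (Suc n) (arc_segments (Suc n) \<rho> \<tau>)
        \<le> ereal ((M.C0 + 2 * M.C1) * (cosh h * (2 * (1 + 72 * harm n))))"
      by (rule interpolation_op_norm_le[OF \<beta>(1) _ L(2) \<beta>(2) h]) (simp_all add: rhoL)
    ultimately have "interpolation_op_norm r (arc_segments r \<rho> \<tau>) \<le> ereal (C * ln (real r))"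
      unfolding rn(1) by (meson ereal_less_eq(3) order.trans)
    moreover have "ereal (1 / 2 * (4 / pi\<^sup>2 * ln (real r - 1) - 1)) \<le> interpolation_op_norm r (arc_segments r \<rho> \<tau>)"
      using interpolation_op_norm_ge unfolding rn(3) rn(1) .
    ultimately show "ereal (1 / 2 * (4 / pi\<^sup>2 * ln (real r - 1) - 1)) \<le> interpolation_op_norm r (arc_segments r \<rho> \<tau>)
      \<and> interpolation_op_norm r (arc_segments r \<rho> \<tau>) \<le> ereal (C * ln (real r))"
      by (rule conjI[rotated])
  qed
qed

end
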